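(* Let $K$ and $L$ be number fields, with adele rings $\mathbb{A}_K$ and $\mathbb{A}_L$. If $\mathbb{A}_K$ and $\mathbb{A}_L$ are elementarily equivalent in the first-order language of rings, then $\mathbb{A}_K$ and $\mathbb{A}_L$ are isomorphic.
   Context: A number field is a finite extension of $\mathbb{Q}$. For a number field $K$, the adele ring $\mathbb{A}_K$ is the restricted direct product, over all places $v$ of $K$ (archimedean and non-archimedean), of the completions $K_v$ with respect to the valuation rings $\mathcal{O}_v\subset K_v$ at the non-archimedean places; that is, the ring of all $(x_v)_v\in\prod_v K_v$ with $x_v\in\mathcal{O}_v$ for all but finitely many non-archimedean $v$, with componentwise operations. Two rings are elementarily equivalent if they satisfy the same first-order sentences in the language of rings $\{+,-,\cdot,0,1\}$. *)

theory Defs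
  imports Complex_Main "HOL-Algebra.QuotRing"
begin

definition number_field :: "'a::field_char_0 itself \<Rightarrow> bool" where
  "number_field _ \<longleftrightarrow>
     (\<exists>B::'a set. finite B \<and> module.span (\<lambda>q x. of_rat q * x) B = UNIV)"

definition absolute_value :: "('a::field \<Rightarrow> real) \<Rightarrow> bool" where
  "absolute_value f \<longleftrightarrow>
     (\<forall>x. 0 \<le> f x) \<and>
     (\<forall>x. f x = 0 \<longleftrightarrow> x = 0) \<and>
     (\<forall>x y. f (x * y) = f x * f y) \<and>
     (\<forall>x y. f (x + y) \<le> f x + f y)"

definition nontrivial_absolute_value :: "('a::field \<Rightarrow> real) \<Rightarrow> bool" where
  "nontrivial_absolute_value f \<longleftrightarrow> absolute_value f \<and> (\<exists>x. x \<noteq> 0 \<and> f x \<noteq> 1)"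

definition nonarchimedean :: "('a::field \<Rightarrow> real) \<Rightarrow> bool" where
  "nonarchimedean f \<longleftrightarrow> (\<forall>x y. f (x + y) \<le> max (f x) (f y))"

definition equivalent_absolute_values :: "(('a::field \<Rightarrow> real) \<times> ('a \<Rightarrow> real)) set" where
  "equivalent_absolute_values =
     {(f, g). nontrivial_absolute_value f \<and> nontrivial_absolute_value g \<and>
              (\<exists>s>0. \<forall>x. g x = f x powr s)}"

definition places :: "('a::field \<Rightarrow> real) set set" where
  "places = {f. nontrivial_absolute_value f} // equivalent_absolute_values"

text \<open>
  An arbitrary absolute value in the class \<open>v\<close>. It is only used for notions that do not
  change when an absolute value is replaced by a positive power of itself: Cauchy and null
  sequences, the ultrametric inequality, and the closed unit ball.
\<close>

definition place_abs :: "('a::field \<Rightarrow> real) set \<Rightarrow> 'a \<Rightarrow> real" where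
  "place_abs v = (SOME f. f \<in> v)"

definition cauchy_ring :: "('a::field \<Rightarrow> real) \<Rightarrow> (nat \<Rightarrow> 'a) ring" where
  "cauchy_ring f =
     \<lparr>carrier = {x. \<forall>e>0. \<exists>N. \<forall>m\<ge>N. \<forall>n\<ge>N. f (x m - x n) < e},
      mult = (\<lambda>x y n. x n * y n), one = (\<lambda>n. 1),
      zero = (\<lambda>n. 0), add = (\<lambda>x y n. x n + y n)\<rparr>"

definition null_sequences :: "('a::field \<Rightarrow> real) \<Rightarrow> (nat \<Rightarrow> 'a) set" where
  "null_sequences f = {x. (\<lambda>n. f (x n)) \<longlonglongrightarrow> 0}"

definition field_completion :: "('a::field \<Rightarrow> real) \<Rightarrow> (nat \<Rightarrow> 'a) set ring" where
  "field_completion f = cauchy_ring f Quot null_sequences f"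

text \<open>
  The continuous extension of \<open>f\<close> to the completion; the limit is the same for every
  Cauchy sequence \<open>x\<close> in the coset \<open>X\<close>.
\<close>

definition completion_abs :: "('a::field \<Rightarrow> real) \<Rightarrow> (nat \<Rightarrow> 'a) set \<Rightarrow> real" where
  "completion_abs f X = lim (\<lambda>n. f ((SOME x. x \<in> X) n))"

definition valuation_ring :: "('a::field \<Rightarrow> real) \<Rightarrow> (nat \<Rightarrow> 'a) set set" where
  "valuation_ring f = {X \<in> carrier (field_completion f). completion_abs f X \<le> 1}"

abbreviation completion_at :: "('a::field \<Rightarrow> real) set \<Rightarrow> (nat \<Rightarrow> 'a) set ring" where
  "completion_at v \<equiv> field_completion (place_abs v)"

text \<open>
  All completions of a field of type \<open>'k\<close> have carriers in the type \<open>(nat \<Rightarrow> 'k) set\<close>, so an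
  adele is a function on places, made extensional (\<open>undefined\<close> off \<open>places\<close>).
\<close>

type_synonym 'k adele = "('k \<Rightarrow> real) set \<Rightarrow> (nat \<Rightarrow> 'k) set"

definition adele_ring :: "'k::field itself \<Rightarrow> 'k adele ring" where
  "adele_ring _ =
     \<lparr>carrier = {x \<in> (\<Pi>\<^sub>E v\<in>places. carrier (completion_at v)).
                  finite {v \<in> places. nonarchimedean (place_abs v) \<and>
                                      x v \<notin> valuation_ring (place_abs v)}},
      mult = (\<lambda>x y. \<lambda>v\<in>places. x v \<otimes>\<^bsub>completion_at v\<^esub> y v),
      one = (\<lambda>v\<in>places. \<one>\<^bsub>completion_at v\<^esub>),
      zero = (\<lambda>v\<in>places. \<zero>\<^bsub>completion_at v\<^esub>),
      add = (\<lambda>x y. \<lambda>v\<in>places. x v \<oplus>\<^bsub>completion_at v\<^esub> y v)\<rparr>"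

datatype ring_term =
    Var nat
  | Zero
  | One
  | Plus ring_term ring_term
  | Minus ring_term ring_term
  | Times ring_term ring_term

datatype ring_formula =
    Equal ring_term ring_term
  | Negation ring_formula
  | Conj ring_formula ring_formula
  | Forall nat ring_formula

primrec term_vars :: "ring_term \<Rightarrow> nat set" where
  "term_vars (Var i) = {i}"
| "term_vars Zero = {}"
| "term_vars One = {}"
| "term_vars (Plus s t) = term_vars s \<union> term_vars t"
| "term_vars (Minus s t) = term_vars s \<union> term_vars t"
| "term_vars (Times s t) = term_vars s \<union> term_vars t"

primrec free_vars :: "ring_formula \<Rightarrow> nat set" where
  "free_vars (Equal s t) = term_vars s \<union> term_vars t"
| "free_vars (Negation p) = free_vars p"
| "free_vars (Conj p q) = free_vars p \<union> free_vars q"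
| "free_vars (Forall i p) = free_vars p - {i}"

primrec term_value :: "('a, 'm) ring_scheme \<Rightarrow> (nat \<Rightarrow> 'a) \<Rightarrow> ring_term \<Rightarrow> 'a" where
  "term_value R e (Var i) = e i"
| "term_value R e Zero = \<zero>\<^bsub>R\<^esub>"
| "term_value R e One = \<one>\<^bsub>R\<^esub>"
| "term_value R e (Plus s t) = term_value R e s \<oplus>\<^bsub>R\<^esub> term_value R e t"
| "term_value R e (Minus s t) = term_value R e s \<ominus>\<^bsub>R\<^esub> term_value R e t"
| "term_value R e (Times s t) = term_value R e s \<otimes>\<^bsub>R\<^esub> term_value R e t"

primrec satisfies :: "('a, 'm) ring_scheme \<Rightarrow> (nat \<Rightarrow> 'a) \<Rightarrow> ring_formula \<Rightarrow> bool" where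
  "satisfies R e (Equal s t) \<longleftrightarrow> term_value R e s = term_value R e t"
| "satisfies R e (Negation p) \<longleftrightarrow> \<not> satisfies R e p"
| "satisfies R e (Conj p q) \<longleftrightarrow> satisfies R e p \<and> satisfies R e q"
| "satisfies R e (Forall i p) \<longleftrightarrow> (\<forall>a\<in>carrier R. satisfies R (e(i := a)) p)"

definition sentence :: "ring_formula \<Rightarrow> bool" where
  "sentence p \<longleftrightarrow> free_vars p = {}"

definition holds_in :: "('a, 'm) ring_scheme \<Rightarrow> ring_formula \<Rightarrow> bool" where
  "holds_in R p \<longleftrightarrow> (\<forall>e. range e \<subseteq> carrier R \<longrightarrow> satisfies R e p)"

definition elementarily_equivalent ::
    "('a, 'm) ring_scheme \<Rightarrow> ('b, 'n) ring_scheme \<Rightarrow> bool" where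
  "elementarily_equivalent R S \<longleftrightarrow> (\<forall>p. sentence p \<longrightarrow> (holds_in R p \<longleftrightarrow> holds_in S p))"

end

theory Submission
  imports Defs "HOL-Algebra.Polynomial_Divisibility" "HOL-Computational_Algebra.Fundamental_Theorem_Algebra"
begin

text \<open>
  The minimal idempotents of an adele ring correspond to the places, and the factor cut out by such
  an idempotent is the completion. Hence the number of completions that satisfy a given first-order
  sentence, if finite, is determined by the theory of the adele ring. Each completion satisfies a sentence
  that holds at only finitely many places, so it remains to see that elementarily equivalent completions
  are isomorphic.

  Over a prime \<open>p\<close>, take a prime \<open>l \<noteq> p\<close> above the degree. No \<open>l\<close>-th power has an absolute value
  in the interval from that of \<open>p\<close> (included) to \<open>1\<close> (excluded), so by Hensel's lemma the valuation ring
  consists of the \<open>x\<close> for which \<open>1 + p x ^ l\<close> is an \<open>l\<close>-th power. This definition isolates the places over \<open>p\<close>, and together with weak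
  approximation it lets a sentence say that \<open>K\<close> embeds compatibly with the place \<open>v\<close>. Equivalent
  completions therefore embed in each other, and the composite endomorphism has a power
  that fixes \<open>K\<close>, because it permutes roots of polynomials over \<open>\<rat>\<close>; by density this power is the identity.

  Archimedean completions are isomorphic to \<open>\<real>\<close> or \<open>\<complex>\<close>, which differ in whether \<open>-1\<close> is a square; they
  are the ones in which every element has an \<open>l\<close>-th root.
\<close>

section \<open>Absolute values\<close>

text \<open>A sentence can say neither that a map is onto nor that it is continuous. Surjectivity
  comes from embeddings in both directions; continuity from a positive exponent, carried along with
  each homomorphism, by which it scales absolute values. The exponent also shows that the
  isomorphisms of non-archimedean completions respect valuation rings, as the restricted product
  demands. An embedding of \<open>K\<close> in a completion of \<open>L\<close> over
  \<open>p\<close> induces some place of \<open>K\<close> over \<open>p\<close>. To force the right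
  one, the sentence also asserts integrality of the image of one element that is integral at
  \<open>v\<close> and at no other place over \<open>p\<close>. The bound on \<open>l\<close>
  reflects the degree through linear independence: if \<open>z\<close> has absolute value below
  \<open>1\<close> and its \<open>l\<close>-th power is at least as large as \<open>p\<close>, then
  \<open>1, z, ..., z ^ (l - 1)\<close> are independent over \<rat>. An \<open>l\<close> above both
  degrees makes the same formula work for both fields. A theory is infinite, so places with a given
  theory can be counted only through one sentence that has finitely many models and whose models all
  have that theory.\<close>

lemma av_nonneg [simp]: "absolute_value f \<Longrightarrow> 0 \<le> f x"
  and av_zero_iff [simp]: "absolute_value f \<Longrightarrow> f x = 0 \<longleftrightarrow> x = 0"
  and av_mult: "absolute_value f \<Longrightarrow> f (x * y) = f x * f y"
  and av_triangle: "absolute_value f \<Longrightarrow> f (x + y) \<le> f x + f y"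
  by (auto simp: absolute_value_def)

lemma av_0 [simp]: "absolute_value f \<Longrightarrow> f 0 = 0"
  by simp

lemma av_pos_iff [simp]: "absolute_value f \<Longrightarrow> 0 < f x \<longleftrightarrow> x \<noteq> 0"
  using av_nonneg[of f x] av_zero_iff[of f x] by linarith

lemma av_1 [simp]: "absolute_value f \<Longrightarrow> f 1 = 1"
  using av_mult[of f 1 1] av_zero_iff[of f 1] by simp

lemma av_minus [simp]: assumes "absolute_value f" shows "f (- x) = f x"
proof -
  have "f (-1) * f (-1) = 1"
    using av_mult[OF assms, of "-1" "-1"] assms by simp
  then have "f (-1) = 1"
    using av_nonneg[OF assms, of "-1"] by (metis abs_of_nonneg abs_mult_self_eq real_sqrt_abs2 real_sqrt_one)
  then show ?thesis
    using av_mult[OF assms, of "-1" x] by simp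
qed

lemma av_diff_commute: "absolute_value f \<Longrightarrow> f (x - y) = f (y - x)"
  using av_minus[of f "x - y"] by simp

lemma av_triangle_diff: "absolute_value f \<Longrightarrow> f (x - y) \<le> f x + f y"
  using av_triangle[of f x "-y"] by simp

lemma av_abs_diff: "absolute_value f \<Longrightarrow> \<bar>f x - f y\<bar> \<le> f (x - y)"
  using av_triangle[of f "x - y" y] av_triangle[of f "y - x" x] av_diff_commute[of f x y]
  by simp

lemma av_power: "absolute_value f \<Longrightarrow> f (x ^ n) = f x ^ n"
  by (induction n) (auto simp: av_mult)

lemma av_inverse: assumes "absolute_value f" shows "f (inverse x) = inverse (f x)"
proof (cases "x = 0")
  case False
  then have "f x * f (inverse x) = 1"
    using assms av_mult[OF assms, of x "inverse x"] by simp
  then show ?thesis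
    by (metis inverse_unique)
qed (use assms in auto)

lemma av_divide: "absolute_value f \<Longrightarrow> f (x / y) = f x / f y"
  by (simp add: divide_inverse av_mult av_inverse)

lemma av_power_int: "absolute_value f \<Longrightarrow> f (x powi n) = f x powi n"
  by (simp add: power_int_def av_power av_inverse)

lemma av_sum: "absolute_value f \<Longrightarrow> f (\<Sum>i\<in>I. g i) \<le> (\<Sum>i\<in>I. f (g i))"
proof (induction I rule: infinite_finite_induct)
  case (insert x F)
  then show ?case
    using av_triangle[of f "g x" "sum g F"] by simp
qed auto

lemma av_of_nat_le: "absolute_value f \<Longrightarrow> f (of_nat n) \<le> real n"
proof (induction n)
  case (Suc n)
  then show ?case
    using av_triangle[of f 1 "of_nat n"] by simp
qed auto

lemma nontrivial_av: "nontrivial_absolute_value f \<Longrightarrow> absolute_value f"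
  by (simp add: nontrivial_absolute_value_def)

lemma nontrivial_gt_1:
  assumes "nontrivial_absolute_value f"
  obtains c where "f c > 1"
proof -
  note a = nontrivial_av[OF assms]
  obtain x where "x \<noteq> 0" "f x \<noteq> 1"
    using assms by (auto simp: nontrivial_absolute_value_def)
  show ?thesis
  proof (cases "f x > 1")
    case True then show ?thesis using that by blast
  next
    case False
    then have "f (inverse x) > 1"
      using \<open>x \<noteq> 0\<close> \<open>f x \<noteq> 1\<close> a by (simp add: av_inverse one_less_inverse)
    then show ?thesis using that by blast
  qed
qed

section \<open>Equivalence and separation of absolute values\<close>

lemma ln_power_int_real:
  assumes "(x::real) > 0"
  shows "ln (x powi n) = of_int n * ln x"
proof -
  have "x powi n = x powr of_int n"
    using assms by (simp add: powr_real_of_int')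
  then show ?thesis
    using assms by (simp add: ln_powr)
qed

text \<open>Comparing powers of \<open>x\<close> with powers of a fixed \<open>c\<close> of value
  above \<open>1\<close> turns the inclusion of open unit balls into an inequality between
  logarithms to the bases \<open>f c\<close> and \<open>g c\<close>. Applied to
  \<open>inverse x\<close> as well it becomes an equality, and the exponent is
  \<open>ln (g c) / ln (f c)\<close>.\<close>

lemma equivalent_if_unit_ball:
  assumes f: "nontrivial_absolute_value f" and g: "nontrivial_absolute_value g"
    and fg: "\<And>x. f x < 1 \<Longrightarrow> g x < 1"
  shows "(f, g) \<in> equivalent_absolute_values"
proof -
  note af = nontrivial_av[OF f] and ag = nontrivial_av[OF g]
  obtain c where c: "f c > 1" using nontrivial_gt_1[OF f] by blast
  then have "c \<noteq> 0" using af by force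
  have "f (inverse c) < 1"
    using c by (simp add: av_inverse[OF af] inverse_less_1_iff)
  then have "g (inverse c) < 1" by (rule fg)
  then have gc: "g c > 1"
    using \<open>c \<noteq> 0\<close> av_pos_iff[OF ag, of c] by (simp add: av_inverse[OF ag] inverse_less_1_iff del: av_pos_iff)
  define s where "s = ln (g c) / ln (f c)"
  have s: "s > 0" using c gc by (simp add: s_def)
  \<comment> \<open>A rational \<open>m / n\<close> strictly between the two sides would give
    \<open>x ^ n / c powi m\<close> an \<open>f\<close>-value below \<open>1\<close> but a
    \<open>g\<close>-value above \<open>1\<close>.\<close>
  have le: "ln (g x) / ln (g c) \<le> ln (f x) / ln (f c)" if "x \<noteq> 0" for x
  proof (rule ccontr)
    assume "\<not> ?thesis"
    then obtain q where q: "q \<in> \<rat>" "ln (f x) / ln (f c) < q" "q < ln (g x) / ln (g c)"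
      using Rats_dense_in_real[of "ln (f x) / ln (f c)" "ln (g x) / ln (g c)"] by auto
    from q(1) obtain m :: int and n :: nat where n: "n > 0" "q = of_int m / of_nat n"
      by (auto simp: Rats_eq_int_div_nat)
    let ?y = "x ^ n / c powi m"
    have fx: "f x > 0" "g x > 0" using that af ag by auto
    have "real n * ln (f x) < of_int m * ln (f c)"
      using q(2) n c by (simp add: field_simps)
    then have "ln (f x ^ n) < ln (f c powi m)"
      using fx c by (simp add: ln_realpow ln_power_int_real)
    then have "f x ^ n < f c powi m"
      using fx c by (subst (asm) ln_less_cancel_iff) auto
    then have "f ?y < 1"
      using c by (simp add: av_divide[OF af] av_power[OF af] av_power_int[OF af])
    then have "g ?y < 1" by (rule fg)
    then have "g x ^ n < g c powi m"
      using gc by (simp add: av_divide[OF ag] av_power[OF ag] av_power_int[OF ag])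
    then have "ln (g x ^ n) < ln (g c powi m)"
      using fx gc by (subst ln_less_cancel_iff) auto
    then have "real n * ln (g x) < of_int m * ln (g c)"
      using fx gc by (simp add: ln_realpow ln_power_int_real)
    then show False
      using q(3) n gc by (simp add: field_simps)
  qed
  have eq: "ln (g x) / ln (g c) = ln (f x) / ln (f c)" if "x \<noteq> 0" for x
    using le[OF that] le[of "inverse x"] that af ag c gc
    by (simp add: av_inverse ln_inverse)
  have "g x = f x powr s" for x
  proof (cases "x = 0")
    case False
    have "ln (g x) = s * ln (f x)"
      using eq[OF False] c gc by (simp add: s_def field_simps)
    then have "exp (ln (g x)) = exp (s * ln (f x))" by simp
    then show ?thesis
      using False af ag by (simp add: powr_def)
  qed (use af ag in simp)
  then show ?thesis
    using f g s by (auto simp: equivalent_absolute_values_def)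
qed

lemma equiv_equivalent: "equiv {f :: 'a::field \<Rightarrow> real. nontrivial_absolute_value f} equivalent_absolute_values"
proof (rule equivI)
  show "refl_on {f :: 'a \<Rightarrow> real. nontrivial_absolute_value f} equivalent_absolute_values"
    by (rule refl_onI)
       (auto simp: equivalent_absolute_values_def dest: nontrivial_av intro!: exI[of _ "1::real"])
  show "sym (equivalent_absolute_values :: (('a \<Rightarrow> real) \<times> ('a \<Rightarrow> real)) set)"
  proof (rule symI)
    fix f g :: "'a \<Rightarrow> real" assume "(f, g) \<in> equivalent_absolute_values"
    then obtain s where s: "nontrivial_absolute_value f" "nontrivial_absolute_value g" "s > 0"
      "\<And>x. g x = f x powr s" by (auto simp: equivalent_absolute_values_def)
    have "f x = g x powr (1 / s)" for x
      using s nontrivial_av[OF s(1)] by (simp add: powr_powr)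
    then show "(g, f) \<in> equivalent_absolute_values"
      using s by (auto simp: equivalent_absolute_values_def intro!: exI[of _ "1 / s"])
  qed
  show "trans (equivalent_absolute_values :: (('a \<Rightarrow> real) \<times> ('a \<Rightarrow> real)) set)"
  proof (rule transI)
    fix f g h :: "'a \<Rightarrow> real"
    assume "(f, g) \<in> equivalent_absolute_values" "(g, h) \<in> equivalent_absolute_values"
    then obtain s t where s: "nontrivial_absolute_value f" "nontrivial_absolute_value h" "s > 0" "t > 0"
      "\<And>x. g x = f x powr s" "\<And>x. h x = g x powr t" by (auto simp: equivalent_absolute_values_def)
    then show "(f, h) \<in> equivalent_absolute_values"
      by (auto simp: equivalent_absolute_values_def powr_powr intro!: exI[of _ "s * t"])
  qed
qed (auto simp: equivalent_absolute_values_def)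

text \<open>Neither open unit ball contains the other. Elements witnessing the two failures have a
  quotient that is large for \<open>f\<close> and small for \<open>g\<close>.\<close>

lemma av_separate_pair:
  assumes f: "nontrivial_absolute_value f" and g: "nontrivial_absolute_value g"
    and fg: "(f, g) \<notin> equivalent_absolute_values"
  obtains a where "f a > 1" "g a < 1"
proof -
  note af = nontrivial_av[OF f] and ag = nontrivial_av[OF g]
  obtain x where x: "f x < 1" "g x \<ge> 1"
    using equivalent_if_unit_ball[OF f g] fg by (meson not_le)
  have "(g, f) \<notin> equivalent_absolute_values"
    using fg equiv_equivalent by (meson equivE symE)
  then obtain y where y: "g y < 1" "f y \<ge> 1"
    using equivalent_if_unit_ball[OF g f] by (meson not_le)
  have "x \<noteq> 0" using x ag by auto
  then have "f x > 0" "g x > 0" using af ag by auto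
  then have "f (y / x) > 1" "g (y / x) < 1"
    using x y by (auto simp: av_divide af ag field_simps)
  then show ?thesis using that by blast
qed

text \<open>The induction behind weak approximation: \<open>a\<close> deals with \<open>G\<close>,
  \<open>b\<close> with the new \<open>g\<close>, and a high power of \<open>a\<close>, or a
  fraction built from it, is multiplied by \<open>b\<close>.\<close>

lemma av_separate:
  assumes f: "nontrivial_absolute_value f"
    and "finite G" "\<And>g. g \<in> G \<Longrightarrow> nontrivial_absolute_value g"
      "\<And>g. g \<in> G \<Longrightarrow> (f, g) \<notin> equivalent_absolute_values"
  shows "\<exists>a. f a > 1 \<and> (\<forall>g\<in>G. g a < 1)"
  using assms(2-4)
proof (induction G rule: finite_induct)
  case empty
  then show ?case using nontrivial_gt_1[OF f] by auto
next
  case (insert g G)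
  note af = nontrivial_av[OF f]
  have g: "nontrivial_absolute_value g" using insert by auto
  note ag = nontrivial_av[OF g]
  obtain a where a: "f a > 1" "\<And>h. h \<in> G \<Longrightarrow> h a < 1" using insert by auto
  obtain b where b: "f b > 1" "g b < 1"
    using av_separate_pair[OF f g] insert by auto
  have ah: "absolute_value h" if "h \<in> G" for h
    using insert.prems that by (auto intro: nontrivial_av)
  have pow0: "(\<lambda>r. h a ^ r) \<longlonglongrightarrow> 0" if "h \<in> G" for h
    using a(2)[OF that] ah[OF that] by (intro LIMSEQ_power_zero) auto
  have "\<exists>a. f a > 1 \<and> g a < 1 \<and> (\<forall>h\<in>G. h a < 1)"
  proof (cases "g a \<le> 1")
    case True
    \<comment> \<open>As \<open>g a \<le> 1\<close>, the factor \<open>a ^ r\<close> makes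
      \<open>b\<close> small on \<open>G\<close> and does no harm at \<open>f\<close> and
      \<open>g\<close>.\<close>
    have "(\<lambda>r. h a ^ r * h b) \<longlonglongrightarrow> 0" if "h \<in> G" for h
      using tendsto_mult[OF pow0[OF that] tendsto_const[of "h b"]] by simp
    then have "\<forall>\<^sub>F r in sequentially. \<forall>h\<in>G. h a ^ r * h b < 1"
      using insert.hyps(1) by (intro eventually_ball_finite) (simp_all add: order_tendstoD(2)[OF _ zero_less_one])
    then obtain r where r: "\<And>h. h \<in> G \<Longrightarrow> h a ^ r * h b < 1"
      by (auto simp: eventually_sequentially)
    have "f (a ^ r * b) > 1"
      using a(1) b(1) by (simp add: av_mult[OF af] av_power[OF af] less_1_mult' one_le_power mult.commute)
    moreover have "g (a ^ r * b) < 1"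
    proof -
      have "g a ^ r * g b \<le> 1 * g b"
        using True ag by (intro mult_right_mono power_le_one) auto
      then show ?thesis using b(2) by (simp add: av_mult[OF ag] av_power[OF ag])
    qed
    ultimately show ?thesis
      using r ah by (intro exI[of _ "a ^ r * b"]) (auto simp: av_mult av_power)
  next
    case False
    \<comment> \<open>Now \<open>g a > 1\<close>: the fraction \<open>a ^ r / (1 + a ^ r)\<close>
      tends to \<open>1\<close> at \<open>f\<close> and \<open>g\<close> and to \<open>0\<close> on
      \<open>G\<close>, so its product with \<open>b\<close> works for large
      \<open>r\<close>.\<close>
    define t where "t r = a ^ r" for r
    have ft: "f (t r) = f a ^ r" "g (t r) = g a ^ r" for r
      by (auto simp: t_def av_power af ag)
    have inv0: "(\<lambda>r. inverse (f (t r))) \<longlonglongrightarrow> 0" "(\<lambda>r. inverse (g (t r))) \<longlonglongrightarrow> 0"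
      unfolding ft using a(1) False by (auto intro: LIMSEQ_inverse_realpow_zero)
    have "(\<lambda>r. f b * inverse (1 + inverse (f (t r)))) \<longlonglongrightarrow> f b * inverse (1 + 0)"
      by (intro tendsto_intros inv0) auto
    then have ev1: "\<forall>\<^sub>F r in sequentially. f b * inverse (1 + inverse (f (t r))) > 1"
      using b(1) by (intro order_tendstoD(1)[of _ "f b"]) auto
    have "(\<lambda>r. g b * inverse (1 - inverse (g (t r)))) \<longlonglongrightarrow> g b * inverse (1 - 0)"
      by (intro tendsto_intros inv0) auto
    then have ev2: "\<forall>\<^sub>F r in sequentially. g b * inverse (1 - inverse (g (t r))) < 1"
      using b(2) by (intro order_tendstoD(2)[of _ "g b"]) auto
    have "(\<lambda>r. h a ^ r * inverse (1 - h a ^ r) * h b) \<longlonglongrightarrow> 0 * inverse (1 - 0) * h b" if "h \<in> G" for h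
      by (intro tendsto_intros pow0[OF that]) auto
    then have ev3: "\<forall>\<^sub>F r in sequentially. \<forall>h\<in>G. h a ^ r * inverse (1 - h a ^ r) * h b < 1"
      using insert.hyps(1) by (intro eventually_ball_finite ballI order_tendstoD(2)[where y=0]) auto
    have ev4: "\<forall>\<^sub>F r in sequentially. \<forall>h\<in>G. h a ^ r < 1"
      using insert.hyps(1) pow0 by (intro eventually_ball_finite ballI order_tendstoD(2)[where y=0]) auto
    have ev5: "\<forall>\<^sub>F r in sequentially. f (t r) > 1" "\<forall>\<^sub>F r in sequentially. g (t r) > 1"
      unfolding ft using a(1) False
      by (auto intro!: eventually_mono[OF eventually_gt_at_top[of 0]] one_less_power)
    obtain r where r: "f b * inverse (1 + inverse (f (t r))) > 1" "g b * inverse (1 - inverse (g (t r))) < 1"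
      "\<And>h. h \<in> G \<Longrightarrow> h a ^ r * inverse (1 - h a ^ r) * h b < 1" "\<And>h. h \<in> G \<Longrightarrow> h a ^ r < 1"
      "f (t r) > 1" "g (t r) > 1"
      using eventually_happens[OF eventually_conj[OF ev1 eventually_conj[OF ev2 eventually_conj[OF ev3
        eventually_conj[OF ev4 eventually_conj[OF ev5]]]]]] by auto
    define T where "T = t r"
    have T1: "h (T / (1 + T) * b) = h T / h (1 + T) * h b"
      if "absolute_value h" for h by (auto simp: av_divide av_mult that)
    have f1: "f (1 + T) > 0" "f (1 + T) \<le> 1 + f T"
      using r(5) av_abs_diff[OF af, of T "-1"] av_triangle[OF af, of 1 T] af unfolding T_def by (auto simp: add.commute simp del: av_pos_iff)
    have g1: "g (1 + T) \<ge> g T - 1"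
      using av_abs_diff[OF ag, of T "-1"] ag by (simp add: add.commute)
    have h1: "h (1 + T) \<ge> 1 - h T" if "h \<in> G" for h
      using av_abs_diff[OF ah[OF that], of 1 "-T"] ah[OF that] by simp
    have "1 < f b * inverse (1 + inverse (f T))" using r(1) by (simp add: T_def)
    also have "\<dots> = f T / (1 + f T) * f b" using r(5) by (simp add: T_def field_simps)
    also have "\<dots> \<le> f T / f (1 + T) * f b"
      using f1 r(5) af by (intro mult_right_mono divide_left_mono mult_pos_pos) (auto simp: T_def simp del: av_pos_iff)
    finally have "f (T / (1 + T) * b) > 1" by (simp only: T1[OF af])
    moreover have "g (T / (1 + T) * b) < 1"
    proof -
      have "g T / g (1 + T) * g b \<le> g T / (g T - 1) * g b"
        using g1 r(6) ag by (intro mult_right_mono divide_left_mono mult_pos_pos) (auto simp: T_def simp del: av_pos_iff)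
      also have "\<dots> = g b * inverse (1 - inverse (g T))" using r(6) by (simp add: T_def field_simps)
      finally show ?thesis using r(2) unfolding T1[OF ag] T_def[symmetric] by linarith
    qed
    moreover have "h (T / (1 + T) * b) < 1" if "h \<in> G" for h
    proof -
      have hT: "h T = h a ^ r" by (simp add: T_def t_def av_power ah that)
      have "h T / h (1 + T) * h b \<le> h T / (1 - h T) * h b"
        using h1[OF that] r(4)[OF that] ah[OF that] unfolding hT
        by (intro mult_right_mono divide_left_mono mult_pos_pos) (auto simp: hT simp del: av_pos_iff)
      then show ?thesis
        using r(3)[OF that] unfolding T1[OF ah[OF that]] hT by (simp add: divide_inverse)
    qed
    ultimately show ?thesis by blast
  qed
  then show ?case by blast
qed

section \<open>Places of a number field\<close>

lemma nonarch_add_le: "nonarchimedean f \<Longrightarrow> f x \<le> C \<Longrightarrow> f y \<le> C \<Longrightarrow> f (x + y) \<le> C"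
  unfolding nonarchimedean_def by (meson max.boundedI order_trans)

lemma nonarch_add_less: "nonarchimedean f \<Longrightarrow> f x < C \<Longrightarrow> f y < C \<Longrightarrow> f (x + y) < C"
  unfolding nonarchimedean_def by (meson max_less_iff_conj order_le_less_trans)

lemma nonarch_diff_le:
  "absolute_value f \<Longrightarrow> nonarchimedean f \<Longrightarrow> f x \<le> C \<Longrightarrow> f y \<le> C \<Longrightarrow> f (x - y) \<le> C"
  using nonarch_add_le[of f x C "-y"] by simp

lemma nonarch_sum_le:
  "absolute_value f \<Longrightarrow> nonarchimedean f \<Longrightarrow> 0 \<le> C \<Longrightarrow> (\<And>i. i \<in> I \<Longrightarrow> f (x i) \<le> C) \<Longrightarrow> f (\<Sum>i\<in>I. x i) \<le> C"
  by (induction I rule: infinite_finite_induct) (auto intro: nonarch_add_le)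

lemma nonarch_sum_less:
  "absolute_value f \<Longrightarrow> nonarchimedean f \<Longrightarrow> 0 < C \<Longrightarrow> (\<And>i. i \<in> I \<Longrightarrow> f (x i) < C) \<Longrightarrow> f (\<Sum>i\<in>I. x i) < C"
  by (induction I rule: infinite_finite_induct) (auto intro: nonarch_add_less)

lemma nonarch_of_nat_le: "absolute_value f \<Longrightarrow> nonarchimedean f \<Longrightarrow> f (of_nat n) \<le> 1"
  by (induction n) (auto intro: nonarch_add_le)

lemma nonarch_of_int_le: "absolute_value f \<Longrightarrow> nonarchimedean f \<Longrightarrow> f (of_int n) \<le> 1"
  by (cases n rule: int_cases2) (auto intro: nonarch_of_nat_le)

text \<open>In an ultrametric triangle the two longest sides are equal.\<close>

lemma nonarch_eq:
  assumes "absolute_value f" "nonarchimedean f" "f (x - y) < f x"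
  shows "f y = f x"
proof (rule antisym)
  show "f y \<le> f x"
    using nonarch_diff_le[OF assms(1,2), of x "f x" "x - y"] assms(3) by simp
  show "f x \<le> f y"
  proof (rule ccontr)
    assume "\<not> ?thesis"
    then have "f ((x - y) + y) < f x"
      using assms by (intro nonarch_add_less[of f]) auto
    then show False by simp
  qed
qed

text \<open>Taking \<open>k\<close>-th roots in the limit: a factor of linear growth in
  \<open>k\<close> disappears. This later removes the constants of binomial, digit and norm
  estimates.\<close>

lemma power_growth_le:
  fixes a b C :: real
  assumes "b \<ge> 0" "\<And>k. a ^ k \<le> C * (real k + 1) * b ^ k"
  shows "a \<le> b"
proof (rule ccontr)
  assume "\<not> a \<le> b"
  then have ab: "a > b" "a > 0" using assms(1) by auto
  define r where "r = b / a"
  have r: "0 \<le> r" "r < 1" using ab assms(1) by (auto simp: r_def)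
  have "(\<lambda>k. C * (real k * r ^ k) + C * r ^ k) \<longlonglongrightarrow> C * 0 + C * 0"
    using r by (intro tendsto_intros powser_times_n_limit_0 LIMSEQ_power_zero) auto
  then have "\<forall>\<^sub>F k in sequentially. C * (real k * r ^ k) + C * r ^ k < 1"
    by (intro order_tendstoD(2)[where y=0]) auto
  then obtain k where k: "C * (real k * r ^ k) + C * r ^ k < 1"
    by (auto simp: eventually_sequentially)
  have "C * (real k + 1) * b ^ k < a ^ k"
    using k ab by (simp add: r_def power_divide field_simps)
  then show False using assms(2)[of k] by simp
qed

lemma finite_arg_max:
  fixes v :: "'i \<Rightarrow> real"
  assumes "finite S" "S \<noteq> {}"
  shows "\<exists>k\<in>S. \<forall>j\<in>S. v j \<le> v k"
proof -
  have "Max (v ` S) \<in> v ` S" using assms by (intro Max_in) auto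
  then obtain k where "k \<in> S" "v k = Max (v ` S)" by auto
  then show ?thesis using assms(1) by (intro bexI[of _ k]) auto
qed

text \<open>Expand \<open>(x + y) ^ k\<close> by the binomial theorem: the coefficients are integers
  of value at most \<open>1\<close>, so there are \<open>k + 1\<close> terms bounded by the
  \<open>k\<close>-th power of the maximum, and \<open>k\<close>-th roots remove the factor
  \<open>k + 1\<close>.\<close>

lemma nonarch_if_of_nat_le:
  fixes f :: "'a::field \<Rightarrow> real"
  assumes f: "absolute_value f" and le: "\<And>n. f (of_nat n) \<le> 1"
  shows "nonarchimedean f"
  unfolding nonarchimedean_def
proof (intro allI)
  fix x y
  let ?m = "max (f x) (f y)"
  show "f (x + y) \<le> ?m"
  proof (rule power_growth_le[where C = 1])
    fix k
    have "f (x + y) ^ k = f (\<Sum>i\<le>k. of_nat (k choose i) * x ^ i * y ^ (k - i))"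
      by (simp add: av_power[OF f, symmetric] binomial_ring)
    also have "\<dots> \<le> (\<Sum>i\<le>k. f (of_nat (k choose i) * x ^ i * y ^ (k - i)))"
      by (rule av_sum[OF f])
    also have "\<dots> \<le> (\<Sum>i\<le>k. ?m ^ k)"
    proof (rule sum_mono)
      fix i assume "i \<in> {..k}"
      then have i: "?m ^ k = 1 * ?m ^ i * ?m ^ (k - i)" by (simp flip: power_add)
      show "f (of_nat (k choose i) * x ^ i * y ^ (k - i)) \<le> ?m ^ k"
        unfolding i av_mult[OF f] av_power[OF f]
        using f by (intro mult_mono le power_mono) (auto simp: le_max_iff_disj)
    qed
    finally show "f (x + y) ^ k \<le> 1 * (real k + 1) * ?m ^ k" by (simp add: algebra_simps)
  qed (use f in \<open>simp add: le_max_iff_disj\<close>)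
qed

section \<open>Values of rational numbers over a prime\<close>

lemma of_rat_quotient:
  fixes q :: rat
  obtains a b where "quotient_of q = (a, b)" "b > 0" "coprime a b"
    "of_rat q = (of_int a / of_int b :: 'a::field_char_0)"
proof -
  obtain a b where ab: "quotient_of q = (a, b)" by (cases "quotient_of q")
  then have "q = of_int a / of_int b" by (rule quotient_of_div)
  then have "of_rat q = (of_int a / of_int b :: 'a)" by (simp add: of_rat_divide)
  then show ?thesis
    using that ab quotient_of_denom_pos[OF ab] quotient_of_coprime[OF ab] by blast
qed

definition lies_over :: "nat \<Rightarrow> ('a::field_char_0 \<Rightarrow> real) \<Rightarrow> bool" where
  "lies_over p f \<longleftrightarrow> prime p \<and> absolute_value f \<and> nonarchimedean f \<and> f (of_nat p) < 1"

lemma lies_over_pos: "lies_over p f \<Longrightarrow> 0 < f (of_nat p)"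
  by (auto simp: lies_over_def dest: prime_gt_0_nat)

text \<open>In a Bezout relation \<open>u * m + v * int p = 1\<close> the second summand lies in the
  open unit ball, so the first has value at least \<open>1\<close>, while each of its factors has
  value at most \<open>1\<close>.\<close>

lemma lies_over_coprime:
  assumes "lies_over p f" "coprime m (int p)"
  shows "f (of_int m) = 1"
proof -
  have f: "absolute_value f" "nonarchimedean f" "f (of_nat p) < 1"
    using assms by (auto simp: lies_over_def)
  obtain u v where uv: "u * m + v * int p = 1"
    using bezout_int[of m "int p"] assms(2) by auto
  have vp: "f (of_int v * of_nat p) < 1"
    using nonarch_of_int_le[OF f(1,2), of v] f(3) f(1)
    by (simp add: av_mult) (metis av_nonneg mult_left_le_one_le order_le_less_trans)
  have "f (of_int (u * m)) \<ge> 1"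
  proof (rule ccontr)
    assume "\<not> ?thesis"
    then have "f (of_int (u * m) + of_int v * of_nat p) < 1"
      using vp by (intro nonarch_add_less[of f] f) auto
    also have "of_int (u * m) + of_int v * of_nat p = (of_int (u * m + v * int p) :: 'a)"
      by simp
    finally show False using uv f(1) by simp
  qed
  then have "1 \<le> f (of_int u) * f (of_int m)" by (simp add: av_mult f)
  also have "\<dots> \<le> 1 * f (of_int m)"
    using f by (intro mult_right_mono nonarch_of_int_le) auto
  finally show ?thesis
    using nonarch_of_int_le[OF f(1,2), of m] by simp
qed

lemma coprime_int_prime:
  fixes p :: nat
  assumes "prime p" "\<not> int p dvd a"
  shows "coprime a (int p)"
  using prime_imp_coprime[of "int p" a] assms by (auto simp: coprime_commute)

text \<open>The right-hand side does not mention \<open>f\<close>: absolute values over the same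
  \<open>p\<close> share their unit ball in \<rat>, the hypothesis under which
  \<open>finite_same_unit_ball\<close> bounds their number.\<close>

lemma lies_over_le_1_iff:
  assumes "lies_over p f"
  shows "f (of_rat q) \<le> 1 \<longleftrightarrow> \<not> int p dvd snd (quotient_of q)"
proof -
  have f: "absolute_value f" "nonarchimedean f" "f (of_nat p) < 1" "prime p"
    using assms by (auto simp: lies_over_def)
  obtain a b where ab: "quotient_of q = (a, b)" "b > 0" "coprime a b" "of_rat q = (of_int a / of_int b :: 'a)"
    by (rule of_rat_quotient)
  show ?thesis
  proof (cases "int p dvd b")
    case True
    have "\<not> int p dvd a"
    proof
      assume "int p dvd a"
      then have "is_unit (int p)" using True ab(3) coprime_common_divisor by blast
      then show False using f(4) by simp
    qed
    then have "f (of_int a) = 1"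
      using f(4) by (intro lies_over_coprime[OF assms]) (simp add: coprime_int_prime)
    moreover obtain c where "b = int p * c" using True by auto
    then have "f (of_int b) \<le> f (of_nat p) * 1"
      using f by (simp add: av_mult mult_left_le nonarch_of_int_le)
    moreover have "f (of_int b) > 0" using ab f by simp
    ultimately show ?thesis
      using True ab f by (simp add: av_divide)
  next
    case False
    then have "f (of_int b) = 1"
      using f(4) by (intro lies_over_coprime[OF assms]) (simp add: coprime_int_prime)
    then show ?thesis
      using False ab f by (simp add: av_divide nonarch_of_int_le)
  qed
qed

lemma lies_over_of_int_value:
  assumes "lies_over p f" "m \<noteq> 0"
  shows "\<exists>k. f (of_int m) = f (of_nat p) ^ k"
proof -
  have f: "absolute_value f" "prime p" using assms by (auto simp: lies_over_def)
  have "\<not> is_unit (int p)" using f(2) by auto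
  then obtain c where c: "m = int p ^ multiplicity (int p) m * c" "\<not> int p dvd c"
    by (rule multiplicity_decompose'[OF assms(2)])
  have "f (of_int c) = 1"
    using f(2) c(2) by (intro lies_over_coprime[OF assms(1)]) (simp add: coprime_int_prime)
  then have "f (of_int m) = f (of_nat p) ^ multiplicity (int p) m"
    by (subst c(1)) (simp add: av_mult av_power f)
  then show ?thesis ..
qed

text \<open>Up to a unit at \<open>p\<close>, a nonzero rational is a power of \<open>p\<close>; so
  values on \<rat> are spaced by factors \<open>f (of_nat p)\<close>.\<close>

lemma lies_over_of_rat_value:
  assumes "lies_over p f" "q \<noteq> 0"
  shows "\<exists>k. f (of_rat q) = f (of_nat p) powi k"
proof -
  have f: "absolute_value f" using assms by (auto simp: lies_over_def)
  obtain a b where ab: "quotient_of q = (a, b)" "b > 0" "coprime a b" "of_rat q = (of_int a / of_int b :: 'a)"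
    by (rule of_rat_quotient)
  have "a \<noteq> 0" using ab(4) assms(2) by auto
  obtain k l where "f (of_int a) = f (of_nat p) ^ k" "f (of_int b) = f (of_nat p) ^ l"
    using lies_over_of_int_value[OF assms(1)] \<open>a \<noteq> 0\<close> \<open>b > 0\<close> by (metis less_irrefl)
  then have "f (of_rat q) = f (of_nat p) powi (int k - int l)"
    using lies_over_pos[OF assms(1)] by (simp add: ab(4) av_divide f power_int_diff)
  then show ?thesis ..
qed

section \<open>Linear dependence over the rationals and the size of values\<close>

interpretation rat_vs: vector_space "\<lambda>(q::rat) (x::'a::field_char_0). of_rat q * x"
  by unfold_locales (auto simp: algebra_simps of_rat_add of_rat_mult)

text \<open>A bound for the degree, to be exceeded by \<open>l\<close>; any finite spanning set
  provides one.\<close>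

definition dim_at_most :: "'a::field_char_0 itself \<Rightarrow> nat \<Rightarrow> bool" where
  "dim_at_most _ d \<longleftrightarrow> (\<exists>B::'a set. finite B \<and> card B \<le> d \<and> rat_vs.span B = UNIV)"

lemma number_field_dim:
  assumes "number_field TYPE('a::field_char_0)"
  obtains d where "dim_at_most TYPE('a) d"
  using assms unfolding number_field_def dim_at_most_def by blast

text \<open>Formulated for families, because powers of one element may coincide; a repetition is
  itself a relation.\<close>

lemma dim_at_most_dependent:
  fixes x :: "'i \<Rightarrow> 'a::field_char_0"
  assumes "dim_at_most TYPE('a) d" "finite I" "d < card I"
  shows "\<exists>q. (\<exists>i\<in>I. q i \<noteq> 0) \<and> (\<Sum>i\<in>I. of_rat (q i) * x i) = 0"
proof (cases "inj_on x I")
  case True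
  obtain B :: "'a set" where B: "finite B" "card B \<le> d" "rat_vs.span B = UNIV"
    using assms(1) by (auto simp: dim_at_most_def)
  have "rat_vs.dependent (x ` I)"
  proof (rule ccontr)
    assume "\<not> ?thesis"
    then have "card (x ` I) \<le> card B"
      using rat_vs.independent_span_bound[OF B(1)] B(3) by auto
    then show False using B(2) assms(3) True by (simp add: card_image)
  qed
  then obtain u where "\<exists>v\<in>x ` I. u v \<noteq> 0" "(\<Sum>v\<in>x ` I. of_rat (u v) * v) = 0"
    using rat_vs.dependent_finite[of "x ` I"] assms(2) by auto
  then show ?thesis
    using True by (intro exI[of _ "u \<circ> x"]) (auto simp: sum.reindex)
next
  case False
  then obtain i j where ij: "i \<in> I" "j \<in> I" "i \<noteq> j" "x i = x j" by (auto simp: inj_on_def)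
  define q where "q k = (if k = i then 1 else if k = j then -1 else (0::rat))" for k
  have "(\<Sum>k\<in>I. of_rat (q k) * x k) = (\<Sum>k\<in>{i, j}. of_rat (q k) * x k)"
    using assms(2) ij by (intro sum.mono_neutral_right) (auto simp: q_def)
  also have "\<dots> = 0" using ij by (simp add: q_def)
  finally show ?thesis using ij by (intro exI[of _ q]) (auto simp: q_def)
qed

text \<open>The powers \<open>z ^ i\<close> with \<open>i < l\<close> have distinct values between
  \<open>f (of_nat p)\<close> (excluded) and \<open>1\<close> (included), while rational factors
  change values by powers of \<open>f (of_nat p)\<close>. So the nonzero terms of a rational
  relation have distinct values and the largest cannot cancel: \<open>l\<close> independent
  elements, more than the degree allows. This plays the part of bounding the ramification index by
  the degree.\<close>

lemma no_small_value:
  fixes f :: "'a::field_char_0 \<Rightarrow> real"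
  assumes d: "dim_at_most TYPE('a) d" "d < l" and p: "lies_over p f"
    and z: "f (of_nat p) \<le> f z ^ l" "f z < 1"
  shows False
proof -
  have f: "absolute_value f" "nonarchimedean f" "f (of_nat p) < 1" "prime p"
    using p by (auto simp: lies_over_def)
  let ?c = "f (of_nat p)"
  have c: "0 < ?c" using lies_over_pos[OF p] .
  have z0: "z \<noteq> 0"
    using z(1) c d(2) f(1) by (cases "z = 0") (auto simp: power_0_left)
  then have fz: "0 < f z" using f by simp
  have zi: "?c < f z ^ i" if "i < l" for i
  proof -
    have "f z ^ l < f z ^ i" using fz z(2) that by (simp add: power_strict_decreasing)
    then show ?thesis using z(1) by simp
  qed
  obtain q where q: "\<exists>i\<in>{..<l}. q i \<noteq> 0" "(\<Sum>i<l. of_rat (q i) * z ^ i) = 0"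
    using dim_at_most_dependent[OF d(1), of "{..<l}" "\<lambda>i. z ^ i"] d(2) by auto
  define J where "J = {i. i < l \<and> q i \<noteq> 0}"
  have J: "finite J" "J \<noteq> {}" using q by (auto simp: J_def)
  have sumJ: "(\<Sum>i\<in>J. of_rat (q i) * z ^ i) = 0"
    using q(2) by (subst sum.mono_neutral_left[of "{..<l}"]) (auto simp: J_def)
  define v where "v i = f (of_rat (q i) * z ^ i)" for i
  have inj: "inj_on v J"
  proof (rule inj_onI)
    fix i j assume ij: "i \<in> J" "j \<in> J" "v i = v j"
    then obtain k m where km: "f (of_rat (q i)) = ?c powi k" "f (of_rat (q j)) = ?c powi m"
      using lies_over_of_rat_value[OF p] by (metis (mono_tags, lifting) J_def mem_Collect_eq)
    have eq: "?c powi k * f z ^ i = ?c powi m * f z ^ j"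
      using ij(3) km by (simp add: v_def av_mult av_power f)
    \<comment> \<open>With \<open>k < m\<close> the left side is at most
      \<open>?c powi (k + 1)\<close>, which the right side exceeds because
      \<open>f z ^ i > ?c\<close>.\<close>
    have le: "?c powi m * f z ^ j \<noteq> ?c powi k * f z ^ i" if "i < l" "j < l" "k < m" for i j k m
    proof -
      have "?c powi m * f z ^ j \<le> ?c powi m * 1"
        using c fz z(2) by (intro mult_left_mono power_le_one) auto
      also have "\<dots> \<le> ?c powi (k + 1)"
        using c f(3) that by (simp add: power_int_decreasing)
      also have "\<dots> = ?c powi k * ?c" using c by (simp add: power_int_add)
      also have "\<dots> < ?c powi k * f z ^ i"
        using c zi[OF that(1)] by (intro mult_strict_left_mono) auto
      finally show ?thesis by simp
    qed
    have "k = m"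
      using le[of i j k m] le[of j i m k] eq ij by (force simp: J_def)
    then have "f z ^ i = f z ^ j" using eq c by simp
    then show "i = j"
      using fz z(2) by (simp add: power_inject_exp')
  qed
  obtain i where i: "i \<in> J" "\<And>j. j \<in> J \<Longrightarrow> v j \<le> v i"
    using finite_arg_max[OF J, of v] by blast
  have "v i > 0" using i(1) z0 f(1) by (simp add: v_def J_def)
  \<comment> \<open>All other terms are strictly smaller than the largest, and by the ultrametric
    inequality so is their sum.\<close>
  have "f (\<Sum>j\<in>J - {i}. of_rat (q j) * z ^ j) < v i"
  proof (rule nonarch_sum_less[OF f(1,2) \<open>v i > 0\<close>])
    fix j assume "j \<in> J - {i}"
    then have "v j \<noteq> v i" using inj i(1) by (auto dest: inj_onD)
    then show "f (of_rat (q j) * z ^ j) < v i"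
      using i(2)[of j] \<open>j \<in> J - {i}\<close> by (auto simp: v_def)
  qed
  moreover have "(\<Sum>j\<in>J - {i}. of_rat (q j) * z ^ j) = - (of_rat (q i) * z ^ i)"
    using sumJ sum.remove[OF J(1) i(1), of "\<lambda>j. of_rat (q j) * z ^ j"] by (simp add: eq_neg_iff_add_eq_0 add.commute)
  ultimately show False using f(1) by (simp add: v_def)
qed

section \<open>Restriction to the rationals and Ostrowski's theorem\<close>

lemma nontrivial_on_rat:
  fixes f :: "'a::field_char_0 \<Rightarrow> real"
  assumes "number_field TYPE('a)" "nontrivial_absolute_value f"
  shows "\<exists>q::rat. f (of_rat q) > 1"
proof (rule ccontr)
  assume "\<not> ?thesis"
  then have le: "f (of_rat q) \<le> 1" for q by (meson not_le)
  note f = nontrivial_av[OF assms(2)]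
  obtain B :: "'a set" where B: "finite B" "rat_vs.span B = UNIV"
    using assms(1) by (auto simp: number_field_def)
  \<comment> \<open>Rational coordinates of value at most \<open>1\<close> would bound
    \<open>f\<close> on the whole field, but an element of value above \<open>1\<close> has
    unbounded powers.\<close>
  have bound: "f x \<le> (\<Sum>b\<in>B. f b)" for x
  proof -
    have "x \<in> rat_vs.span B" using B(2) by simp
    then obtain u where u: "x = (\<Sum>b\<in>B. of_rat (u b) * b)"
      using rat_vs.span_finite[OF B(1)] by auto
    have "f x \<le> (\<Sum>b\<in>B. f (of_rat (u b) * b))" unfolding u by (rule av_sum[OF f])
    also have "\<dots> \<le> (\<Sum>b\<in>B. 1 * f b)"
      unfolding av_mult[OF f] using f by (intro sum_mono mult_right_mono le) auto
    finally show ?thesis by simp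
  qed
  obtain c where c: "f c > 1" using nontrivial_gt_1[OF assms(2)] .
  obtain n where "f c ^ n > (\<Sum>b\<in>B. f b)" using real_arch_pow[OF c] by blast
  then show False using bound[of "c ^ n"] by (simp add: av_power f)
qed

text \<open>A rational of value above \<open>1\<close> has a denominator of value below
  \<open>1\<close>. The least positive integer of value below \<open>1\<close> is prime, since in a
  proper factorisation both factors would have value at least \<open>1\<close>.\<close>

lemma nonarch_lies_over:
  fixes f :: "'a::field_char_0 \<Rightarrow> real"
  assumes "number_field TYPE('a)" "nontrivial_absolute_value f" "nonarchimedean f"
  obtains p where "lies_over p f"
proof -
  note f = nontrivial_av[OF assms(2)]
  obtain q where q: "f (of_rat q) > 1" using nontrivial_on_rat[OF assms(1,2)] by blast
  obtain a b where ab: "b > 0" "of_rat q = (of_int a / of_int b :: 'a)"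
    by (rule of_rat_quotient)
  have fb: "f (of_int b) > 0" using ab f by simp
  have "f (of_int b) < 1"
    using q fb nonarch_of_int_le[OF f assms(3), of a] by (simp add: ab av_divide f)
  then have ex: "\<exists>n>0. f (of_nat n) < 1"
    using ab(1) by (intro exI[of _ "nat b"]) auto
  define p where "p = (LEAST n. n > 0 \<and> f (of_nat n) < 1)"
  have p: "p > 0" "f (of_nat p) < 1" using LeastI_ex[OF ex] by (auto simp: p_def)
  have least: "f (of_nat n) \<ge> 1" if "n > 0" "n < p" for n
    using not_less_Least[of n "\<lambda>n. n > 0 \<and> f (of_nat n) < 1"] that by (auto simp: p_def)
  have "prime p"
  proof (rule ccontr)
    assume "\<not> prime p"
    moreover have "p \<noteq> 1" using p f by auto
    ultimately obtain m where m: "m dvd p" "m \<noteq> 1" "m \<noteq> p"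
      using p(1) by (auto simp: prime_nat_iff nat_neq_iff)
    then obtain k where k: "p = m * k" by auto
    have "1 < m" "0 < k" using p(1) m(2) k by (auto intro: Suc_lessI) 
    then have "m < p" "k < p" using k m by (auto simp: nat_neq_iff)
    then have "1 * 1 \<le> f (of_nat m) * f (of_nat k)"
      using \<open>1 < m\<close> \<open>0 < k\<close> by (intro mult_mono least) (auto simp: f)
    then show False using p(2) k by (simp add: av_mult f)
  qed
  then show ?thesis using that p f assms(3) by (auto simp: lies_over_def)
qed

text \<open>Expansion in base \<open>n\<close>: there are \<open>t + 1\<close> digits, each of value
  at most \<open>n\<close>, and the powers of \<open>n\<close> that occur are bounded by the
  \<open>t\<close>-th power of the maximum.\<close>

lemma av_of_nat_digits:
  assumes f: "absolute_value f" and n: "n > 0"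
  shows "m < n ^ Suc t \<Longrightarrow> f (of_nat m) \<le> real n * (real t + 1) * max 1 (f (of_nat n)) ^ t"
proof (induction t arbitrary: m)
  case 0
  then show ?case using av_of_nat_le[OF f, of m] by simp
next
  case (Suc t)
  let ?M = "max 1 (f (of_nat n))"
  have "m div n < n ^ Suc t" using Suc.prems by (simp add: less_mult_imp_div_less mult.commute)
  note IH = Suc.IH[OF this]
  have "m = m div n * n + m mod n" by simp
  then have "f (of_nat m) = f (of_nat (m div n) * of_nat n + of_nat (m mod n))"
    by (metis of_nat_add of_nat_mult)
  also have "\<dots> \<le> f (of_nat (m div n)) * f (of_nat n) + f (of_nat (m mod n))"
    using av_triangle[OF f] by (metis av_mult[OF f])
  also have "\<dots> \<le> real n * (real t + 1) * ?M ^ t * ?M + real n * ?M ^ Suc t"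
  proof (rule add_mono)
    show "f (of_nat (m div n)) * f (of_nat n) \<le> real n * (real t + 1) * ?M ^ t * ?M"
      using f by (intro mult_mono IH) auto
    have "f (of_nat (m mod n)) \<le> real (m mod n)" by (rule av_of_nat_le[OF f])
    also have "\<dots> \<le> real n * 1" using n by (simp add: less_imp_le)
    also have "\<dots> \<le> real n * ?M ^ Suc t" by (intro mult_left_mono one_le_power) auto
    finally show "f (of_nat (m mod n)) \<le> real n * ?M ^ Suc t" .
  qed
  also have "\<dots> = real n * (real (Suc t) + 1) * ?M ^ Suc t" by (simp add: algebra_simps)
  finally show ?case .
qed

text \<open>Ostrowski's comparison: apply the digit bound to \<open>m ^ k\<close>, whose number of
  digits in base \<open>n\<close> grows like \<open>k * ln m / ln n\<close>, and take
  \<open>k\<close>-th roots.\<close>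

lemma av_of_nat_compare:
  assumes f: "absolute_value f" and mn: "m > 1" "n > 1"
  shows "f (of_nat m) \<le> max 1 (f (of_nat n)) powr (ln (real m) / ln (real n))"
proof -
  let ?M = "max 1 (f (of_nat n))" and ?L = "ln (real m) / ln (real n)"
  have L: "?L > 0" using mn by simp
  show ?thesis
  proof (rule power_growth_le[where C = "real n * (?L + 1)"])
    fix k
    define t where "t = nat \<lfloor>real k * ?L\<rfloor>"
    have kL: "real k * ?L \<ge> 0" using L by (intro mult_nonneg_nonneg) auto
    have t: "real t \<le> real k * ?L" "real k * ?L < real t + 1"
      unfolding t_def using kL by linarith+
    have "real (m ^ k) = exp (real k * ln (real m))" using mn by (simp add: exp_of_nat_mult)
    also have "\<dots> < exp ((real t + 1) * ln (real n))"
      using t(2) mn by (simp add: field_simps)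
    also have "\<dots> = real (n ^ Suc t)"
    proof -
      have "real t + 1 = real (Suc t)" by simp
      then show ?thesis using mn by (simp only: exp_of_nat_mult) simp
    qed
    finally have "m ^ k < n ^ Suc t" by linarith
    then have "f (of_nat (m ^ k)) \<le> real n * (real t + 1) * ?M ^ t"
      using mn by (intro av_of_nat_digits[OF f]) auto
    also have "\<dots> \<le> real n * ((?L + 1) * (real k + 1)) * ?M powr (real k * ?L)"
    proof (intro mult_mono)
      have "(?L + 1) * (real k + 1) = real k * ?L + ?L + real k + 1" by (simp only: algebra_simps)
      then show "real t + 1 \<le> (?L + 1) * (real k + 1)" using t L by linarith
      have "?M ^ t = ?M powr real t" by (simp add: powr_realpow)
      also have "\<dots> \<le> ?M powr (real k * ?L)" using t(1) by (intro powr_mono) auto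
      finally show "?M ^ t \<le> ?M powr (real k * ?L)" .
    qed (use L in auto)
    also have "?M powr (real k * ?L) = (?M powr ?L) ^ k"
      by (simp add: powr_powr[symmetric] powr_realpow[symmetric] powr_powr mult.commute)
    finally show "f (of_nat m) ^ k \<le> real n * (?L + 1) * (real k + 1) * (?M powr ?L) ^ k"
      by (simp add: av_power f algebra_simps)
  qed simp
qed

text \<open>One integer of value above \<open>1\<close> forces all integers above \<open>1\<close>
  to have value above \<open>1\<close>; comparison in both directions then makes
  \<open>ln (f (of_nat n)) / ln n\<close> constant, and this constant is \<open>s\<close>.\<close>

lemma archimedean_on_rat:
  fixes f :: "'a::field_char_0 \<Rightarrow> real"
  assumes f: "absolute_value f" and arch: "\<not> nonarchimedean f"
  obtains s where "0 < s" "\<And>q. f (of_rat q) = \<bar>real_of_rat q\<bar> powr s"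
proof -
  obtain n0 where n0: "f (of_nat n0) > 1"
    using nonarch_if_of_nat_le[OF f] arch by (meson not_le)
  have n0': "n0 > 1"
    using n0 f by (cases "n0 = 0"; cases "n0 = 1") auto
  have gt1: "f (of_nat n) > 1" if "n > 1" for n
  proof (rule ccontr)
    assume "\<not> ?thesis"
    then have "f (of_nat n0) \<le> 1 powr (ln (real n0) / ln (real n))"
      using av_of_nat_compare[OF f n0' that] by (simp add: max_def split: if_splits)
    then show False using n0 by simp
  qed
  have le: "ln (f (of_nat m)) / ln (real m) \<le> ln (f (of_nat n)) / ln (real n)" if "m > 1" "n > 1" for m n
  proof -
    have "f (of_nat m) \<le> f (of_nat n) powr (ln (real m) / ln (real n))"
      using av_of_nat_compare[OF f that] gt1[OF that(2)] by (simp add: max_def)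
    then have "ln (f (of_nat m)) \<le> ln (f (of_nat n) powr (ln (real m) / ln (real n)))"
      using gt1[OF that(1)] by (intro ln_mono) auto
    then have "ln (f (of_nat m)) \<le> ln (real m) / ln (real n) * ln (f (of_nat n))"
      using gt1[OF that(2)] by (simp add: ln_powr)
    then show ?thesis using that by (simp add: field_simps)
  qed
  define s where "s = ln (f (of_nat 2)) / ln (2::real)"
  have "s > 0" using gt1[of 2] by (simp add: s_def)
  have nat: "f (of_nat n) = real n powr s" for n
  proof -
    consider "n = 0" | "n = 1" | "n > 1" by linarith
    then show ?thesis
    proof cases
      case 3
      have "ln (f (of_nat n)) / ln (real n) = s"
        using le[of n 2] le[of 2 n] 3 by (simp add: s_def)
      then have "ln (f (of_nat n)) = s * ln (real n)" using 3 by (simp add: field_simps)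
      then have "exp (ln (f (of_nat n))) = exp (s * ln (real n))" by simp
      then show ?thesis using 3 f by (simp add: powr_def)
    qed (use f in auto)
  qed
  have int: "f (of_int m) = \<bar>real_of_int m\<bar> powr s" for m
    by (cases m rule: int_cases2) (use nat f in auto)
  have "f (of_rat q) = \<bar>real_of_rat q\<bar> powr s" for q
  proof -
    obtain a b where ab: "quotient_of q = (a, b)" "b > 0" "of_rat q = (of_int a / of_int b :: 'a)"
      by (rule of_rat_quotient)
    have "real_of_rat q = of_int a / of_int b"
      using quotient_of_div[OF ab(1)] by (simp add: of_rat_divide)
    then show ?thesis using ab by (simp add: av_divide f int powr_divide)
  qed
  with \<open>s > 0\<close> show ?thesis using that by blast
qed

text \<open>For \<open>d + 1\<close> members of \<open>F\<close>, high powers of separating elements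
  would be independent over \<rat>. Divide a relation by a coefficient \<open>q k\<close> that is
  largest for one member, so that all quotients lie in the common unit ball; under the absolute
  value \<open>k\<close> the term of \<open>a k\<close> then outweighs the sum of the
  others.\<close>

lemma finite_same_unit_ball:
  fixes F :: "('a::field_char_0 \<Rightarrow> real) set"
  assumes d: "dim_at_most TYPE('a) d"
    and nt: "\<And>f. f \<in> F \<Longrightarrow> nontrivial_absolute_value f"
    and ineq: "\<And>f g. f \<in> F \<Longrightarrow> g \<in> F \<Longrightarrow> (f, g) \<in> equivalent_absolute_values \<Longrightarrow> f = g"
    and ball: "\<And>f g q. f \<in> F \<Longrightarrow> g \<in> F \<Longrightarrow> f (of_rat q) \<le> 1 \<Longrightarrow> g (of_rat q) \<le> 1"
  shows "finite F"
proof (rule ccontr)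
  assume "infinite F"
  then obtain G where G: "finite G" "card G = Suc d" "G \<subseteq> F"
    using infinite_arbitrarily_large by blast
  note av = nontrivial_av[OF nt]
  have "\<exists>a. f a > 1 \<and> (\<forall>g\<in>G - {f}. g a < 1)" if "f \<in> G" for f
    using that G nt ineq by (intro av_separate) blast+
  then obtain a where a: "\<And>f. f \<in> G \<Longrightarrow> f (a f) > 1" "\<And>f g. f \<in> G \<Longrightarrow> g \<in> G \<Longrightarrow> g \<noteq> f \<Longrightarrow> g (a f) < 1"
    by (metis DiffI singletonD)
  \<comment> \<open>The bound \<open>1 / (d + 1)\<close> makes the \<open>d\<close> other terms of a
    relation add up to less than \<open>1\<close>.\<close>
  have "\<forall>\<^sub>F r in sequentially. \<forall>f\<in>G. \<forall>g\<in>G - {f}. g (a f) ^ r < 1 / (d + 1)"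
  proof (intro eventually_ball_finite ballI)
    fix f g assume "f \<in> G" "g \<in> G - {f}"
    then have "(\<lambda>r. g (a f) ^ r) \<longlonglongrightarrow> 0"
      using a(2)[of f g] av[of g] G by (intro LIMSEQ_power_zero) auto
    then show "\<forall>\<^sub>F r in sequentially. g (a f) ^ r < 1 / (d + 1)"
      by (rule order_tendstoD) auto
  qed (use G in auto)
  then obtain r where r: "\<And>f g. f \<in> G \<Longrightarrow> g \<in> G \<Longrightarrow> g \<noteq> f \<Longrightarrow> g (a f) ^ r < 1 / (d + 1)"
    by (auto simp: eventually_sequentially)
  obtain q where q: "\<exists>f\<in>G. q f \<noteq> 0" "(\<Sum>f\<in>G. of_rat (q f) * a f ^ r) = 0"
    using dim_at_most_dependent[OF d G(1), of "\<lambda>f. a f ^ r"] G(2) by auto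
  obtain f0 where f0: "f0 \<in> G" using q by auto
  obtain k where k: "k \<in> G" "\<And>j. j \<in> G \<Longrightarrow> f0 (of_rat (q j)) \<le> f0 (of_rat (q k))"
    using finite_arg_max[OF G(1), of "\<lambda>j. f0 (of_rat (q j))"] f0 by blast
  have qk: "q k \<noteq> 0"
    using q(1) k(2) av[of f0] f0 G by (metis av_pos_iff av_zero_iff of_rat_eq_0_iff order_le_less subset_iff linorder_not_le)
  have avk: "absolute_value k" using av k(1) G by auto
  have avf0: "absolute_value f0" using av f0 G by auto
  \<comment> \<open>\<open>k\<close> is both an index and an absolute value. Maximality was arranged
    for \<open>f0\<close>; the common unit ball transfers it to \<open>k\<close>.\<close>
  have le: "k (of_rat (q j / q k)) \<le> 1" if "j \<in> G" for j
  proof -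
    have "f0 (of_rat (q j / q k)) \<le> 1"
      using k(2)[OF that] qk avf0 by (simp add: of_rat_divide av_divide divide_le_eq_1)
    then show ?thesis using ball[of f0 k] f0 k(1) G by auto
  qed
  have "(\<Sum>f\<in>G. of_rat (q f / q k) * a f ^ r) = (\<Sum>f\<in>G. of_rat (q f) * a f ^ r) / of_rat (q k)"
    by (simp add: of_rat_divide sum_divide_distrib)
  also have "\<dots> = 0" using q(2) by simp
  finally have "(\<Sum>f\<in>G - {k}. of_rat (q f / q k) * a f ^ r) = - (a k ^ r)"
    using sum.remove[OF G(1) k(1), of "\<lambda>f. of_rat (q f / q k) * a f ^ r"] qk
    by (simp add: eq_neg_iff_add_eq_0 add.commute)
  then have "k (a k) ^ r = k (\<Sum>f\<in>G - {k}. of_rat (q f / q k) * a f ^ r)"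
    using avk by (simp add: av_power)
  also have "\<dots> \<le> (\<Sum>f\<in>G - {k}. k (of_rat (q f / q k) * a f ^ r))" by (rule av_sum[OF avk])
  also have "\<dots> \<le> (\<Sum>f\<in>G - {k}. 1 * (1 / (d + 1)))"
  proof (rule sum_mono)
    fix f assume f: "f \<in> G - {k}"
    then have "k (a f) ^ r < 1 / (d + 1)" using r k(1) by auto
    then show "k (of_rat (q f / q k) * a f ^ r) \<le> 1 * (1 / (d + 1))"
      unfolding av_mult[OF avk] av_power[OF avk] using le[of f] f avk by (intro mult_mono) auto
  qed
  also have "\<dots> = d / (d + 1)" using G k(1) by simp
  also have "\<dots> < 1" by simp
  finally have "k (a k) ^ r < 1" .
  moreover have "k (a k) ^ r \<ge> 1" using a(1)[OF k(1)] by (intro one_le_power) simp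
  ultimately show False by simp
qed

section \<open>Places, their representatives, and finiteness\<close>

lemma place_abs_in: assumes "v \<in> places" shows "place_abs v \<in> v"
  using in_quotient_imp_non_empty[OF equiv_equivalent] assms
  unfolding places_def place_abs_def by (metis ex_in_conv someI_ex)

lemma place_abs_nontrivial: assumes "v \<in> places" shows "nontrivial_absolute_value (place_abs v)"
  using place_abs_in[OF assms] in_quotient_imp_subset[OF equiv_equivalent] assms
  unfolding places_def by blast

lemmas place_abs_av [simp] = nontrivial_av[OF place_abs_nontrivial]

lemma place_abs_equivalent_imp_eq:
  assumes "v \<in> places" "w \<in> places" "(place_abs v, place_abs w) \<in> equivalent_absolute_values"
  shows "v = w"
  using quotient_eqI[OF equiv_equivalent _ _ place_abs_in place_abs_in] assms
  unfolding places_def by blast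

lemma nontrivial_place:
  assumes "nontrivial_absolute_value f"
  obtains v where "v \<in> places" "(place_abs v, f) \<in> equivalent_absolute_values"
proof -
  let ?v = "equivalent_absolute_values `` {f}"
  have v: "?v \<in> places" using assms unfolding places_def by (auto intro: quotientI)
  then have "(f, place_abs ?v) \<in> equivalent_absolute_values" using place_abs_in by blast
  then show ?thesis using that v equiv_equivalent by (meson equivE symE)
qed

lemma finite_places_over:
  assumes "number_field TYPE('a::field_char_0)"
  shows "finite {v :: ('a \<Rightarrow> real) set. v \<in> places \<and> lies_over p (place_abs v)}"
proof -
  obtain d where d: "dim_at_most TYPE('a) d" using number_field_dim[OF assms] .
  let ?V = "{v :: ('a \<Rightarrow> real) set. v \<in> places \<and> lies_over p (place_abs v)}"
  have "finite (place_abs ` ?V)"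
    by (rule finite_same_unit_ball[OF d])
       (auto simp: lies_over_le_1_iff intro: place_abs_nontrivial dest: place_abs_equivalent_imp_eq)
  moreover have "inj_on place_abs ?V"
  proof (rule inj_onI)
    fix v w assume vw: "v \<in> ?V" "w \<in> ?V" "place_abs v = place_abs w"
    then have "(place_abs v, place_abs w) \<in> equivalent_absolute_values"
      using equiv_equivalent place_abs_nontrivial[of v] by (auto simp: equiv_def refl_on_def)
    then show "v = w" using vw place_abs_equivalent_imp_eq by blast
  qed
  ultimately show ?thesis by (rule finite_imageD)
qed

text \<open>By Ostrowski an archimedean absolute value is a positive power of the usual one on
  \<rat>, so all of them have the same rational unit ball.\<close>

lemma finite_archimedean_places:
  assumes "number_field TYPE('a::field_char_0)"
  shows "finite {v :: ('a \<Rightarrow> real) set. v \<in> places \<and> \<not> nonarchimedean (place_abs v)}"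
proof -
  obtain d where d: "dim_at_most TYPE('a) d" using number_field_dim[OF assms] .
  let ?V = "{v :: ('a \<Rightarrow> real) set. v \<in> places \<and> \<not> nonarchimedean (place_abs v)}"
  have le: "f (of_rat q) \<le> 1 \<longleftrightarrow> \<bar>real_of_rat q\<bar> \<le> 1"
    if f: "absolute_value f" "\<not> nonarchimedean f" for f :: "'a \<Rightarrow> real" and q
  proof -
    obtain s where s: "0 < s" "f (of_rat q) = \<bar>real_of_rat q\<bar> powr s"
      using archimedean_on_rat[OF f] by blast
    have "x powr s \<le> 1 \<longleftrightarrow> x \<le> 1" if "x \<ge> 0" for x :: real
      using that s(1) powr_less_mono2[of s 1 x] powr_le1[of s x] by (cases "x \<le> 1") (simp_all add: not_le)
    then show ?thesis using s by simp
  qed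
  have "finite (place_abs ` ?V)"
    by (rule finite_same_unit_ball[OF d])
       (auto simp: le intro: place_abs_nontrivial dest: place_abs_equivalent_imp_eq)
  moreover have "inj_on place_abs ?V"
  proof (rule inj_onI)
    fix v w assume vw: "v \<in> ?V" "w \<in> ?V" "place_abs v = place_abs w"
    then have "(place_abs v, place_abs w) \<in> equivalent_absolute_values"
      using equiv_equivalent place_abs_nontrivial[of v] by (auto simp: equiv_def refl_on_def)
    then show "v = w" using vw place_abs_equivalent_imp_eq by blast
  qed
  ultimately show ?thesis by (rule finite_imageD)
qed

section \<open>Completions\<close>

abbreviation Cau :: "('a::field \<Rightarrow> real) \<Rightarrow> (nat \<Rightarrow> 'a) set" where
  "Cau f \<equiv> carrier (cauchy_ring f)"

abbreviation Nul :: "('a::field \<Rightarrow> real) \<Rightarrow> (nat \<Rightarrow> 'a) set" where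
  "Nul f \<equiv> null_sequences f"

lemma Cau_iff: "x \<in> Cau f \<longleftrightarrow> (\<forall>e>0. \<exists>N. \<forall>m\<ge>N. \<forall>n\<ge>N. f (x m - x n) < e)"
  by (simp add: cauchy_ring_def)

lemma Nul_iff: "x \<in> Nul f \<longleftrightarrow> (\<lambda>n. f (x n)) \<longlonglongrightarrow> 0"
  by (simp add: null_sequences_def)

lemma CauD: "x \<in> Cau f \<Longrightarrow> e > 0 \<Longrightarrow> \<exists>N. \<forall>m\<ge>N. \<forall>n\<ge>N. f (x m - x n) < e"
  by (simp add: Cau_iff)

lemma Cau_const [simp]: "absolute_value f \<Longrightarrow> (\<lambda>n. a) \<in> Cau f"
  by (simp add: Cau_iff)

lemma Nul_tendsto_le:
  assumes "absolute_value f" "\<And>n. f (x n) \<le> b n" "b \<longlonglongrightarrow> 0"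
  shows "x \<in> Nul f"
  unfolding Nul_iff
  by (rule tendsto_sandwich[of "\<lambda>_. 0" _ _ b]) (use assms in auto)

lemma Nul_zero [simp]: "absolute_value f \<Longrightarrow> (\<lambda>n. 0) \<in> Nul f"
  by (simp add: Nul_iff)

lemma Nul_add:
  assumes "absolute_value f" "x \<in> Nul f" "y \<in> Nul f"
  shows "(\<lambda>n. x n + y n) \<in> Nul f"
proof (rule Nul_tendsto_le[OF assms(1)])
  show "f (x n + y n) \<le> f (x n) + f (y n)" for n by (rule av_triangle[OF assms(1)])
  show "(\<lambda>n. f (x n) + f (y n)) \<longlonglongrightarrow> 0"
    using assms tendsto_add[of "\<lambda>n. f (x n)" 0 sequentially "\<lambda>n. f (y n)" 0] by (simp add: Nul_iff)
qed

lemma Nul_minus: "absolute_value f \<Longrightarrow> x \<in> Nul f \<Longrightarrow> (\<lambda>n. - x n) \<in> Nul f"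
  by (simp add: Nul_iff)

lemma Nul_diff:
  assumes "absolute_value f" "x \<in> Nul f" "y \<in> Nul f"
  shows "(\<lambda>n. x n - y n) \<in> Nul f"
  using Nul_add[OF assms(1,2) Nul_minus[OF assms(1,3)]] by simp

lemma Nul_sum:
  assumes "absolute_value f" "\<And>i. i \<in> I \<Longrightarrow> x i \<in> Nul f"
  shows "(\<lambda>n. \<Sum>i\<in>I. x i n) \<in> Nul f"
  using assms(2) by (induction I rule: infinite_finite_induct) (auto intro!: Nul_add simp: assms(1))

lemma Nul_in_Cau:
  assumes "absolute_value f" "x \<in> Nul f"
  shows "x \<in> Cau f"
  unfolding Cau_iff
proof (intro allI impI)
  fix e :: real assume "e > 0"
  then have "\<forall>\<^sub>F n in sequentially. f (x n) < e / 2"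
    using assms(2) by (intro order_tendstoD(2)[where y = 0]) (auto simp: Nul_iff)
  then obtain N where N: "\<And>n. n \<ge> N \<Longrightarrow> f (x n) < e / 2" by (auto simp: eventually_sequentially)
  have "f (x m - x n) < e" if "m \<ge> N" "n \<ge> N" for m n
    using av_triangle_diff[OF assms(1), of "x m" "x n"] N[OF that(1)] N[OF that(2)] by linarith
  then show "\<exists>N. \<forall>m\<ge>N. \<forall>n\<ge>N. f (x m - x n) < e" by blast
qed

lemma Cau_bounded:
  assumes "absolute_value f" "x \<in> Cau f"
  obtains B where "B > 0" "\<And>n. f (x n) \<le> B"
proof -
  obtain N where N: "\<And>m n. m \<ge> N \<Longrightarrow> n \<ge> N \<Longrightarrow> f (x m - x n) < 1"
    using CauD[OF assms(2), of 1] by auto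
  define B where "B = Max ((\<lambda>n. f (x n)) ` {..N}) + 1"
  have le: "f (x n) \<le> B - 1" if "n \<le> N" for n using that by (auto simp: B_def)
  have "f (x n) \<le> B" for n
  proof (cases "n \<le> N")
    case True then show ?thesis using le by force
  next
    case False
    then have "f (x n - x N) < 1" by (intro N) auto
    then show ?thesis using av_abs_diff[OF assms(1), of "x n" "x N"] le[of N] by linarith
  qed
  moreover have "B > 0" using le[of 0] av_nonneg[OF assms(1), of "x 0"] by linarith
  ultimately show ?thesis using that by blast
qed

lemma Cau_add:
  assumes "absolute_value f" "x \<in> Cau f" "y \<in> Cau f"
  shows "(\<lambda>n. x n + y n) \<in> Cau f"
  unfolding Cau_iff
proof (intro allI impI)
  fix e :: real assume "e > 0"
  then have "e / 2 > 0" by simp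
  obtain M where M: "\<And>m n. m \<ge> M \<Longrightarrow> n \<ge> M \<Longrightarrow> f (x m - x n) < e / 2"
    using CauD[OF assms(2) \<open>e / 2 > 0\<close>] by blast
  obtain N where N: "\<And>m n. m \<ge> N \<Longrightarrow> n \<ge> N \<Longrightarrow> f (y m - y n) < e / 2"
    using CauD[OF assms(3) \<open>e / 2 > 0\<close>] by blast
  have "f ((x m + y m) - (x n + y n)) < e" if "m \<ge> max M N" "n \<ge> max M N" for m n
    using av_triangle[OF assms(1), of "x m - x n" "y m - y n"] M[of m n] N[of m n] that
    by (simp add: algebra_simps)
  then show "\<exists>N. \<forall>m\<ge>N. \<forall>n\<ge>N. f ((x m + y m) - (x n + y n)) < e" by blast
qed

lemma Cau_mult:
  assumes f: "absolute_value f" and "x \<in> Cau f" "y \<in> Cau f"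
  shows "(\<lambda>n. x n * y n) \<in> Cau f"
  unfolding Cau_iff
proof (intro allI impI)
  fix e :: real assume "e > 0"
  obtain A B where A: "A > 0" "\<And>n. f (x n) \<le> A" and B: "B > 0" "\<And>n. f (y n) \<le> B"
    using Cau_bounded[OF f assms(2)] Cau_bounded[OF f assms(3)] by metis
  have "e / (2 * B) > 0" "e / (2 * A) > 0" using \<open>e > 0\<close> A B by auto
  then obtain M N where M: "\<forall>m\<ge>M. \<forall>n\<ge>M. f (x m - x n) < e / (2 * B)"
    and N: "\<forall>m\<ge>N. \<forall>n\<ge>N. f (y m - y n) < e / (2 * A)"
    using CauD[OF assms(2)] CauD[OF assms(3)] by blast
  have "f (x m * y m - x n * y n) < e" if "m \<ge> max M N" "n \<ge> max M N" for m n
  proof -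
    have "x m * y m - x n * y n = (x m - x n) * y m + x n * (y m - y n)" by (simp add: algebra_simps)
    then have "f (x m * y m - x n * y n) \<le> f (x m - x n) * f (y m) + f (x n) * f (y m - y n)"
      using av_triangle[OF f, of "(x m - x n) * y m" "x n * (y m - y n)"] by (simp add: av_mult[OF f])
    also have "\<dots> \<le> f (x m - x n) * B + A * f (y m - y n)"
      using A B f by (intro add_mono mult_mono) auto
    also have "\<dots> < e / (2 * B) * B + A * (e / (2 * A))"
      using M[rule_format, of m n] N[rule_format, of m n] that A(1) B(1) by (intro add_strict_mono mult_strict_left_mono mult_strict_right_mono) auto
    also have "\<dots> = e" using A B by simp
    finally show ?thesis .
  qed
  then show "\<exists>N. \<forall>m\<ge>N. \<forall>n\<ge>N. f (x m * y m - x n * y n) < e" by blast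
qed

lemma Cau_minus: "absolute_value f \<Longrightarrow> x \<in> Cau f \<Longrightarrow> (\<lambda>n. - x n) \<in> Cau f"
  using Cau_mult[of f "\<lambda>_. -1" x] by simp

lemma Cau_diff:
  assumes "absolute_value f" "x \<in> Cau f" "y \<in> Cau f"
  shows "(\<lambda>n. x n - y n) \<in> Cau f"
  using Cau_add[OF assms(1,2) Cau_minus[OF assms(1,3)]] by simp

lemma Cau_power: "absolute_value f \<Longrightarrow> x \<in> Cau f \<Longrightarrow> (\<lambda>n. x n ^ k) \<in> Cau f"
  by (induction k) (auto intro: Cau_mult)

lemma Cau_sum:
  assumes "absolute_value f" "\<And>i. i \<in> I \<Longrightarrow> x i \<in> Cau f"
  shows "(\<lambda>n. \<Sum>i\<in>I. x i n) \<in> Cau f"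
  using assms(2) by (induction I rule: infinite_finite_induct) (auto intro!: Cau_add simp: assms(1))

lemma Nul_mult:
  assumes f: "absolute_value f" and "x \<in> Cau f" "y \<in> Nul f"
  shows "(\<lambda>n. x n * y n) \<in> Nul f"
proof -
  obtain B where B: "B > 0" "\<And>n. f (x n) \<le> B" using Cau_bounded[OF f assms(2)] by blast
  show ?thesis
  proof (rule Nul_tendsto_le[OF f])
    show "f (x n * y n) \<le> B * f (y n)" for n
      using B f by (simp add: av_mult mult_right_mono)
    show "(\<lambda>n. B * f (y n)) \<longlonglongrightarrow> 0"
      using assms(3) tendsto_mult_right_zero[of "\<lambda>n. f (y n)"] by (simp add: Nul_iff)
  qed
qed

lemma Nul_mult':
  "absolute_value f \<Longrightarrow> x \<in> Nul f \<Longrightarrow> y \<in> Cau f \<Longrightarrow> (\<lambda>n. x n * y n) \<in> Nul f"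
  using Nul_mult[of f y x] by (simp add: mult.commute)

text \<open>The absolute value of the element of the completion represented by a Cauchy sequence.\<close>

definition seq_abs :: "('a::field \<Rightarrow> real) \<Rightarrow> (nat \<Rightarrow> 'a) \<Rightarrow> real" where
  "seq_abs f x = lim (\<lambda>n. f (x n))"

lemma seq_abs_tendsto:
  assumes "absolute_value f" "x \<in> Cau f"
  shows "(\<lambda>n. f (x n)) \<longlonglongrightarrow> seq_abs f x"
proof -
  have "Cauchy (\<lambda>n. f (x n))"
    unfolding Cauchy_def dist_real_def
    using CauD[OF assms(2)] av_abs_diff[OF assms(1)] by (meson order_le_less_trans)
  then show ?thesis
    unfolding seq_abs_def by (simp add: Cauchy_convergent_iff convergent_LIMSEQ_iff)
qed

lemma seq_abs_eqI: "(\<lambda>n. f (x n)) \<longlonglongrightarrow> l \<Longrightarrow> seq_abs f x = l"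
  unfolding seq_abs_def by (rule limI)

lemma seq_abs_const [simp]: "seq_abs f (\<lambda>_. a) = f a"
  by (rule seq_abs_eqI) simp

lemma seq_abs_nonneg [simp]: "absolute_value f \<Longrightarrow> x \<in> Cau f \<Longrightarrow> 0 \<le> seq_abs f x"
  using seq_abs_tendsto[of f x] by (rule tendsto_lowerbound) auto

lemma seq_abs_0_iff: "absolute_value f \<Longrightarrow> x \<in> Cau f \<Longrightarrow> seq_abs f x = 0 \<longleftrightarrow> x \<in> Nul f"
  using seq_abs_tendsto[of f x] seq_abs_eqI[of f x 0] by (auto simp: Nul_iff)

lemma seq_abs_mult:
  "absolute_value f \<Longrightarrow> x \<in> Cau f \<Longrightarrow> y \<in> Cau f \<Longrightarrow> seq_abs f (\<lambda>n. x n * y n) = seq_abs f x * seq_abs f y"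
  by (rule seq_abs_eqI) (auto simp: av_mult intro!: tendsto_mult seq_abs_tendsto)

lemma seq_abs_power:
  "absolute_value f \<Longrightarrow> x \<in> Cau f \<Longrightarrow> seq_abs f (\<lambda>n. x n ^ k) = seq_abs f x ^ k"
  by (rule seq_abs_eqI) (auto simp: av_power intro!: tendsto_power seq_abs_tendsto)

lemma seq_abs_minus [simp]: "absolute_value f \<Longrightarrow> seq_abs f (\<lambda>n. - x n) = seq_abs f x"
  by (simp add: seq_abs_def)

lemma seq_abs_triangle:
  assumes f: "absolute_value f" and "x \<in> Cau f" "y \<in> Cau f"
  shows "seq_abs f (\<lambda>n. x n + y n) \<le> seq_abs f x + seq_abs f y"
proof (rule LIMSEQ_le)
  show "(\<lambda>n. f (x n + y n)) \<longlonglongrightarrow> seq_abs f (\<lambda>n. x n + y n)"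
    by (intro seq_abs_tendsto Cau_add assms)
  show "(\<lambda>n. f (x n) + f (y n)) \<longlonglongrightarrow> seq_abs f x + seq_abs f y"
    by (intro tendsto_add seq_abs_tendsto assms)
  show "\<exists>N. \<forall>n\<ge>N. f (x n + y n) \<le> f (x n) + f (y n)" using av_triangle[OF f] by auto
qed

lemma seq_abs_cong:
  assumes f: "absolute_value f" and "x \<in> Cau f" "(\<lambda>n. y n - x n) \<in> Nul f"
  shows "seq_abs f y = seq_abs f x"
proof (rule seq_abs_eqI)
  have "(\<lambda>n. f (y n) - f (x n)) \<longlonglongrightarrow> 0"
  proof (rule tendsto_rabs_zero_cancel, rule tendsto_sandwich[of "\<lambda>_. 0" _ _ "\<lambda>n. f (y n - x n)"])
    show "(\<lambda>n. f (y n - x n)) \<longlonglongrightarrow> 0" using assms(3) by (simp add: Nul_iff)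
  qed (use av_abs_diff[OF f] in auto)
  then show "(\<lambda>n. f (y n)) \<longlonglongrightarrow> seq_abs f x"
    using tendsto_add[OF _ seq_abs_tendsto[OF f assms(2)]] by fastforce
qed

text \<open>A late entry of the sequence approximates the class of the sequence.\<close>

lemma seq_abs_dense:
  assumes f: "absolute_value f" and "x \<in> Cau f" "e > 0"
  shows "\<exists>a. seq_abs f (\<lambda>n. x n - a) < e"
proof -
  obtain N where N: "\<And>m n. m \<ge> N \<Longrightarrow> n \<ge> N \<Longrightarrow> f (x m - x n) < e / 2"
    using CauD[OF assms(2), of "e / 2"] assms(3) by auto
  have "seq_abs f (\<lambda>n. x n - x N) \<le> e / 2"
  proof (rule tendsto_upperbound)
    show "(\<lambda>n. f (x n - x N)) \<longlonglongrightarrow> seq_abs f (\<lambda>n. x n - x N)"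
      by (intro seq_abs_tendsto Cau_diff assms Cau_const)
    show "\<forall>\<^sub>F n in sequentially. f (x n - x N) \<le> e / 2"
      using N by (auto simp: eventually_sequentially intro!: exI[of _ N] less_imp_le)
  qed simp
  then show ?thesis using assms(3) by (intro exI[of _ "x N"]) simp
qed

lemma seq_abs_nonarch_le:
  assumes f: "absolute_value f" "nonarchimedean f" and x: "x \<in> Cau f" "y \<in> Cau f"
    and C: "seq_abs f x \<le> C" "seq_abs f y \<le> C"
  shows "seq_abs f (\<lambda>n. x n + y n) \<le> C"
proof -
  have "seq_abs f (\<lambda>n. x n + y n) \<le> max (seq_abs f x) (seq_abs f y)"
  proof (rule LIMSEQ_le)
    show "(\<lambda>n. f (x n + y n)) \<longlonglongrightarrow> seq_abs f (\<lambda>n. x n + y n)"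
      by (intro seq_abs_tendsto Cau_add assms)
    show "(\<lambda>n. max (f (x n)) (f (y n))) \<longlonglongrightarrow> max (seq_abs f x) (seq_abs f y)"
      by (intro tendsto_max seq_abs_tendsto assms)
    show "\<exists>N. \<forall>n\<ge>N. f (x n + y n) \<le> max (f (x n)) (f (y n))"
      using f(2) by (auto simp: nonarchimedean_def)
  qed
  then show ?thesis using C by simp
qed

text \<open>Off the null sequences the values are eventually above half of their positive limit,
  which makes the pointwise inverses Cauchy; the finitely many earlier entries, possibly zero,
  contribute only a null sequence.\<close>

lemma Cau_inverse:
  assumes f: "absolute_value f" and x: "x \<in> Cau f" "x \<notin> Nul f"
  obtains y where "y \<in> Cau f" "(\<lambda>n. x n * y n - 1) \<in> Nul f"
proof -
  let ?l = "seq_abs f x"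
  have l: "?l > 0" using seq_abs_0_iff[OF f x(1)] seq_abs_nonneg[OF f x(1)] x(2) by linarith
  then have "\<forall>\<^sub>F n in sequentially. f (x n) > ?l / 2"
    by (intro order_tendstoD(1)[OF seq_abs_tendsto[OF f x(1)]]) auto
  then obtain N where N: "\<And>n. n \<ge> N \<Longrightarrow> f (x n) > ?l / 2" by (auto simp: eventually_sequentially)
  have nz: "x n \<noteq> 0" if "n \<ge> N" for n using N[OF that] l f by auto
  show ?thesis
  proof
    show "(\<lambda>n. inverse (x n)) \<in> Cau f"
      unfolding Cau_iff
    proof (intro allI impI)
      fix e :: real assume "e > 0"
      then have "e * (?l / 2)\<^sup>2 > 0" using l by simp
      then obtain M where M: "\<And>m n. m \<ge> M \<Longrightarrow> n \<ge> M \<Longrightarrow> f (x m - x n) < e * (?l / 2)\<^sup>2"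
        using CauD[OF x(1)] by blast
      have "f (inverse (x m) - inverse (x n)) < e" if "m \<ge> max M N" "n \<ge> max M N" for m n
      proof -
        have pos: "0 < f (x m) * f (x n)" using nz[of m] nz[of n] that f by simp
        have "inverse (x m) - inverse (x n) = (x n - x m) / (x m * x n)"
          using nz[of m] nz[of n] that by (simp add: field_simps)
        then have "f (inverse (x m) - inverse (x n)) = f (x n - x m) / (f (x m) * f (x n))"
          by (simp add: av_divide av_mult f)
        also have "\<dots> < e"
        proof -
          have "f (x n - x m) < e * (?l / 2)\<^sup>2" using M[of n m] that by simp
          also have "\<dots> \<le> e * (f (x m) * f (x n))"
            unfolding power2_eq_square using N[of m] N[of n] that l \<open>e > 0\<close>
            by (intro mult_left_mono mult_mono) auto
          finally show ?thesis using pos by (simp add: pos_divide_less_eq)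
        qed
        finally show ?thesis .
      qed
      then show "\<exists>N. \<forall>m\<ge>N. \<forall>n\<ge>N. f (inverse (x m) - inverse (x n)) < e" by blast
    qed
    have "\<forall>\<^sub>F n in sequentially. f (x n * inverse (x n) - 1) = 0"
      using nz f by (auto simp: eventually_sequentially intro!: exI[of _ N])
    then show "(\<lambda>n. x n * inverse (x n) - 1) \<in> Nul f"
      unfolding Nul_iff by (rule tendsto_eventually)
  qed
qed

section \<open>The completion as a quotient field\<close>

lemma cauchy_ring_simps [simp]:
  "x \<otimes>\<^bsub>cauchy_ring f\<^esub> y = (\<lambda>n. x n * y n)"
  "\<one>\<^bsub>cauchy_ring f\<^esub> = (\<lambda>n. 1)"
  "x \<oplus>\<^bsub>cauchy_ring f\<^esub> y = (\<lambda>n. x n + y n)"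
  "\<zero>\<^bsub>cauchy_ring f\<^esub> = (\<lambda>n. 0)"
  by (auto simp: cauchy_ring_def)

lemma cauchy_ring_cring:
  assumes f: "absolute_value f"
  shows "cring (cauchy_ring f)"
proof (rule cringI)
  show "abelian_group (cauchy_ring f)"
  proof (rule abelian_groupI)
    fix x assume "x \<in> Cau f"
    then show "\<exists>y\<in>Cau f. y \<oplus>\<^bsub>cauchy_ring f\<^esub> x = \<zero>\<^bsub>cauchy_ring f\<^esub>"
      using f by (intro bexI[of _ "\<lambda>n. - x n"]) (auto intro: Cau_minus)
  qed (use f in \<open>auto intro: Cau_add simp: algebra_simps\<close>)
  show "comm_monoid (cauchy_ring f)"
    by (rule comm_monoidI) (use f in \<open>auto intro: Cau_mult simp: algebra_simps\<close>)
qed (simp add: algebra_simps)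

lemma cauchy_ring_minus:
  assumes f: "absolute_value f" and x: "x \<in> Cau f"
  shows "a_inv (cauchy_ring f) x = (\<lambda>n. - x n)"
proof -
  interpret cring "cauchy_ring f" by (rule cauchy_ring_cring[OF f])
  show ?thesis
    using x f by (intro minus_equality) (auto intro: Cau_minus)
qed

lemma null_sequences_ideal:
  assumes f: "absolute_value f"
  shows "ideal (Nul f) (cauchy_ring f)"
proof (rule idealI)
  interpret cring "cauchy_ring f" by (rule cauchy_ring_cring[OF f])
  show "ring (cauchy_ring f)" by unfold_locales
  show "subgroup (Nul f) (add_monoid (cauchy_ring f))"
  proof
    show "Nul f \<subseteq> carrier (add_monoid (cauchy_ring f))" using Nul_in_Cau[OF f] by auto
    show "inv\<^bsub>add_monoid (cauchy_ring f)\<^esub> x \<in> Nul f" if "x \<in> Nul f" for x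
      using cauchy_ring_minus[OF f Nul_in_Cau[OF f that]] Nul_minus[OF f that]
      by (simp add: a_inv_def)
  qed (use f in \<open>auto intro: Nul_add\<close>)
qed (use f in \<open>auto intro: Nul_mult Nul_mult'\<close>)

text \<open>The coset of the null sequences through \<open>x\<close>, in a form that turns equality
  of classes into a statement about one null sequence.\<close>

definition seq_class :: "('a::field \<Rightarrow> real) \<Rightarrow> (nat \<Rightarrow> 'a) \<Rightarrow> (nat \<Rightarrow> 'a) set" where
  "seq_class f x = {y. (\<lambda>n. y n - x n) \<in> Nul f}"

lemma seq_class_eq:
  assumes "absolute_value f"
  shows "Nul f +>\<^bsub>cauchy_ring f\<^esub> x = seq_class f x"
proof -
  have "y \<in> Nul f +>\<^bsub>cauchy_ring f\<^esub> x \<longleftrightarrow> (\<lambda>n. y n - x n) \<in> Nul f" for y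
    unfolding a_r_coset_def' by (auto intro!: bexI[of _ "\<lambda>n. y n - x n"])
  then show ?thesis by (auto simp: seq_class_def)
qed

lemma seq_class_eq_iff:
  assumes f: "absolute_value f"
  shows "seq_class f x = seq_class f y \<longleftrightarrow> (\<lambda>n. x n - y n) \<in> Nul f"
proof
  assume "seq_class f x = seq_class f y"
  moreover have "x \<in> seq_class f x" using f by (simp add: seq_class_def)
  ultimately show "(\<lambda>n. x n - y n) \<in> Nul f" by (simp add: seq_class_def)
next
  assume xy: "(\<lambda>n. x n - y n) \<in> Nul f"
  show "seq_class f x = seq_class f y"
    unfolding seq_class_def using Nul_add[OF f _ xy] Nul_diff[OF f _ xy] by force
qed

lemma completion_carrier: "absolute_value f \<Longrightarrow> carrier (field_completion f) = seq_class f ` Cau f"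
  by (auto simp: field_completion_def FactRing_def A_RCOSETS_def' seq_class_eq)

lemma completion_carrierE:
  assumes "absolute_value f" "U \<in> carrier (field_completion f)"
  obtains x where "x \<in> Cau f" "U = seq_class f x"
  using assms by (auto simp: completion_carrier)

lemma seq_class_in_carrier [simp]:
  "absolute_value f \<Longrightarrow> x \<in> Cau f \<Longrightarrow> seq_class f x \<in> carrier (field_completion f)"
  by (simp add: completion_carrier)

lemma completion_add:
  assumes f: "absolute_value f" and "x \<in> Cau f" "y \<in> Cau f"
  shows "seq_class f x \<oplus>\<^bsub>field_completion f\<^esub> seq_class f y = seq_class f (\<lambda>n. x n + y n)"
proof -
  interpret ideal "Nul f" "cauchy_ring f" by (rule null_sequences_ideal[OF f])
  show ?thesis
    using a_rcos_sum[OF assms(2,3)] by (simp add: field_completion_def FactRing_def seq_class_eq f)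
qed

lemma completion_mult:
  assumes f: "absolute_value f" and "x \<in> Cau f" "y \<in> Cau f"
  shows "seq_class f x \<otimes>\<^bsub>field_completion f\<^esub> seq_class f y = seq_class f (\<lambda>n. x n * y n)"
proof -
  interpret ideal "Nul f" "cauchy_ring f" by (rule null_sequences_ideal[OF f])
  show ?thesis
    using rcoset_mult_add[OF assms(2,3)] by (simp add: field_completion_def FactRing_def seq_class_eq f)
qed

lemma completion_one: "absolute_value f \<Longrightarrow> \<one>\<^bsub>field_completion f\<^esub> = seq_class f (\<lambda>_. 1)"
  by (simp add: field_completion_def FactRing_def seq_class_eq)

lemma completion_zero: "\<zero>\<^bsub>field_completion f\<^esub> = seq_class f (\<lambda>_. 0)"
  by (simp add: field_completion_def FactRing_def seq_class_def)

lemma completion_cring: "absolute_value f \<Longrightarrow> cring (field_completion f)"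
  unfolding field_completion_def
  by (intro ideal.quotient_is_cring null_sequences_ideal cauchy_ring_cring)

lemma completion_minus:
  assumes f: "absolute_value f" and x: "x \<in> Cau f"
  shows "a_inv (field_completion f) (seq_class f x) = seq_class f (\<lambda>n. - x n)"
proof -
  interpret cring "field_completion f" by (rule completion_cring[OF f])
  show ?thesis
    using x f Cau_minus[OF f x] by (intro minus_equality) (simp_all add: completion_add completion_zero)
qed

lemma completion_diff:
  assumes f: "absolute_value f" and x: "x \<in> Cau f" "y \<in> Cau f"
  shows "seq_class f x \<ominus>\<^bsub>field_completion f\<^esub> seq_class f y = seq_class f (\<lambda>n. x n - y n)"
  using assms by (simp add: a_minus_def completion_minus completion_add Cau_minus)

lemma completion_one_neq_zero:
  "absolute_value f \<Longrightarrow> \<one>\<^bsub>field_completion f\<^esub> \<noteq> \<zero>\<^bsub>field_completion f\<^esub>"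
  by (auto simp: completion_one completion_zero seq_class_eq_iff Nul_iff LIMSEQ_const_iff)

lemma completion_field:
  assumes f: "absolute_value f"
  shows "field (field_completion f)"
proof -
  interpret cring "field_completion f" by (rule completion_cring[OF f])
  show ?thesis
  proof (rule cring_fieldI2)
    show "\<zero>\<^bsub>field_completion f\<^esub> \<noteq> \<one>\<^bsub>field_completion f\<^esub>"
      using completion_one_neq_zero[OF f] by simp
    fix U assume U: "U \<in> carrier (field_completion f)" "U \<noteq> \<zero>\<^bsub>field_completion f\<^esub>"
    obtain x where x: "x \<in> Cau f" "U = seq_class f x" using completion_carrierE[OF f U(1)] .
    then have "x \<notin> Nul f" using U(2) by (simp add: completion_zero seq_class_eq_iff f)
    then obtain y where "y \<in> Cau f" "(\<lambda>n. x n * y n - 1) \<in> Nul f" using Cau_inverse[OF f x(1)] by blast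
    then show "\<exists>Y\<in>carrier (field_completion f). U \<otimes>\<^bsub>field_completion f\<^esub> Y = \<one>\<^bsub>field_completion f\<^esub>"
      using x f by (intro bexI[of _ "seq_class f y"]) (auto simp: completion_mult completion_one seq_class_eq_iff)
  qed
qed

text \<open>The limit depends only on the coset, so the representative picked by \<open>SOME\<close>
  may be exchanged for \<open>x\<close>.\<close>

lemma completion_abs_seq_class:
  assumes f: "absolute_value f" and x: "x \<in> Cau f"
  shows "completion_abs f (seq_class f x) = seq_abs f x"
proof -
  have "(SOME y. y \<in> seq_class f x) \<in> seq_class f x"
    by (rule someI[of _ x]) (simp add: seq_class_def f)
  then show ?thesis
    unfolding completion_abs_def using seq_abs_cong[OF f x] by (simp add: seq_class_def seq_abs_def)
qed

lemma valuation_ring_seq_class: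
  "absolute_value f \<Longrightarrow> x \<in> Cau f \<Longrightarrow> seq_class f x \<in> valuation_ring f \<longleftrightarrow> seq_abs f x \<le> 1"
  by (simp add: valuation_ring_def completion_abs_seq_class)

section \<open>First-order formulas\<close>

lemma term_value_cong: "(\<And>i. i \<in> term_vars t \<Longrightarrow> e i = e' i) \<Longrightarrow> term_value R e t = term_value R e' t"
  by (induction t) auto

lemma satisfies_cong: "(\<And>i. i \<in> free_vars p \<Longrightarrow> e i = e' i) \<Longrightarrow> satisfies R e p = satisfies R e' p"
proof (induction p arbitrary: e e')
  case (Equal s t)
  have "term_value R e s = term_value R e' s" "term_value R e t = term_value R e' t"
    by (rule term_value_cong, simp add: Equal)+
  then show ?case by simp
next
  case (Negation p)
  have "satisfies R e p = satisfies R e' p"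
    by (rule Negation.IH) (simp add: Negation.prems)
  then show ?case by simp
next
  case (Conj p q)
  have "satisfies R e p = satisfies R e' p" "satisfies R e q = satisfies R e' q"
    by (rule Conj.IH; simp add: Conj.prems)+
  then show ?case by simp
next
  case (Forall i p)
  have "satisfies R (e(i := a)) p = satisfies R (e'(i := a)) p" for a
    using Forall.prems by (intro Forall.IH) auto
  then show ?case by simp
qed

text \<open>A sentence has the same truth value under all assignments. Membership of
  \<open>e i\<close> guarantees an inhabited carrier, without which \<open>holds_in\<close> would be
  vacuously true.\<close>

lemma holds_in_iff:
  assumes "sentence p" "e i \<in> carrier R"
  shows "holds_in R p \<longleftrightarrow> satisfies R e p"
proof -
  have eq: "satisfies R e p = satisfies R e' p" for e'
    using assms(1) by (intro satisfies_cong) (simp add: sentence_def)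
  have "range (\<lambda>_. e i) \<subseteq> carrier R" using assms(2) by auto
  then show ?thesis unfolding holds_in_def using eq by blast
qed

lemma finite_term_vars [simp]: "finite (term_vars t)"
  by (induction t) auto

lemma finite_free_vars [simp]: "finite (free_vars p)"
  by (induction p) auto

section \<open>Derived connectives and blocks of quantifiers\<close>

abbreviation "Disj p q \<equiv> Negation (Conj (Negation p) (Negation q))"
abbreviation "Impl p q \<equiv> Negation (Conj p (Negation q))"
abbreviation "Exist i p \<equiv> Negation (Forall i (Negation p))"

primrec Conjs :: "ring_formula list \<Rightarrow> ring_formula" where
  "Conjs [] = Equal Zero Zero"
| "Conjs (p # ps) = Conj p (Conjs ps)"

primrec exs :: "nat \<Rightarrow> ring_formula \<Rightarrow> ring_formula" where
  "exs 0 p = p"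
| "exs (Suc n) p = exs n (Exist n p)"

lemma free_vars_exs [simp]: "free_vars (exs n p) = free_vars p - {..<n}"
  by (induction n arbitrary: p) auto

lemma free_vars_Conjs [simp]: "free_vars (Conjs ps) = (\<Union>p\<in>set ps. free_vars p)"
  by (induction ps) auto

lemma satisfies_Conjs [simp]: "satisfies R e (Conjs ps) \<longleftrightarrow> (\<forall>p\<in>set ps. satisfies R e p)"
  by (induction ps) auto

lemma satisfies_exs:
  "satisfies R e (exs n p) \<longleftrightarrow>
     (\<exists>e'. (\<forall>i<n. e' i \<in> carrier R) \<and> (\<forall>i\<ge>n. e' i = e i) \<and> satisfies R e' p)"
proof (induction n arbitrary: p)
  case 0
  have "(\<forall>i\<ge>0. e' i = e i) \<longleftrightarrow> e' = e" for e' by auto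
  then show ?case by simp
next
  case (Suc n)
  show ?case (is "_ = ?rhs")
  proof
    assume "satisfies R e (exs (Suc n) p)"
    then obtain e' a where e': "\<forall>i<n. e' i \<in> carrier R" "\<forall>i\<ge>n. e' i = e i" "a \<in> carrier R"
      "satisfies R (e'(n := a)) p"
      using Suc.IH[of "Exist n p"] by auto
    then show ?rhs by (intro exI[of _ "e'(n := a)"]) (auto simp: less_Suc_eq fun_upd_def)
  next
    assume ?rhs
    then obtain e' where e': "\<forall>i<Suc n. e' i \<in> carrier R" "\<forall>i\<ge>Suc n. e' i = e i" "satisfies R e' p"
      by blast
    \<comment> \<open>The outer block leaves the variables from \<open>n\<close> on as in
      \<open>e\<close>, so the value at \<open>n\<close> is reset to \<open>e n\<close> and
      \<open>e' n\<close> becomes the inner witness.\<close>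
    have "satisfies R (e'(n := e n)) (Exist n p)"
      using e' by (auto intro!: bexI[of _ "e' n"])
    then show "satisfies R e (exs (Suc n) p)"
      using e' unfolding exs.simps Suc.IH by (intro exI[of _ "e'(n := e n)"]) auto
  qed
qed

text \<open>Evaluation in the field itself, to be applied entry by entry to Cauchy
  sequences.\<close>

primrec term_at :: "(nat \<Rightarrow> 'a::ring_1) \<Rightarrow> ring_term \<Rightarrow> 'a" where
  "term_at e (Var i) = e i"
| "term_at e Zero = 0"
| "term_at e One = 1"
| "term_at e (Plus s t) = term_at e s + term_at e t"
| "term_at e (Minus s t) = term_at e s - term_at e t"
| "term_at e (Times s t) = term_at e s * term_at e t"

text \<open>Truth in the completion, phrased in terms of representing Cauchy sequences.\<close>

primrec sat :: "('a::field \<Rightarrow> real) \<Rightarrow> (nat \<Rightarrow> nat \<Rightarrow> 'a) \<Rightarrow> ring_formula \<Rightarrow> bool" where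
  "sat f e (Equal s t) \<longleftrightarrow> (\<lambda>n. term_at (\<lambda>i. e i n) s - term_at (\<lambda>i. e i n) t) \<in> Nul f"
| "sat f e (Negation p) \<longleftrightarrow> \<not> sat f e p"
| "sat f e (Conj p q) \<longleftrightarrow> sat f e p \<and> sat f e q"
| "sat f e (Forall i p) \<longleftrightarrow> (\<forall>x\<in>Cau f. sat f (e(i := x)) p)"

lemma Cau_term_at:
  assumes f: "absolute_value f" and e: "\<And>i. e i \<in> Cau f"
  shows "(\<lambda>n. term_at (\<lambda>i. e i n) t) \<in> Cau f"
  by (induction t) (auto intro: Cau_add Cau_mult Cau_diff simp: f e eta_contract_eq)

lemma term_value_seq_class:
  assumes f: "absolute_value f" and e: "\<And>i. e i \<in> Cau f"
  shows "term_value (field_completion f) (\<lambda>i. seq_class f (e i)) t = seq_class f (\<lambda>n. term_at (\<lambda>i. e i n) t)"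
  by (induction t)
     (auto simp: completion_zero completion_one[OF f] completion_add[OF f] completion_diff[OF f]
        completion_mult[OF f] Cau_term_at f e)

lemma satisfies_iff_sat:
  assumes f: "absolute_value f" and e: "\<And>i. e i \<in> Cau f"
  shows "satisfies (field_completion f) (\<lambda>i. seq_class f (e i)) p \<longleftrightarrow> sat f e p"
  using e
proof (induction p arbitrary: e)
  case (Equal s t)
  then show ?case by (simp add: term_value_seq_class f seq_class_eq_iff)
next
  case (Forall i p)
  have "(\<lambda>i. seq_class f (e i))(i := seq_class f x) = (\<lambda>j. seq_class f ((e(i := x)) j))" for x
    by (rule ext) simp
  moreover have "satisfies (field_completion f) (\<lambda>j. seq_class f ((e(i := x)) j)) p = sat f (e(i := x)) p"
    if "x \<in> Cau f" for x
    using that Forall.prems by (intro Forall.IH) auto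
  ultimately show ?case by (simp add: completion_carrier f)
qed simp_all

lemma holds_in_completion_iff:
  assumes "absolute_value f" "sentence p" "\<And>i. e i \<in> Cau f"
  shows "holds_in (field_completion f) p \<longleftrightarrow> sat f e p"
  using holds_in_iff[OF assms(2), of "\<lambda>i. seq_class f (e i)" 0 "field_completion f"]
    satisfies_iff_sat[OF assms(1,3)] assms(1,3) by simp

lemma sat_Conjs [simp]: "absolute_value f \<Longrightarrow> sat f e (Conjs ps) \<longleftrightarrow> (\<forall>p\<in>set ps. sat f e p)"
  by (induction ps) auto

lemma sat_exs:
  "sat f e (exs n p) \<longleftrightarrow>
     (\<exists>e'. (\<forall>i<n. e' i \<in> Cau f) \<and> (\<forall>i\<ge>n. e' i = e i) \<and> sat f e' p)"
proof (induction n arbitrary: p)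
  case 0
  have "(\<forall>i\<ge>0. e' i = e i) \<longleftrightarrow> e' = e" for e' by auto
  then show ?case by simp
next
  case (Suc n)
  show ?case (is "_ = ?rhs")
  proof
    assume "sat f e (exs (Suc n) p)"
    then obtain e' a where e': "\<forall>i<n. e' i \<in> Cau f" "\<forall>i\<ge>n. e' i = e i" "a \<in> Cau f"
      "sat f (e'(n := a)) p"
      using Suc.IH[of "Exist n p"] by auto
    then show ?rhs by (intro exI[of _ "e'(n := a)"]) (auto simp: less_Suc_eq fun_upd_def)
  next
    assume ?rhs
    then obtain e' where e': "\<forall>i<Suc n. e' i \<in> Cau f" "\<forall>i\<ge>Suc n. e' i = e i" "sat f e' p"
      by blast
    have "sat f (e'(n := e n)) (Exist n p)"
      using e' by (auto intro!: bexI[of _ "e' n"])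
    then show "sat f e (exs (Suc n) p)"
      using e' unfolding exs.simps Suc.IH by (intro exI[of _ "e'(n := e n)"]) auto
  qed
qed

lemma sentence_exs: "free_vars p \<subseteq> {..<n} \<Longrightarrow> sentence (exs n p)"
  by (auto simp: sentence_def)

lemma holds_in_completion_exs:
  assumes f: "absolute_value f" and p: "free_vars p \<subseteq> {..<n}"
  shows "holds_in (field_completion f) (exs n p) \<longleftrightarrow>
    (\<exists>e. (\<forall>i. e i \<in> Cau f) \<and> sat f e p)"
proof -
  have "holds_in (field_completion f) (exs n p) \<longleftrightarrow> sat f (\<lambda>_ _. 0) (exs n p)"
    using f p by (intro holds_in_completion_iff sentence_exs) auto
  also have "\<dots> \<longleftrightarrow> (\<exists>e. (\<forall>i. e i \<in> Cau f) \<and> sat f e p)"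
  proof
    assume "sat f (\<lambda>_ _. 0) (exs n p)"
    then obtain e' where "\<forall>i<n. e' i \<in> Cau f" "\<forall>i\<ge>n. e' i = (\<lambda>_. 0)" "sat f e' p"
      by (auto simp: sat_exs)
    then show "\<exists>e. (\<forall>i. e i \<in> Cau f) \<and> sat f e p"
      using f by (intro exI[of _ e']) (metis Cau_const linorder_not_le)
  next
    assume "\<exists>e. (\<forall>i. e i \<in> Cau f) \<and> sat f e p"
    then obtain e where e: "\<And>i. e i \<in> Cau f" "sat f e p" by auto
    \<comment> \<open>Variables from \<open>n\<close> on are not free in \<open>p\<close>; setting
      them to zero matches the assignment outside the quantified block.\<close>
    let ?e = "\<lambda>i. if i < n then e i else (\<lambda>_. 0)"
    have e': "\<And>i. ?e i \<in> Cau f" using e f by auto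
    have "satisfies (field_completion f) (\<lambda>i. seq_class f (e i)) p =
      satisfies (field_completion f) (\<lambda>i. seq_class f (?e i)) p"
      using p by (intro satisfies_cong) auto
    then have "sat f ?e p"
      using satisfies_iff_sat[OF f e(1)] satisfies_iff_sat[OF f e'] e(2) by simp
    then show "sat f (\<lambda>_ _. 0) (exs n p)"
      unfolding sat_exs using e by (intro exI[of _ ?e]) auto
  qed
  finally show ?thesis .
qed

section \<open>Idempotents of the adele ring\<close>

abbreviation adeles :: "'k::field adele ring" where
  "adeles \<equiv> adele_ring TYPE('k)"

lemma place_field: "v \<in> places \<Longrightarrow> field (completion_at v)"
  by (simp add: completion_field)

lemma place_cring: "v \<in> places \<Longrightarrow> cring (completion_at v)"
  by (simp add: completion_cring)

lemmas place_simps = cring.cring_simprules[OF place_cring]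

lemma place_r_one [simp]:
  assumes "v \<in> places" "a \<in> carrier (completion_at v)"
  shows "a \<otimes>\<^bsub>completion_at v\<^esub> \<one>\<^bsub>completion_at v\<^esub> = a"
proof -
  interpret cring "completion_at v" by (rule place_cring[OF assms(1)])
  show ?thesis using assms(2) by simp
qed

lemma valuation_ring_closed:
  assumes f: "absolute_value f"
  shows "\<zero>\<^bsub>field_completion f\<^esub> \<in> valuation_ring f" "\<one>\<^bsub>field_completion f\<^esub> \<in> valuation_ring f"
    "U \<in> valuation_ring f \<Longrightarrow> a_inv (field_completion f) U \<in> valuation_ring f"
    "U \<in> valuation_ring f \<Longrightarrow> W \<in> valuation_ring f \<Longrightarrow> U \<otimes>\<^bsub>field_completion f\<^esub> W \<in> valuation_ring f"
    "nonarchimedean f \<Longrightarrow> U \<in> valuation_ring f \<Longrightarrow> W \<in> valuation_ring f \<Longrightarrow> U \<oplus>\<^bsub>field_completion f\<^esub> W \<in> valuation_ring f"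
proof -
  have rep: "\<exists>x\<in>Cau f. U = seq_class f x \<and> seq_abs f x \<le> 1" if "U \<in> valuation_ring f" for U
    using that f by (auto simp: valuation_ring_def completion_carrier completion_abs_seq_class)
  show "\<zero>\<^bsub>field_completion f\<^esub> \<in> valuation_ring f" "\<one>\<^bsub>field_completion f\<^esub> \<in> valuation_ring f"
    using f by (auto simp: completion_zero completion_one valuation_ring_seq_class)
  show "a_inv (field_completion f) U \<in> valuation_ring f" if "U \<in> valuation_ring f"
    using rep[OF that] f by (auto simp: completion_minus valuation_ring_seq_class Cau_minus)
  show "U \<otimes>\<^bsub>field_completion f\<^esub> W \<in> valuation_ring f" if "U \<in> valuation_ring f" "W \<in> valuation_ring f"
    using rep[OF that(1)] rep[OF that(2)] f
    by (auto simp: completion_mult valuation_ring_seq_class Cau_mult seq_abs_mult intro!: mult_le_one)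
  show "U \<oplus>\<^bsub>field_completion f\<^esub> W \<in> valuation_ring f"
    if "nonarchimedean f" "U \<in> valuation_ring f" "W \<in> valuation_ring f"
    using rep[OF that(2)] rep[OF that(3)] f that(1)
    by (auto simp: completion_add valuation_ring_seq_class Cau_add intro: seq_abs_nonarch_le)
qed

lemma adele_simps [simp]:
  "x \<otimes>\<^bsub>adeles\<^esub> y = (\<lambda>v\<in>places. x v \<otimes>\<^bsub>completion_at v\<^esub> y v)"
  "x \<oplus>\<^bsub>adeles\<^esub> y = (\<lambda>v\<in>places. x v \<oplus>\<^bsub>completion_at v\<^esub> y v)"
  "\<one>\<^bsub>adeles\<^esub> = (\<lambda>v\<in>places. \<one>\<^bsub>completion_at v\<^esub>)"
  "\<zero>\<^bsub>adeles\<^esub> = (\<lambda>v\<in>places. \<zero>\<^bsub>completion_at v\<^esub>)"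
  by (simp_all add: adele_ring_def)

lemma adele_carrier:
  "x \<in> carrier adeles \<longleftrightarrow> x \<in> (\<Pi>\<^sub>E v\<in>places. carrier (completion_at v)) \<and>
     finite {v \<in> places. nonarchimedean (place_abs v) \<and> x v \<notin> valuation_ring (place_abs v)}"
  by (simp add: adele_ring_def)

lemma adele_component: "x \<in> carrier adeles \<Longrightarrow> v \<in> places \<Longrightarrow> x v \<in> carrier (completion_at v)"
  by (auto simp: adele_carrier)

lemma adele_eqI:
  assumes "x \<in> carrier adeles" "y \<in> carrier adeles" "\<And>v. v \<in> places \<Longrightarrow> x v = y v"
  shows "x = y"
  using assms by (auto simp: adele_carrier intro: PiE_ext)

lemma adele_add_closed:
  fixes x y :: "'k::field adele"
  assumes "x \<in> carrier adeles" "y \<in> carrier adeles"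
  shows "x \<oplus>\<^bsub>adeles\<^esub> y \<in> carrier adeles"
proof -
  have "finite {v \<in> places. nonarchimedean (place_abs v) \<and> (x \<oplus>\<^bsub>adeles\<^esub> y) v \<notin> valuation_ring (place_abs v)}"
  proof (rule finite_subset)
    show "{v \<in> places. nonarchimedean (place_abs v) \<and> (x \<oplus>\<^bsub>adeles\<^esub> y) v \<notin> valuation_ring (place_abs v)}
      \<subseteq> {v \<in> places. nonarchimedean (place_abs v) \<and> x v \<notin> valuation_ring (place_abs v)} \<union>
        {v \<in> places. nonarchimedean (place_abs v) \<and> y v \<notin> valuation_ring (place_abs v)}"
      using valuation_ring_closed(5)[OF place_abs_av] by auto
  qed (use assms in \<open>auto simp: adele_carrier\<close>)
  moreover have "(x \<oplus>\<^bsub>adeles\<^esub> y) \<in> (\<Pi>\<^sub>E v\<in>places. carrier (completion_at v))"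
    by (auto simp: place_simps adele_component[OF assms(1)] adele_component[OF assms(2)])
  ultimately show ?thesis unfolding adele_carrier by blast
qed

lemma adele_minus_in:
  fixes x :: "'k::field adele"
  assumes "x \<in> carrier adeles"
  shows "(\<lambda>v\<in>places. a_inv (completion_at v) (x v)) \<in> carrier adeles"
proof -
  have "finite {v \<in> places. nonarchimedean (place_abs v) \<and> a_inv (completion_at v) (x v) \<notin> valuation_ring (place_abs v)}"
  proof (rule finite_subset)
    show "{v \<in> places. nonarchimedean (place_abs v) \<and> a_inv (completion_at v) (x v) \<notin> valuation_ring (place_abs v)}
      \<subseteq> {v \<in> places. nonarchimedean (place_abs v) \<and> x v \<notin> valuation_ring (place_abs v)}"
      using valuation_ring_closed(3)[OF place_abs_av] by auto
  qed (use assms in \<open>auto simp: adele_carrier\<close>)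
  then have "finite {v \<in> places. nonarchimedean (place_abs v) \<and>
      (\<lambda>v\<in>places. a_inv (completion_at v) (x v)) v \<notin> valuation_ring (place_abs v)}"
    by (rule rev_finite_subset) auto
  moreover have "(\<lambda>v\<in>places. a_inv (completion_at v) (x v)) \<in> (\<Pi>\<^sub>E v\<in>places. carrier (completion_at v))"
    by (auto simp: place_simps adele_component[OF assms])
  ultimately show ?thesis unfolding adele_carrier by blast
qed

text \<open>The inclusion of the completion at \<open>v\<close> as a factor of the adele ring.\<close>

definition delta :: "('k::field \<Rightarrow> real) set \<Rightarrow> (nat \<Rightarrow> 'k) set \<Rightarrow> 'k adele" where
  "delta v U = (\<lambda>u\<in>places. if u = v then U else \<zero>\<^bsub>completion_at u\<^esub>)"

lemma delta_carrier:
  assumes "v \<in> places" "U \<in> carrier (completion_at v)"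
  shows "delta v U \<in> carrier adeles"
proof -
  have "finite {u \<in> places. nonarchimedean (place_abs u) \<and> delta v U u \<notin> valuation_ring (place_abs u)}"
  proof (rule finite_subset[of _ "{v}"])
    show "{u \<in> places. nonarchimedean (place_abs u) \<and> delta v U u \<notin> valuation_ring (place_abs u)} \<subseteq> {v}"
      using valuation_ring_closed(1)[OF place_abs_av] by (auto simp: delta_def)
  qed simp
  moreover have "delta v U \<in> (\<Pi>\<^sub>E u\<in>places. carrier (completion_at u))"
    using assms by (auto simp: delta_def place_simps)
  ultimately show ?thesis unfolding adele_carrier by blast
qed

lemma delta_same [simp]: "v \<in> places \<Longrightarrow> delta v U v = U"
  by (simp add: delta_def)

lemma delta_inj: "v \<in> places \<Longrightarrow> delta v U = delta v W \<longleftrightarrow> U = W"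
  by (metis delta_same)

lemma adele_zero_in: "\<zero>\<^bsub>adeles\<^esub> \<in> carrier adeles"
proof -
  have "finite {v \<in> places. nonarchimedean (place_abs v) \<and> \<zero>\<^bsub>adeles\<^esub> v \<notin> valuation_ring (place_abs v)}"
    using valuation_ring_closed(1)[OF place_abs_av] by (auto intro!: finite_subset[of _ "{}"])
  moreover have "\<zero>\<^bsub>adeles\<^esub> \<in> (\<Pi>\<^sub>E v\<in>places. carrier (completion_at v))"
    by (auto simp: place_simps)
  ultimately show ?thesis
    unfolding adele_carrier by blast
qed

lemma adele_abelian_group: "abelian_group (adeles :: 'k::field adele ring)"
proof (rule abelian_groupI)
  fix x y z :: "'k adele"
  assume x: "x \<in> carrier adeles" and y: "y \<in> carrier adeles" and z: "z \<in> carrier adeles"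
  show "x \<oplus>\<^bsub>adeles\<^esub> y \<oplus>\<^bsub>adeles\<^esub> z = x \<oplus>\<^bsub>adeles\<^esub> (y \<oplus>\<^bsub>adeles\<^esub> z)"
    by (rule ext) (simp add: place_simps adele_component[OF x] adele_component[OF y] adele_component[OF z])
  show "x \<oplus>\<^bsub>adeles\<^esub> y = y \<oplus>\<^bsub>adeles\<^esub> x"
    by (rule ext) (simp add: place_simps adele_component[OF x] adele_component[OF y])
next
  fix x y :: "'k adele" assume x: "x \<in> carrier adeles"
  show "\<zero>\<^bsub>adeles\<^esub> \<oplus>\<^bsub>adeles\<^esub> x = x"
    using x by (intro adele_eqI adele_add_closed adele_zero_in)
      (simp_all add: place_simps adele_component[OF x])
  show "\<exists>y\<in>carrier adeles. y \<oplus>\<^bsub>adeles\<^esub> x = \<zero>\<^bsub>adeles\<^esub>"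
    by (rule bexI[OF _ adele_minus_in[OF x]], rule ext) (simp add: place_simps adele_component[OF x])
qed (auto intro!: adele_add_closed adele_zero_in simp del: adele_simps)

lemma adele_diff:
  fixes x y :: "'k::field adele"
  assumes "x \<in> carrier adeles" "y \<in> carrier adeles"
  shows "x \<ominus>\<^bsub>adeles\<^esub> y = (\<lambda>v\<in>places. x v \<ominus>\<^bsub>completion_at v\<^esub> y v)"
proof -
  interpret abelian_group "adeles :: 'k adele ring" by (rule adele_abelian_group)
  have "\<ominus>\<^bsub>adeles\<^esub> y = (\<lambda>v\<in>places. a_inv (completion_at v) (y v))"
    by (rule minus_equality[OF _ assms(2) adele_minus_in[OF assms(2)]], rule ext)
      (simp add: place_simps adele_component[OF assms(2)])
  then show ?thesis by (simp add: a_minus_def restrict_def fun_eq_iff)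
qed

text \<open>Multiplication by this idempotent is the projection to the factor at \<open>v\<close>;
  so being fixed by it characterises the factor inside the adele ring, which is how relativised
  quantifiers recognise it.\<close>

lemma delta_mult_one:
  assumes x: "x \<in> carrier adeles" and v: "v \<in> places"
  shows "x \<otimes>\<^bsub>adeles\<^esub> delta v \<one>\<^bsub>completion_at v\<^esub> = delta v (x v)"
proof -
  show ?thesis
    using v by (intro ext) (simp add: delta_def place_simps adele_component[OF x])
qed

lemma delta_arith:
  assumes v: "v \<in> places" and U: "U \<in> carrier (completion_at v)" "W \<in> carrier (completion_at v)"
  shows "delta v U \<oplus>\<^bsub>adeles\<^esub> delta v W = delta v (U \<oplus>\<^bsub>completion_at v\<^esub> W)"
    "delta v U \<ominus>\<^bsub>adeles\<^esub> delta v W = delta v (U \<ominus>\<^bsub>completion_at v\<^esub> W)"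
    "delta v U \<otimes>\<^bsub>adeles\<^esub> delta v W = delta v (U \<otimes>\<^bsub>completion_at v\<^esub> W)"
proof -
  show "delta v U \<oplus>\<^bsub>adeles\<^esub> delta v W = delta v (U \<oplus>\<^bsub>completion_at v\<^esub> W)"
    "delta v U \<otimes>\<^bsub>adeles\<^esub> delta v W = delta v (U \<otimes>\<^bsub>completion_at v\<^esub> W)"
    by (rule ext, simp add: delta_def place_simps)+
  show "delta v U \<ominus>\<^bsub>adeles\<^esub> delta v W = delta v (U \<ominus>\<^bsub>completion_at v\<^esub> W)"
    unfolding adele_diff[OF delta_carrier[OF v U(1)] delta_carrier[OF v U(2)]]
    by (rule ext) (simp add: delta_def a_minus_def place_simps)
qed

section \<open>Minimal idempotents are places\<close>

definition minimal_idempotent :: "'k::field adele \<Rightarrow> bool" where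
  "minimal_idempotent e \<longleftrightarrow> e \<in> carrier adeles \<and> e \<otimes>\<^bsub>adeles\<^esub> e = e \<and> e \<noteq> \<zero>\<^bsub>adeles\<^esub> \<and>
     (\<forall>x\<in>carrier adeles. x \<otimes>\<^bsub>adeles\<^esub> x = x \<and> x \<otimes>\<^bsub>adeles\<^esub> e = x \<longrightarrow> x = \<zero>\<^bsub>adeles\<^esub> \<or> x = e)"

lemma place_idempotent:
  assumes v: "v \<in> places" and "U \<in> carrier (completion_at v)" "U \<otimes>\<^bsub>completion_at v\<^esub> U = U"
  shows "U = \<zero>\<^bsub>completion_at v\<^esub> \<or> U = \<one>\<^bsub>completion_at v\<^esub>"
proof -
  interpret field "completion_at v" by (rule place_field[OF v])
  have "U \<otimes>\<^bsub>completion_at v\<^esub> (U \<ominus>\<^bsub>completion_at v\<^esub> \<one>\<^bsub>completion_at v\<^esub>) = \<zero>\<^bsub>completion_at v\<^esub>"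
    using assms(2,3) by (simp add: a_minus_def r_distr r_minus r_neg)
  then have "U = \<zero>\<^bsub>completion_at v\<^esub> \<or> U \<ominus>\<^bsub>completion_at v\<^esub> \<one>\<^bsub>completion_at v\<^esub> = \<zero>\<^bsub>completion_at v\<^esub>"
    using integral[OF _ assms(2) minus_closed[OF assms(2) one_closed]] by simp
  then show ?thesis using assms(2) by (auto simp: r_right_minus_eq)
qed

text \<open>Components of an idempotent are \<open>0\<close> or \<open>1\<close>, because
  completions are fields. An idempotent that is nonzero at \<open>v\<close> is therefore
  \<open>1\<close> there and lies above the idempotent of \<open>v\<close>, to which minimality
  makes it equal.\<close>

lemma minimal_idempotent_iff:
  "minimal_idempotent e \<longleftrightarrow> (\<exists>v\<in>places. e = delta v \<one>\<^bsub>completion_at v\<^esub>)"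
proof
  assume e: "minimal_idempotent e"
  then have ec: "e \<in> carrier adeles" and ee: "e \<otimes>\<^bsub>adeles\<^esub> e = e" and "e \<noteq> \<zero>\<^bsub>adeles\<^esub>"
    by (auto simp: minimal_idempotent_def simp del: adele_simps)
  then obtain v where v: "v \<in> places" "e v \<noteq> \<zero>\<^bsub>completion_at v\<^esub>"
    using adele_eqI[OF ec adele_zero_in] by auto
  have idem: "e v \<otimes>\<^bsub>completion_at v\<^esub> e v = e v" if "v \<in> places" for v
    using fun_cong[OF ee, of v] that by simp
  have one: "\<one>\<^bsub>completion_at v\<^esub> \<in> carrier (completion_at v)"
    using place_cring[OF v(1)] by (simp add: cring_def ring_def monoid.one_closed)
  have ev: "e v = \<one>\<^bsub>completion_at v\<^esub>"
    using place_idempotent[OF v(1) adele_component[OF ec v(1)] idem[OF v(1)]] v(2) by simp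
  let ?d = "delta v \<one>\<^bsub>completion_at v\<^esub>"
  have d: "?d \<in> carrier adeles" using delta_carrier[OF v(1) one] .
  have "?d \<otimes>\<^bsub>adeles\<^esub> ?d = ?d" using delta_mult_one[OF d v(1)] v(1) by simp
  moreover have "?d \<otimes>\<^bsub>adeles\<^esub> e = ?d"
  proof -
    have "?d \<otimes>\<^bsub>adeles\<^esub> e = e \<otimes>\<^bsub>adeles\<^esub> ?d"
      by (rule ext) (simp add: place_simps adele_component[OF d] adele_component[OF ec])
    also have "\<dots> = ?d" using delta_mult_one[OF ec v(1)] ev by simp
    finally show ?thesis .
  qed
  moreover have "?d \<noteq> \<zero>\<^bsub>adeles\<^esub>"
  proof
    assume "?d = \<zero>\<^bsub>adeles\<^esub>"
    then have "?d v = \<zero>\<^bsub>adeles\<^esub> v" by simp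
    then show False using v ev by simp
  qed
  ultimately have "?d = e" using e d unfolding minimal_idempotent_def by blast
  then show "\<exists>v\<in>places. e = delta v \<one>\<^bsub>completion_at v\<^esub>" using v(1) by blast
next
  assume "\<exists>v\<in>places. e = delta v \<one>\<^bsub>completion_at v\<^esub>"
  then obtain v where v: "v \<in> places" "e = delta v \<one>\<^bsub>completion_at v\<^esub>" by blast
  have one: "\<one>\<^bsub>completion_at v\<^esub> \<in> carrier (completion_at v)"
    using place_cring[OF v(1)] by (simp add: cring_def ring_def monoid.one_closed)
  have ec: "e \<in> carrier adeles" using delta_carrier[OF v(1) one] v(2) by simp
  have "e \<noteq> \<zero>\<^bsub>adeles\<^esub>"
  proof
    assume "e = \<zero>\<^bsub>adeles\<^esub>"
    then have "e v = \<zero>\<^bsub>adeles\<^esub> v" by simp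
    then show False using v completion_one_neq_zero[OF place_abs_av[OF v(1)]] by simp
  qed
  moreover have "x = \<zero>\<^bsub>adeles\<^esub> \<or> x = e"
    if x: "x \<in> carrier adeles" "x \<otimes>\<^bsub>adeles\<^esub> x = x" "x \<otimes>\<^bsub>adeles\<^esub> e = x" for x
  proof -
    have xd: "x = delta v (x v)" using x(3) delta_mult_one[OF x(1) v(1)] v(2) by simp
    have "x v \<otimes>\<^bsub>completion_at v\<^esub> x v = x v" using fun_cong[OF x(2), of v] v(1) by simp
    then have "x v = \<zero>\<^bsub>completion_at v\<^esub> \<or> x v = \<one>\<^bsub>completion_at v\<^esub>"
      using place_idempotent[OF v(1) adele_component[OF x(1) v(1)]] by simp
    moreover have "delta v \<zero>\<^bsub>completion_at v\<^esub> = \<zero>\<^bsub>adeles\<^esub>" by (rule ext) (simp add: delta_def)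
    ultimately show ?thesis using xd v(2) by metis
  qed
  ultimately show "minimal_idempotent e"
    unfolding minimal_idempotent_def using ec delta_mult_one[OF ec v(1)] v by auto
qed

text \<open>Relativisation of a formula to the factor cut out by the idempotent in variable \<open>k\<close>.\<close>

primrec rel_term :: "nat \<Rightarrow> ring_term \<Rightarrow> ring_term" where
  "rel_term k (Var i) = Var i"
| "rel_term k Zero = Zero"
| "rel_term k One = Var k"
| "rel_term k (Plus s t) = Plus (rel_term k s) (rel_term k t)"
| "rel_term k (Minus s t) = Minus (rel_term k s) (rel_term k t)"
| "rel_term k (Times s t) = Times (rel_term k s) (rel_term k t)"

primrec rel_formula :: "nat \<Rightarrow> ring_formula \<Rightarrow> ring_formula" where
  "rel_formula k (Equal s t) = Equal (rel_term k s) (rel_term k t)"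
| "rel_formula k (Negation p) = Negation (rel_formula k p)"
| "rel_formula k (Conj p q) = Conj (rel_formula k p) (rel_formula k q)"
| "rel_formula k (Forall i p) =
     Forall i (Impl (Equal (Times (Var i) (Var k)) (Var i)) (rel_formula k p))"

text \<open>Bound variables are included, so that a variable outside this set can hold the
  idempotent without being captured by a quantifier.\<close>

primrec all_vars :: "ring_formula \<Rightarrow> nat set" where
  "all_vars (Equal s t) = term_vars s \<union> term_vars t"
| "all_vars (Negation p) = all_vars p"
| "all_vars (Conj p q) = all_vars p \<union> all_vars q"
| "all_vars (Forall i p) = insert i (all_vars p)"

lemma finite_all_vars [simp]: "finite (all_vars p)"
  by (induction p) auto

lemma rel_term_vars: "term_vars (rel_term k t) \<subseteq> insert k (term_vars t)"
  by (induction t) auto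

lemma rel_formula_vars: "free_vars (rel_formula k p) \<subseteq> insert k (all_vars p)"
  by (induction p) (use rel_term_vars in fastforce)+

lemma rel_term_value:
  assumes v: "v \<in> places" and k: "e k = delta v \<one>\<^bsub>completion_at v\<^esub>"
  shows "(\<And>i. i \<in> term_vars t \<Longrightarrow> e i \<in> carrier adeles \<and> delta v (e i v) = e i) \<Longrightarrow>
    term_value (completion_at v) (\<lambda>i. e i v) t \<in> carrier (completion_at v) \<and>
    term_value adeles e (rel_term k t) = delta v (term_value (completion_at v) (\<lambda>i. e i v) t)"
proof (induction t)
  case (Var i)
  then show ?case using adele_component[OF _ v] by simp
next
  case Zero
  interpret cring "completion_at v" by (rule place_cring[OF v])
  show ?case by (simp add: delta_def fun_eq_iff)
next
  case One
  interpret cring "completion_at v" by (rule place_cring[OF v])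
  show ?case using k by simp
next
  case (Plus s t)
  interpret cring "completion_at v" by (rule place_cring[OF v])
  show ?case using Plus by (simp add: delta_arith[OF v] del: adele_simps)
next
  case (Minus s t)
  interpret cring "completion_at v" by (rule place_cring[OF v])
  show ?case using Minus by (simp add: delta_arith[OF v] del: adele_simps)
next
  case (Times s t)
  interpret cring "completion_at v" by (rule place_cring[OF v])
  show ?case using Times by (simp add: delta_arith[OF v] del: adele_simps)
qed

text \<open>The idempotent stays in variable \<open>k\<close> because no quantifier of
  \<open>p\<close> binds it. Free variables have to hold elements supported at \<open>v\<close>,
  since relativised terms are computed in that factor.\<close>

lemma rel_formula_satisfies:
  assumes v: "v \<in> places" and k: "e k = delta v \<one>\<^bsub>completion_at v\<^esub>" "k \<notin> all_vars p"
    and e: "\<And>i. i \<in> free_vars p \<Longrightarrow> e i \<in> carrier adeles \<and> delta v (e i v) = e i"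
  shows "satisfies adeles e (rel_formula k p) \<longleftrightarrow> satisfies (completion_at v) (\<lambda>i. e i v) p"
  using k e
proof (induction p arbitrary: e)
  case (Equal s t)
  have "term_value adeles e (rel_term k s) = delta v (term_value (completion_at v) (\<lambda>i. e i v) s)"
    "term_value adeles e (rel_term k t) = delta v (term_value (completion_at v) (\<lambda>i. e i v) t)"
    using Equal.prems rel_term_value[where e = e and k = k, OF v Equal.prems(1)] by (simp_all del: adele_simps)
  then show ?case by (simp add: delta_inj[OF v])
next
  case (Negation p)
  have "satisfies adeles e (rel_formula k p) \<longleftrightarrow> satisfies (completion_at v) (\<lambda>i. e i v) p"
    by (rule Negation.IH) (use Negation.prems in auto)
  then show ?case by simp
next
  case (Conj p q)
  have "satisfies adeles e (rel_formula k p) \<longleftrightarrow> satisfies (completion_at v) (\<lambda>i. e i v) p"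
    by (rule Conj.IH(1)) (use Conj.prems in auto)
  moreover have "satisfies adeles e (rel_formula k q) \<longleftrightarrow> satisfies (completion_at v) (\<lambda>i. e i v) q"
    by (rule Conj.IH(2)) (use Conj.prems in auto)
  ultimately show ?case by simp
next
  case (Forall i p)
  have ik: "i \<noteq> k" using Forall.prems(2) by auto
  have IH: "satisfies adeles (e(i := delta v U)) (rel_formula k p) \<longleftrightarrow>
    satisfies (completion_at v) ((\<lambda>j. e j v)(i := U)) p" if U: "U \<in> carrier (completion_at v)" for U
  proof -
    have "satisfies adeles (e(i := delta v U)) (rel_formula k p) \<longleftrightarrow>
      satisfies (completion_at v) (\<lambda>j. (e(i := delta v U)) j v) p"
    proof (rule Forall.IH)
      show "(e(i := delta v U)) k = delta v \<one>\<^bsub>completion_at v\<^esub>" using ik Forall.prems(1) by simp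
      show "k \<notin> all_vars p" using Forall.prems(2) by simp
      show "(e(i := delta v U)) j \<in> carrier adeles \<and> delta v ((e(i := delta v U)) j v) = (e(i := delta v U)) j"
        if "j \<in> free_vars p" for j
        using Forall.prems(3)[of j] that delta_carrier[OF v U] v by (cases "j = i") auto
    qed
    also have "(\<lambda>j. (e(i := delta v U)) j v) = (\<lambda>j. e j v)(i := U)" using v by (intro ext) simp
    finally show ?thesis .
  qed
  \<comment> \<open>By \<open>delta_mult_one\<close> the guard of the quantifier says that
    \<open>x\<close> is supported at \<open>v\<close>.\<close>
  have "satisfies adeles e (rel_formula k (Forall i p)) \<longleftrightarrow>
    (\<forall>x\<in>carrier adeles. delta v (x v) = x \<longrightarrow> satisfies adeles (e(i := x)) (rel_formula k p))"
    using ik Forall.prems(1) delta_mult_one[OF _ v] by (auto simp del: adele_simps)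
  also have "\<dots> \<longleftrightarrow> (\<forall>U\<in>carrier (completion_at v). satisfies adeles (e(i := delta v U)) (rel_formula k p))"
    using delta_carrier[OF v] adele_component[OF _ v] v by (metis delta_same)
  also have "\<dots> \<longleftrightarrow> satisfies (completion_at v) (\<lambda>i. e i v) (Forall i p)"
    using IH by simp
  finally show ?case .
qed

text \<open>The inner quantifier binds variable \<open>0\<close>, so the idempotent is kept in a
  variable of positive index.\<close>

definition minid_formula :: "nat \<Rightarrow> ring_formula" where
  "minid_formula k = Conj (Equal (Times (Var k) (Var k)) (Var k)) (Conj (Negation (Equal (Var k) Zero))
     (Forall 0 (Impl (Conj (Equal (Times (Var 0) (Var 0)) (Var 0)) (Equal (Times (Var 0) (Var k)) (Var 0)))
       (Disj (Equal (Var 0) Zero) (Equal (Var 0) (Var k))))))"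

lemma minid_formula_satisfies:
  assumes "k > 0" "e k \<in> carrier adeles"
  shows "satisfies adeles e (minid_formula k) \<longleftrightarrow> minimal_idempotent (e k)"
  using assms unfolding minid_formula_def minimal_idempotent_def by (auto simp del: adele_simps)

text \<open>Expresses that at least \<open>m\<close> completions satisfy the sentence \<open>p\<close>, whose variables are below \<open>k\<close>.\<close>

definition count_sentence :: "nat \<Rightarrow> ring_formula \<Rightarrow> nat \<Rightarrow> ring_formula" where
  "count_sentence k p m = exs (k + m) (Conjs (
     map (\<lambda>j. Conj (minid_formula (k + j)) (rel_formula (k + j) p)) [0..<m] @
     map (\<lambda>(i, j). if i = j then Equal Zero Zero else Negation (Equal (Var (k + i)) (Var (k + j))))
       (List.product [0..<m] [0..<m])))"

lemma count_sentence:
  assumes "sentence p" "all_vars p \<subseteq> {..<k}"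
  shows "sentence (count_sentence k p m)"
proof -
  have "free_vars (minid_formula (k + j)) \<subseteq> {..<k + m}" "free_vars (rel_formula (k + j) p) \<subseteq> {..<k + m}"
    if "j < m" for j
    using that rel_formula_vars[of "k + j" p] assms(2) by (fastforce simp: minid_formula_def)+
  then show ?thesis
    unfolding count_sentence_def by (intro sentence_exs) (fastforce split: if_splits)
qed

lemma satisfies_Conjs_upt:
  "satisfies R e (Conjs (map g [0..<m] @ map h (List.product [0..<m] [0..<m]))) \<longleftrightarrow>
     (\<forall>j<m. satisfies R e (g j)) \<and> (\<forall>i<m. \<forall>j<m. satisfies R e (h (i, j)))"
  by auto

text \<open>Distinct minimal idempotents belong to distinct places, and a sentence relativised to
  one of them speaks of the completion there.\<close>

lemma count_sentence_holds:
  assumes p: "sentence p" "all_vars p \<subseteq> {..<k}" "k > 0"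
  shows "holds_in (adeles :: 'k::field adele ring) (count_sentence k p m) \<longleftrightarrow>
    (\<exists>V \<subseteq> {v :: ('k \<Rightarrow> real) set. v \<in> places \<and> holds_in (completion_at v) p}. finite V \<and> card V = m)"
proof -
  let ?A = "adeles :: 'k adele ring"
  have rel: "satisfies ?A e (rel_formula (k + j) p) \<longleftrightarrow> holds_in (completion_at v) p"
    if v: "v \<in> places" and e: "e (k + j) = delta v \<one>\<^bsub>completion_at v\<^esub>" for e j v
  proof -
    have "satisfies ?A e (rel_formula (k + j) p) \<longleftrightarrow> satisfies (completion_at v) (\<lambda>i. e i v) p"
      using p(1,2) by (intro rel_formula_satisfies[where e = e, OF v e]) (auto simp: sentence_def)
    also have "\<dots> \<longleftrightarrow> holds_in (completion_at v) p"
    proof (rule holds_in_iff[symmetric, OF p(1), where i = "k + j"])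
      show "e (k + j) v \<in> carrier (completion_at v)"
        using e v place_cring[OF v] by (simp add: cring_def ring_def monoid.one_closed)
    qed
    finally show ?thesis .
  qed
  let ?body = "\<lambda>e. (\<forall>j<m. minimal_idempotent (e (k + j)) \<and> satisfies ?A e (rel_formula (k + j) p)) \<and>
      (\<forall>i<m. \<forall>j<m. i \<noteq> j \<longrightarrow> e (k + i) \<noteq> e (k + j))"
  have "holds_in ?A (count_sentence k p m) \<longleftrightarrow> satisfies ?A (\<lambda>_. \<zero>\<^bsub>?A\<^esub>) (count_sentence k p m)"
    by (rule holds_in_iff[OF count_sentence[OF p(1,2)] adele_zero_in])
  also have "\<dots> \<longleftrightarrow> (\<exists>e. (\<forall>i<k + m. e i \<in> carrier ?A) \<and> (\<forall>i\<ge>k + m. e i = \<zero>\<^bsub>?A\<^esub>) \<and> ?body e)"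
    unfolding count_sentence_def satisfies_exs satisfies_Conjs_upt
    using p(3) by (intro arg_cong[where f = Ex] ext conj_cong refl) (auto simp add: minid_formula_satisfies simp del: adele_simps)
  also have "\<dots> \<longleftrightarrow> (\<exists>V \<subseteq> {v :: ('k \<Rightarrow> real) set. v \<in> places \<and> holds_in (completion_at v) p}. finite V \<and> card V = m)"
  proof
    assume "\<exists>e. (\<forall>i<k + m. e i \<in> carrier ?A) \<and> (\<forall>i\<ge>k + m. e i = \<zero>\<^bsub>?A\<^esub>) \<and> ?body e"
    then obtain e where e: "?body e" by blast
    then have "\<forall>j<m. \<exists>v. v \<in> places \<and> e (k + j) = delta v \<one>\<^bsub>completion_at v\<^esub>"
      by (meson minimal_idempotent_iff)
    then obtain w where w: "\<And>j. j < m \<Longrightarrow> w j \<in> places"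
      "\<And>j. j < m \<Longrightarrow> e (k + j) = delta (w j) \<one>\<^bsub>completion_at (w j)\<^esub>" by metis
    have "inj_on w {..<m}"
      using e w(2) by (intro inj_onI) (metis lessThan_iff)
    then have "card (w ` {..<m}) = m" by (simp add: card_image)
    moreover have "w ` {..<m} \<subseteq> {v \<in> places. holds_in (completion_at v) p}"
    proof
      fix v assume "v \<in> w ` {..<m}"
      then obtain j where j: "j < m" "v = w j" by auto
      then show "v \<in> {v \<in> places. holds_in (completion_at v) p}"
        using e w(1)[OF j(1)] rel[where e = e and j = j, OF w[OF j(1)]] by simp
    qed
    ultimately show "\<exists>V \<subseteq> {v :: ('k \<Rightarrow> real) set. v \<in> places \<and> holds_in (completion_at v) p}. finite V \<and> card V = m"
      by blast
  next
    assume "\<exists>V \<subseteq> {v :: ('k \<Rightarrow> real) set. v \<in> places \<and> holds_in (completion_at v) p}. finite V \<and> card V = m"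
    then obtain V :: "('k \<Rightarrow> real) set set" where V: "V \<subseteq> {v \<in> places. holds_in (completion_at v) p}" "finite V" "card V = m"
      by blast
    obtain w where w: "bij_betw w {..<m} V"
      using ex_bij_betw_nat_finite[OF V(2)] V(3) by (auto simp: atLeast0LessThan)
    \<comment> \<open>Variables from \<open>k\<close> to \<open>k + m - 1\<close> carry the
      idempotents; those below \<open>k\<close>, reserved for \<open>p\<close>, are set to
      zero.\<close>
    define e where "e i = (if k \<le> i \<and> i < k + m then delta (w (i - k)) \<one>\<^bsub>completion_at (w (i - k))\<^esub> else \<zero>\<^bsub>?A\<^esub>)" for i
    have wp: "w j \<in> places" "holds_in (completion_at (w j)) p" if "j < m" for j
      using bij_betwE[OF w] V(1) that by auto
    have ek: "e (k + j) = delta (w j) \<one>\<^bsub>completion_at (w j)\<^esub>" if "j < m" for j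
      using that by (simp add: e_def)
    have one: "\<one>\<^bsub>completion_at v\<^esub> \<in> carrier (completion_at v)" if "v \<in> places" for v :: "('k \<Rightarrow> real) set"
      using place_cring[OF that] by (simp add: cring_def ring_def monoid.one_closed)
    have ec: "e i \<in> carrier ?A" for i
      using delta_carrier[OF wp(1) one[OF wp(1)]] adele_zero_in by (auto simp: e_def simp del: adele_simps)
    have neq: "e (k + i) \<noteq> e (k + j)" if ij: "i < m" "j < m" "i \<noteq> j" for i j
    proof
      assume eq: "e (k + i) = e (k + j)"
      have "w i \<noteq> w j" using w ij by (auto simp: bij_betw_def inj_on_def)
      then have "e (k + j) (w i) = \<zero>\<^bsub>completion_at (w i)\<^esub>" "e (k + i) (w i) = \<one>\<^bsub>completion_at (w i)\<^esub>"
        using wp(1) ij by (auto simp: ek delta_def)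
      then show False using eq completion_one_neq_zero[OF place_abs_av[OF wp(1)[OF ij(1)]]] by simp
    qed
    have "satisfies ?A e (rel_formula (k + j) p)" if "j < m" for j
      using rel[where e = e and j = j, OF wp(1)[OF that] ek[OF that]] wp(2)[OF that] by simp
    moreover have "minimal_idempotent (e (k + j))" if "j < m" for j
      unfolding minimal_idempotent_iff ek[OF that] using wp(1)[OF that] by blast
    moreover have "e i = \<zero>\<^bsub>?A\<^esub>" if "i \<ge> k + m" for i
      using that by (simp add: e_def del: adele_simps)
    ultimately show "\<exists>e. (\<forall>i<k + m. e i \<in> carrier ?A) \<and> (\<forall>i\<ge>k + m. e i = \<zero>\<^bsub>?A\<^esub>) \<and> ?body e"
      using ec neq by (intro exI[of _ e]) blast
  qed
  finally show ?thesis .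
qed

section \<open>Passing between two adele rings\<close>

lemma models_card:
  fixes p :: ring_formula
  defines "S \<equiv> {v :: ('k::field \<Rightarrow> real) set. v \<in> places \<and> holds_in (completion_at v) p}"
    and "T \<equiv> {w :: ('l::field \<Rightarrow> real) set. w \<in> places \<and> holds_in (completion_at w) p}"
  assumes "elementarily_equivalent (adeles :: 'k adele ring) (adeles :: 'l adele ring)" "sentence p"
    and fin: "finite S" "finite T"
  shows "card S = card T"
proof -
  obtain n where "all_vars p \<subseteq> {..<n}" using finite_nat_bounded[of "all_vars p"] by auto
  then have k: "all_vars p \<subseteq> {..<Suc n}" "Suc n > 0" by auto
  have eq: "(\<exists>V\<subseteq>S. finite V \<and> card V = m) \<longleftrightarrow> (\<exists>V\<subseteq>T. finite V \<and> card V = m)" for m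
  proof -
    have "holds_in (adeles :: 'k adele ring) (count_sentence (Suc n) p m) \<longleftrightarrow>
        holds_in (adeles :: 'l adele ring) (count_sentence (Suc n) p m)"
      using assms(3) count_sentence[OF assms(4) k(1)] by (simp add: elementarily_equivalent_def)
    then show ?thesis
      using count_sentence_holds[OF assms(4) k, of m, where 'k = 'k]
        count_sentence_holds[OF assms(4) k, of m, where 'k = 'l] unfolding S_def T_def by simp
  qed
  \<comment> \<open>The count sentence says at least \<open>m\<close>, so it is used with the size
    of either set to get both inequalities.\<close>
  have "card S \<le> card T" using eq[of "card S"] fin by (metis card_mono order_refl)
  moreover have "card T \<le> card S" using eq[of "card T"] fin by (metis card_mono order_refl)
  ultimately show ?thesis by simp
qed

text \<open>Compatibility with valuation rings makes \<open>s\<close> carry the places where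
  \<open>x\<close> is not integral onto those where its image is not integral, so the finiteness
  condition is preserved in both directions.\<close>

lemma adeles_isomorphic:
  fixes s :: "('k::field \<Rightarrow> real) set \<Rightarrow> ('l::field \<Rightarrow> real) set"
  assumes s: "bij_betw s places places"
    and h: "\<And>v. v \<in> places \<Longrightarrow> h v \<in> ring_iso (completion_at v) (completion_at (s v))"
    and nonarch: "\<And>v. v \<in> places \<Longrightarrow> nonarchimedean (place_abs v) \<longleftrightarrow> nonarchimedean (place_abs (s v))"
    and val: "\<And>v U. v \<in> places \<Longrightarrow> nonarchimedean (place_abs v) \<Longrightarrow> U \<in> carrier (completion_at v) \<Longrightarrow>
      h v U \<in> valuation_ring (place_abs (s v)) \<longleftrightarrow> U \<in> valuation_ring (place_abs v)"
  shows "(adeles :: 'k adele ring) \<simeq> (adeles :: 'l adele ring)"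
proof -
  let ?A = "adeles :: 'k adele ring" and ?B = "adeles :: 'l adele ring"
  define t where "t = inv_into places s"
  have t: "t w \<in> places" "s (t w) = w" if "w \<in> places" for w
    using that s by (auto simp: t_def bij_betw_def f_inv_into_f inv_into_into)
  have ts: "s v \<in> places" "t (s v) = v" if "v \<in> places" for v
    using that s by (auto simp: t_def bij_betw_def)
  have hb: "bij_betw (h v) (carrier (completion_at v)) (carrier (completion_at (s v)))"
    and hh: "h v \<in> ring_hom (completion_at v) (completion_at (s v))" if "v \<in> places" for v
    using h[OF that] by (auto simp: ring_iso_def)
  define \<Phi> where "\<Phi> x = (\<lambda>w\<in>places. h (t w) (x (t w)))" for x :: "'k adele"
  have bad: "{w \<in> places. nonarchimedean (place_abs w) \<and> \<Phi> x w \<notin> valuation_ring (place_abs w)} =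
      s ` {v \<in> places. nonarchimedean (place_abs v) \<and> x v \<notin> valuation_ring (place_abs v)}"
    if x: "\<And>v. v \<in> places \<Longrightarrow> x v \<in> carrier (completion_at v)" for x
  proof (intro equalityI subsetI)
    fix w assume "w \<in> {w \<in> places. nonarchimedean (place_abs w) \<and> \<Phi> x w \<notin> valuation_ring (place_abs w)}"
    then show "w \<in> s ` {v \<in> places. nonarchimedean (place_abs v) \<and> x v \<notin> valuation_ring (place_abs v)}"
      using t[of w] nonarch[of "t w"] val[of "t w" "x (t w)"] x[of "t w"]
      by (intro image_eqI[of _ _ "t w"]) (auto simp: \<Phi>_def)
  next
    fix w assume "w \<in> s ` {v \<in> places. nonarchimedean (place_abs v) \<and> x v \<notin> valuation_ring (place_abs v)}"
    then show "w \<in> {w \<in> places. nonarchimedean (place_abs w) \<and> \<Phi> x w \<notin> valuation_ring (place_abs w)}"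
      using ts nonarch val x by (auto simp: \<Phi>_def)
  qed
  have bad_finite: "finite {w \<in> places. nonarchimedean (place_abs w) \<and> \<Phi> x w \<notin> valuation_ring (place_abs w)} \<longleftrightarrow>
      finite {v \<in> places. nonarchimedean (place_abs v) \<and> x v \<notin> valuation_ring (place_abs v)}"
    if x: "\<And>v. v \<in> places \<Longrightarrow> x v \<in> carrier (completion_at v)" for x
  proof -
    have "inj_on s {v \<in> places. nonarchimedean (place_abs v) \<and> x v \<notin> valuation_ring (place_abs v)}"
      using s by (auto simp: bij_betw_def inj_on_def)
    then show ?thesis using bad[of x] x by (simp add: finite_image_iff)
  qed
  have \<Phi>_carrier: "\<Phi> x \<in> carrier ?B" if x: "x \<in> carrier ?A" for x
  proof -
    have "\<Phi> x \<in> (\<Pi>\<^sub>E w\<in>places. carrier (completion_at w))"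
      using t hb adele_component[OF x] by (fastforce simp: \<Phi>_def dest: bij_betwE)
    then show ?thesis
      unfolding adele_carrier using bad_finite[of x] adele_component[OF x] x by (simp add: adele_carrier)
  qed
  have hom: "\<Phi> \<in> ring_hom ?A ?B"
  proof (rule ring_hom_memI)
    fix x y assume x: "x \<in> carrier ?A" and y: "y \<in> carrier ?A"
    show "\<Phi> x \<in> carrier ?B" using \<Phi>_carrier[OF x] .
    show "\<Phi> (x \<otimes>\<^bsub>?A\<^esub> y) = \<Phi> x \<otimes>\<^bsub>?B\<^esub> \<Phi> y"
      by (rule ext) (simp add: \<Phi>_def t ring_hom_mult[OF hh] adele_component[OF x] adele_component[OF y])
    show "\<Phi> (x \<oplus>\<^bsub>?A\<^esub> y) = \<Phi> x \<oplus>\<^bsub>?B\<^esub> \<Phi> y"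
      by (rule ext) (simp add: \<Phi>_def t ring_hom_add[OF hh] adele_component[OF x] adele_component[OF y])
  next
    show "\<Phi> \<one>\<^bsub>?A\<^esub> = \<one>\<^bsub>?B\<^esub>"
      by (rule ext) (simp add: \<Phi>_def t ring_hom_one[OF hh])
  qed
  have "bij_betw \<Phi> (carrier ?A) (carrier ?B)"
  proof (rule bij_betw_imageI)
    show "inj_on \<Phi> (carrier ?A)"
    proof (rule inj_onI)
      fix x y assume x: "x \<in> carrier ?A" and y: "y \<in> carrier ?A" and eq: "\<Phi> x = \<Phi> y"
      show "x = y"
      proof (rule adele_eqI[OF x y])
        fix v :: "('k \<Rightarrow> real) set" assume v: "v \<in> places"
        have "h v (x v) = h v (y v)" using fun_cong[OF eq, of "s v"] ts[OF v] by (simp add: \<Phi>_def)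
        then show "x v = y v"
          using hb[OF v] adele_component[OF x v] adele_component[OF y v] by (auto simp: bij_betw_def inj_on_def)
      qed
    qed
    show "\<Phi> ` carrier ?A = carrier ?B"
    proof (intro equalityI subsetI)
      fix z assume z: "z \<in> carrier ?B"
      \<comment> \<open>The componentwise preimage; it satisfies the finiteness condition because
        \<open>z\<close> does, through \<open>bad_finite\<close>.\<close>
      define x where "x = (\<lambda>v\<in>places. inv_into (carrier (completion_at v)) (h v) (z (s v)))"
      have im: "z (s v) \<in> h v ` carrier (completion_at v)" if "v \<in> places" for v
        using hb[OF that] adele_component[OF z ts(1)[OF that]] by (simp add: bij_betw_def)
      have xc: "x v \<in> carrier (completion_at v)" "h v (x v) = z (s v)" if "v \<in> places" for v
        using that im[OF that] by (auto simp: x_def inv_into_into f_inv_into_f)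
      have zx: "\<Phi> x = z"
        using z t xc(2)[OF t(1)] by (intro ext) (auto simp: \<Phi>_def adele_carrier PiE_def extensional_def restrict_def)
      have "finite {w \<in> places. nonarchimedean (place_abs w) \<and> \<Phi> x w \<notin> valuation_ring (place_abs w)}"
        using z by (simp only: zx adele_carrier)
      then have "finite {v \<in> places. nonarchimedean (place_abs v) \<and> x v \<notin> valuation_ring (place_abs v)}"
        using bad_finite[of x] xc(1) by blast
      moreover have "x \<in> (\<Pi>\<^sub>E v\<in>places. carrier (completion_at v))"
        using xc(1) by (intro PiE_I) (simp_all add: x_def)
      ultimately have "x \<in> carrier ?A"
        unfolding adele_carrier by blast
      then show "z \<in> \<Phi> ` carrier ?A" using zx by blast
    qed (use \<Phi>_carrier in auto)
  qed
  then show ?thesis using hom by (auto simp: is_ring_iso_def ring_iso_def)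
qed

section \<open>Definability of the valuation ring\<close>

primrec nat_term :: "nat \<Rightarrow> ring_term" where
  "nat_term 0 = Zero"
| "nat_term (Suc n) = Plus (nat_term n) One"

definition int_term :: "int \<Rightarrow> ring_term" where
  "int_term z = (if z \<ge> 0 then nat_term (nat z) else Minus Zero (nat_term (nat (- z))))"

primrec power_term :: "ring_term \<Rightarrow> nat \<Rightarrow> ring_term" where
  "power_term t 0 = One"
| "power_term t (Suc n) = Times t (power_term t n)"

primrec sum_term :: "ring_term list \<Rightarrow> ring_term" where
  "sum_term [] = Zero"
| "sum_term (t # ts) = Plus t (sum_term ts)"

lemma term_at_nat_term [simp]: "term_at e (nat_term n) = of_nat n"
  by (induction n) (auto simp: add.commute)

lemma term_at_int_term [simp]: "term_at e (int_term z) = of_int z"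
  by (auto simp: int_term_def)

lemma term_at_power_term [simp]: "term_at e (power_term t n) = term_at e t ^ n"
  by (induction n) auto

lemma term_at_sum_term [simp]: "term_at e (sum_term ts) = (\<Sum>t\<leftarrow>ts. term_at e t)"
  by (induction ts) auto

lemma term_vars_nat_term [simp]: "term_vars (nat_term n) = {}"
  by (induction n) auto

lemma term_vars_int_term [simp]: "term_vars (int_term z) = {}"
  by (auto simp: int_term_def)

lemma term_vars_power_term: "term_vars (power_term t n) \<subseteq> term_vars t"
  by (induction n) auto

lemma term_vars_sum_term [simp]: "term_vars (sum_term ts) = (\<Union>t\<in>set ts. term_vars t)"
  by (induction ts) auto

section \<open>Roots of elements near 1\<close>

lemma near_one_mult:
  assumes f: "absolute_value f" "nonarchimedean f" and c: "c \<le> 1" and ab: "f (a - 1) \<le> c" "f (b - 1) \<le> c"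
  shows "f (a * b - 1) \<le> c"
proof -
  have "f b \<le> 1" using nonarch_add_le[of f "b - 1" 1 1] f ab c by simp
  then have "f ((a - 1) * b) \<le> c * 1"
    unfolding av_mult[OF f(1)] using ab f(1) by (intro mult_mono) (auto intro: order_trans[OF av_nonneg[OF f(1)]])
  then have "f ((a - 1) * b + (b - 1)) \<le> c" using ab by (intro nonarch_add_le[of f] f) auto
  then show ?thesis by (simp add: algebra_simps)
qed

lemma near_one_power:
  assumes f: "absolute_value f" "nonarchimedean f" and c: "c \<le> 1" and a: "f (a - 1) \<le> c"
  shows "f (a ^ n - 1) \<le> c"
proof (induction n)
  case 0
  show ?case using f a by (simp add: order_trans[OF av_nonneg[OF f(1)] a])
next
  case (Suc n)
  then show ?case using near_one_mult[OF f c a Suc] by simp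
qed

text \<open>Since \<open>l\<close> is a unit, the fixed point iteration \<open>y \<mapsto> y - (y ^ l - u) / l\<close> contracts near \<open>1\<close>;
  running \<open>n\<close> steps of it on \<open>u n\<close> gives an \<open>l\<close>-th root of the Cauchy sequence \<open>u\<close>.\<close>

lemma root_near_one_uniform:
  fixes f :: "'a::field \<Rightarrow> real"
  assumes f: "absolute_value f" "nonarchimedean f" and l: "f (of_nat l) = 1"
    and c: "c < 1" and u: "u \<in> Cau f" "\<And>n. f (u n - 1) \<le> c"
  shows "\<exists>y\<in>Cau f. (\<lambda>n. y n ^ l - u n) \<in> Nul f"
proof -
  have c0: "0 \<le> c" using order_trans[OF av_nonneg[OF f(1)] u(2)] .
  have l0: "(of_nat l :: 'a) \<noteq> 0" using l f by (metis av_zero_iff zero_neq_one)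
  define T where "T u y = y - (y ^ l - u) / of_nat l" for u y :: 'a
  \<comment> \<open>The cofactor \<open>S\<close> in \<open>y ^ l - y' ^ l = (y - y') * S\<close> is
    a sum of \<open>l\<close> elements within \<open>c\<close> of \<open>1\<close>, hence within
    \<open>c\<close> of \<open>l\<close>; the main part cancels against \<open>y - y'\<close> and
    the factor \<open>c\<close> remains.\<close>
  have T_diff: "f (T u y - T u' y') \<le> max (c * f (y - y')) (f (u - u'))"
    if "f (y - 1) \<le> c" "f (y' - 1) \<le> c" for u u' y y'
  proof -
    define S where "S = (\<Sum>i<l. y' ^ (l - Suc i) * y ^ i)"
    have "f (y' ^ (l - Suc i) * y ^ i - 1) \<le> c" for i
      using that c by (intro near_one_mult[OF f] near_one_power[OF f]) auto
    then have "f (\<Sum>i<l. y' ^ (l - Suc i) * y ^ i - 1) \<le> c"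
      by (intro nonarch_sum_le[OF f c0]) auto
    then have S: "f (S - of_nat l) \<le> c" by (simp add: sum_subtractf S_def)
    have "T u y - T u' y' = (y - y') - ((y ^ l - y' ^ l) - (u - u')) / of_nat l"
      by (simp add: T_def diff_divide_distrib)
    also have "y ^ l - y' ^ l = (y - y') * S"
      unfolding S_def by (rule power_diff_sumr2)
    also have "(y - y') - ((y - y') * S - (u - u')) / of_nat l =
        - ((y - y') * (S - of_nat l) / of_nat l) + (u - u') / of_nat l"
      using l0 by (simp add: divide_simps) (simp add: algebra_simps)
    finally have "T u y - T u' y' = - ((y - y') * (S - of_nat l) / of_nat l) + (u - u') / of_nat l" .
    moreover have "f (- ((y - y') * (S - of_nat l) / of_nat l)) \<le> c * f (y - y')"
      using mult_right_mono[OF S av_nonneg[OF f(1), of "y - y'"]] f l by (simp add: av_mult av_divide mult.commute)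
    moreover have "f ((u - u') / of_nat l) = f (u - u')" using f l by (simp add: av_divide)
    ultimately show ?thesis
      using nonarch_add_le[OF f(2), of "- ((y - y') * (S - of_nat l) / of_nat l)"
        "max (c * f (y - y')) (f (u - u'))" "(u - u') / of_nat l"]
      by simp
  qed
  have T_near: "f (T u y - 1) \<le> c" if "f (u - 1) \<le> c" "f (y - 1) \<le> c" for u y
  proof -
    have "f ((y ^ l - 1) - (u - 1)) \<le> c"
      using near_one_power[OF f, of c y l] that c by (intro nonarch_diff_le[OF f, of "_ - 1" _ "_ - 1"]) auto
    then have "f ((y ^ l - u) / of_nat l) \<le> c" using f l by (simp add: av_divide)
    then have "f ((y - 1) - (y ^ l - u) / of_nat l) \<le> c"
      using that by (intro nonarch_diff_le[OF f, of "y - 1"]) auto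
    then show ?thesis by (simp add: T_def algebra_simps)
  qed
  define Y where "Y u k = (T u ^^ k) 1" for u k
  have Y_Suc: "Y u (Suc k) = T u (Y u k)" for u k by (simp add: Y_def)
  have Y_near: "f (Y (u n) k - 1) \<le> c" for n k
    by (induction k) (use c0 f u(2) T_near in \<open>auto simp: Y_Suc, simp add: Y_def\<close>)
  have Y_step: "f (Y (u n) (Suc k) - Y (u n) k) \<le> c ^ Suc k" for n k
  proof (induction k)
    case 0
    then show ?case using f l u(2)[of n] by (simp add: Y_def T_def av_divide av_diff_commute)
  next
    case (Suc k)
    have "f (Y (u n) (Suc (Suc k)) - Y (u n) (Suc k)) \<le> max (c * f (Y (u n) (Suc k) - Y (u n) k)) 0"
      using T_diff[OF Y_near[of n "Suc k"] Y_near[of n k], of "u n" "u n"] f by (simp add: Y_Suc)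
    also have "\<dots> \<le> c * c ^ Suc k" using Suc c0 by (auto intro: mult_left_mono)
    finally show ?case by simp
  qed
  have Y_far: "f (Y (u n) (N + k) - Y (u n) N) \<le> c ^ N" for n N k
  proof (induction k)
    case 0
    then show ?case using f c0 by simp
  next
    case (Suc k)
    have "f (Y (u n) (Suc (N + k)) - Y (u n) (N + k)) \<le> c ^ N"
      by (rule order_trans[OF Y_step]) (rule power_decreasing, use c0 c in auto)
    from nonarch_add_le[OF f(2) this Suc] show ?case by simp
  qed
  have Y_cont: "f (Y (u m) k - Y (u n) k) \<le> f (u m - u n)" for m n k
  proof (induction k)
    case (Suc k)
    have "c * f (Y (u m) k - Y (u n) k) \<le> 1 * f (u m - u n)"
      using Suc c0 c f by (intro mult_mono) auto
    then show ?case
      using T_diff[OF Y_near[of m k] Y_near[of n k], of "u m" "u n"] by (simp add: Y_Suc)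
  qed (use f in \<open>simp add: Y_def\<close>)
  have pow0: "(\<lambda>n. c ^ n) \<longlonglongrightarrow> 0" using c c0 by (intro LIMSEQ_power_zero) auto
  \<comment> \<open>Diagonal choice: the iterates converge at a rate independent of \<open>n\<close>
    by \<open>Y_far\<close> and depend on \<open>u n\<close> without loss by \<open>Y_cont\<close>;
    together this makes \<open>y\<close> Cauchy.\<close>
  define y where "y n = Y (u n) n" for n
  have "y \<in> Cau f"
    unfolding Cau_iff
  proof (intro allI impI)
    fix e :: real assume "e > 0"
    obtain N where N: "\<forall>m\<ge>N. \<forall>n\<ge>N. f (u m - u n) < e" using CauD[OF u(1) \<open>e > 0\<close>] by blast
    obtain M where M: "\<forall>n\<ge>M. c ^ n < e"
      using order_tendstoD(2)[OF pow0 \<open>e > 0\<close>] by (auto simp: eventually_sequentially)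
    let ?K = "max M N"
    have "f (y m - y n) < e" if "m \<ge> ?K" "n \<ge> ?K" for m n
    proof -
      have "f (Y (u m) m - Y (u m) ?K) < e" "f (Y (u n) n - Y (u n) ?K) < e"
        using Y_far[of m ?K "m - ?K"] Y_far[of n ?K "n - ?K"] M[rule_format, of ?K] that
        by (auto intro: order_le_less_trans)
      moreover have "f (Y (u m) ?K - Y (u n) ?K) < e"
        using Y_cont[of m ?K n] N that by (auto intro: order_le_less_trans)
      ultimately have "f ((Y (u m) m - Y (u m) ?K) + ((Y (u m) ?K - Y (u n) ?K) + (Y (u n) ?K - Y (u n) n))) < e"
        using av_diff_commute[OF f(1), of "Y (u n) n" "Y (u n) ?K"] by (intro nonarch_add_less[of f] f) auto
      then show ?thesis by (simp add: y_def)
    qed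
    then show "\<exists>N. \<forall>m\<ge>N. \<forall>n\<ge>N. f (y m - y n) < e" by blast
  qed
  moreover have "(\<lambda>n. y n ^ l - u n) \<in> Nul f"
  proof (rule Nul_tendsto_le[OF f(1) _ pow0])
    fix n
    \<comment> \<open>The defect of the \<open>l\<close>-th power is \<open>l\<close> times one
      further step of the iteration, and such steps shrink like \<open>c ^ Suc n\<close>.\<close>
    have "y n ^ l - u n = of_nat l * (Y (u n) n - Y (u n) (Suc n))"
      using l0 by (simp add: Y_Suc T_def y_def)
    then have "f (y n ^ l - u n) = f (Y (u n) (Suc n) - Y (u n) n)"
      using f l by (simp add: av_mult av_diff_commute)
    also have "\<dots> \<le> c ^ Suc n" by (rule Y_step)
    also have "\<dots> \<le> c ^ n" using c c0 by (intro power_decreasing) auto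
    finally show "f (y n ^ l - u n) \<le> c ^ n" .
  qed
  ultimately show ?thesis by blast
qed

lemma Cau_cong:
  assumes "absolute_value f" "x \<in> Cau f" "(\<lambda>n. y n - x n) \<in> Nul f"
  shows "y \<in> Cau f"
  using Cau_add[OF assms(1,2) Nul_in_Cau[OF assms(1,3)]] by simp

lemma Nul_eventually_eq:
  assumes "absolute_value f" "\<And>n. n \<ge> N \<Longrightarrow> x n = y n"
  shows "(\<lambda>n. x n - y n) \<in> Nul f"
proof -
  have "\<forall>\<^sub>F n in sequentially. f (x n - y n) = 0"
    using assms by (auto simp: eventually_sequentially intro!: exI[of _ N])
  then show ?thesis unfolding Nul_iff by (rule tendsto_eventually)
qed

text \<open>Changing finitely many entries of \<open>u\<close> to \<open>1\<close> turns the bound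
  on the limit into a bound that is uniform in \<open>n\<close>.\<close>

lemma root_near_one:
  fixes f :: "'a::field \<Rightarrow> real"
  assumes f: "absolute_value f" "nonarchimedean f" and l: "f (of_nat l) = 1"
    and u: "u \<in> Cau f" and lt: "seq_abs f (\<lambda>n. u n - 1) < 1"
  shows "\<exists>y\<in>Cau f. (\<lambda>n. y n ^ l - u n) \<in> Nul f"
proof -
  obtain c where c: "seq_abs f (\<lambda>n. u n - 1) < c" "c < 1" using dense[OF lt] by blast
  have u1: "(\<lambda>n. u n - 1) \<in> Cau f" using u f by (intro Cau_diff) auto
  obtain N where N: "\<And>n. n \<ge> N \<Longrightarrow> f (u n - 1) < c"
    using order_tendstoD(2)[OF seq_abs_tendsto[OF f(1) u1] c(1)] by (auto simp: eventually_sequentially)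
  define u' where "u' n = (if n \<ge> N then u n else 1)" for n
  have nul: "(\<lambda>n. u' n - u n) \<in> Nul f" by (rule Nul_eventually_eq[OF f(1), of N]) (simp add: u'_def)
  have "c \<ge> 0" using order_le_less_trans[OF av_nonneg[OF f(1)] N[of N]] by simp
  then have "f (u' n - 1) \<le> c" for n using less_imp_le[OF N[of n]] f by (simp add: u'_def)
  then obtain y where y: "y \<in> Cau f" "(\<lambda>n. y n ^ l - u' n) \<in> Nul f"
    using root_near_one_uniform[OF f l c(2) Cau_cong[OF f(1) u nul]] by blast
  then have "(\<lambda>n. y n ^ l - u n) \<in> Nul f" using Nul_add[OF f(1) y(2) nul] by simp
  then show ?thesis using y(1) by blast
qed

text \<open>Over \<open>p\<close>, for a prime \<open>l \<noteq> p\<close> that exceeds the degree, this says that \<open>x\<close> is integral.\<close>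

definition root_test :: "('a::field \<Rightarrow> real) \<Rightarrow> nat \<Rightarrow> nat \<Rightarrow> (nat \<Rightarrow> 'a) \<Rightarrow> bool" where
  "root_test f p l x \<longleftrightarrow> (\<exists>y\<in>Cau f. (\<lambda>n. y n ^ l - (1 + of_nat p * x n ^ l)) \<in> Nul f)"

text \<open>The sequence under the root differs from \<open>1\<close> by an element of value below
  \<open>1\<close>, so \<open>root_near_one\<close> applies. The hypothesis also covers the case
  that \<open>p\<close> is a unit, in which the lemma serves to refute
  \<open>char_formula\<close>.\<close>

lemma root_test_small:
  assumes f: "absolute_value f" "nonarchimedean f" and l: "f (of_nat l) = 1"
    and x: "x \<in> Cau f" and lt: "f (of_nat p) * seq_abs f x ^ l < 1"
  shows "root_test f p l x"
proof -
  have "(\<lambda>n. 1 + of_nat p * x n ^ l) \<in> Cau f"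
    using f x by (intro Cau_add Cau_mult Cau_power) auto
  moreover have "seq_abs f (\<lambda>n. 1 + of_nat p * x n ^ l - 1) < 1"
    using lt f x by (simp add: seq_abs_mult seq_abs_power Cau_power)
  ultimately show ?thesis unfolding root_test_def by (intro root_near_one f l) auto
qed

lemma lies_over_of_prime:
  assumes "lies_over p f" "prime l" "l \<noteq> p"
  shows "f (of_nat l) = 1"
  using lies_over_coprime[OF assms(1), of "int l"] assms by (simp add: lies_over_def primes_coprime)

text \<open>For the converse suppose that \<open>x\<close> has value above \<open>1\<close>. Then so
  has \<open>p\<close> times \<open>x ^ l\<close>, as otherwise the inverse of \<open>x\<close> has
  a value excluded by \<open>no_small_value\<close>. Adding \<open>1\<close> does not change such a
  value, so a root \<open>y\<close> gives a quotient of \<open>y\<close> by \<open>x\<close> whose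
  \<open>l\<close>-th power has the value of \<open>p\<close>, which is excluded too.\<close>

lemma root_test_iff:
  fixes f :: "'a::field_char_0 \<Rightarrow> real"
  assumes d: "dim_at_most TYPE('a) d" "d < l" and p: "lies_over p f" and l: "prime l" "l \<noteq> p"
    and x: "x \<in> Cau f"
  shows "root_test f p l x \<longleftrightarrow> seq_abs f x \<le> 1"
proof
  have f: "absolute_value f" "nonarchimedean f" "f (of_nat p) < 1" using p by (auto simp: lies_over_def)
  have l0: "l > 0" using l(1) by (simp add: prime_gt_0_nat)
  show "root_test f p l x" if "seq_abs f x \<le> 1"
  proof (rule root_test_small[OF f(1,2) lies_over_of_prime[OF p l] x])
    have "f (of_nat p) * seq_abs f x ^ l \<le> f (of_nat p) * 1"
      using that f x by (intro mult_left_mono power_le_one) auto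
    then show "f (of_nat p) * seq_abs f x ^ l < 1" using f(3) by simp
  qed
  assume "root_test f p l x"
  then obtain y where y: "y \<in> Cau f" "(\<lambda>n. y n ^ l - (1 + of_nat p * x n ^ l)) \<in> Nul f"
    by (auto simp: root_test_def)
  show "seq_abs f x \<le> 1"
  proof (rule ccontr)
    assume "\<not> ?thesis"
    \<comment> \<open>Both conditions are read off at one late index, because
      \<open>no_small_value\<close> speaks of elements of the number field itself.\<close>
    then have "\<forall>\<^sub>F n in sequentially. f (x n) > 1"
      by (intro order_tendstoD(1)[OF seq_abs_tendsto[OF f(1) x]]) auto
    moreover have "\<forall>\<^sub>F n in sequentially. f (y n ^ l - (1 + of_nat p * x n ^ l)) < 1"
      using y(2) by (intro order_tendstoD(2)[where y = 0]) (auto simp: Nul_iff)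
    ultimately obtain n where n: "f (x n) > 1" "f (y n ^ l - (1 + of_nat p * x n ^ l)) < 1"
      using eventually_happens[OF eventually_conj] by fastforce
    have x0: "x n \<noteq> 0" using n(1) f(1) by auto
    let ?t = "of_nat p * x n ^ l"
    have ft: "f ?t = f (of_nat p) * f (x n) ^ l" by (simp add: av_mult av_power f)
    have t1: "f ?t > 1"
    proof (rule ccontr)
      assume "\<not> ?thesis"
      then have "f (of_nat p) * f (x n) ^ l \<le> 1" unfolding ft by simp
      moreover have "f (x n) ^ l > 0" using n(1) by simp
      ultimately have "f (of_nat p) \<le> inverse (f (x n) ^ l)" by (simp add: field_simps)
      then have "f (of_nat p) \<le> f (inverse (x n)) ^ l"
        by (simp only: av_inverse[OF f(1)] power_inverse)
      moreover have "f (inverse (x n)) < 1"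
        using n(1) by (simp add: av_inverse f inverse_less_1_iff)
      ultimately show False using no_small_value[OF d p] by blast
    qed
    have "f (?t - y n ^ l) = f ((y n ^ l - (1 + ?t)) + 1)"
      using av_diff_commute[OF f(1), of "y n ^ l" ?t] by (simp add: algebra_simps)
    also have "\<dots> \<le> 1" using n(2) f by (intro nonarch_add_le[of f] f) auto
    also have "1 < f ?t" by (rule t1)
    finally have "f (y n ^ l) = f ?t" by (rule nonarch_eq[OF f(1,2)])
    then have "f (y n / x n) ^ l = f (of_nat p)"
      using x0 f(1) by (simp add: av_divide av_power power_divide ft)
    moreover from this have "f (y n / x n) < 1"
      using f(3) by (metis linorder_not_le one_le_power)
    ultimately show False using no_small_value[OF d p, of "y n / x n"] by simp
  qed
qed

section \<open>A sentence that detects the residue characteristic\<close>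

definition root_formula :: "nat \<Rightarrow> nat \<Rightarrow> ring_term \<Rightarrow> nat \<Rightarrow> ring_formula" where
  "root_formula p l t j =
     Exist j (Equal (power_term (Var j) l) (Plus One (Times (nat_term p) (power_term t l))))"

lemma term_at_cong: "(\<And>i. i \<in> term_vars t \<Longrightarrow> e i = e' i) \<Longrightarrow> term_at e t = term_at e' t"
  by (induction t) auto

lemma sat_root_formula:
  assumes "j \<notin> term_vars t"
  shows "sat f e (root_formula p l t j) \<longleftrightarrow> root_test f p l (\<lambda>n. term_at (\<lambda>i. e i n) t)"
proof -
  have "term_at (\<lambda>i. (e(j := y)) i n) t = term_at (\<lambda>i. e i n) t" for y n
    using assms by (intro term_at_cong) auto
  then show ?thesis by (simp add: root_formula_def root_test_def del: fun_upd_apply) (simp)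
qed

lemma free_vars_root_formula: "free_vars (root_formula p l t j) \<subseteq> term_vars t"
  using term_vars_power_term[of "Var j" l] term_vars_power_term[of t l]
  by (auto simp: root_formula_def)

text \<open>Over \<open>p\<close> the root test defines the valuation ring, which has these closure
  properties and omits the inverse of \<open>p\<close>. Over another prime the inverse of
  \<open>p\<close> arises from accepted elements by sums and products, so the conditions
  clash.\<close>

definition char_formula :: "nat \<Rightarrow> nat \<Rightarrow> ring_formula" where
  "char_formula p l = Conj (Forall 0 (Forall 1 (Impl
      (Conj (root_formula p l (Var 0) 2) (root_formula p l (Var 1) 2))
      (Conj (root_formula p l (Plus (Var 0) (Var 1)) 2) (root_formula p l (Times (Var 0) (Var 1)) 2)))))
    (Conj (root_formula p l One 2)
      (Forall 0 (Impl (Equal (Times (nat_term p) (Var 0)) One) (Negation (root_formula p l (Var 0) 2)))))"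

lemma sentence_char_formula: "sentence (char_formula p l)"
  unfolding sentence_def char_formula_def
  using free_vars_root_formula[of p l "Var 0" 2] free_vars_root_formula[of p l "Var 1" 2]
    free_vars_root_formula[of p l "Plus (Var 0) (Var 1)" 2] free_vars_root_formula[of p l "Times (Var 0) (Var 1)" 2]
    free_vars_root_formula[of p l One 2]
  by auto

lemma sat_char_formula:
  "sat f e (char_formula p l) \<longleftrightarrow>
     (\<forall>x\<in>Cau f. \<forall>y\<in>Cau f. root_test f p l x \<and> root_test f p l y \<longrightarrow>
        root_test f p l (\<lambda>n. x n + y n) \<and> root_test f p l (\<lambda>n. x n * y n)) \<and>
     root_test f p l (\<lambda>n. 1) \<and>
     (\<forall>x\<in>Cau f. (\<lambda>n. of_nat p * x n - 1) \<in> Nul f \<longrightarrow> \<not> root_test f p l x)"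
  by (simp add: char_formula_def sat_root_formula) blast

lemma char_formula_over:
  fixes f :: "'a::field_char_0 \<Rightarrow> real"
  assumes d: "dim_at_most TYPE('a) d" "d < l" and p: "lies_over p f" and l: "prime l" "l \<noteq> p"
  shows "holds_in (field_completion f) (char_formula p l)"
proof -
  have f: "absolute_value f" "nonarchimedean f" "f (of_nat p) < 1" using p by (auto simp: lies_over_def)
  note iff = root_test_iff[OF d p l]
  have "\<not> root_test f p l x" if x: "x \<in> Cau f" "(\<lambda>n. of_nat p * x n - 1) \<in> Nul f" for x
  proof
    assume "root_test f p l x"
    then have "seq_abs f x \<le> 1" using iff x by simp
    moreover have "seq_abs f (\<lambda>n. of_nat p * x n) = 1"
      using seq_abs_cong[OF f(1), of "\<lambda>_. 1" "\<lambda>n. of_nat p * x n"] x f by simp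
    then have "f (of_nat p) * seq_abs f x = 1" using x f by (simp add: seq_abs_mult)
    moreover have "f (of_nat p) * seq_abs f x \<le> f (of_nat p) * 1"
      using \<open>seq_abs f x \<le> 1\<close> f by (intro mult_left_mono) auto
    ultimately show False using f(3) by simp
  qed
  then have "sat f (\<lambda>_ _. 0) (char_formula p l)"
    unfolding sat_char_formula using f
    by (auto simp: iff Cau_add Cau_mult seq_abs_mult intro!: seq_abs_nonarch_le mult_le_one)
  then show ?thesis
    using f by (subst holds_in_completion_iff[OF f(1) sentence_char_formula, where e = "\<lambda>_ _. 0"]) auto
qed

text \<open>Pigeonhole on the residues of \<open>p ^ i\<close>; the smaller power is a unit modulo
  \<open>q\<close> and cancels.\<close>

lemma exists_power_cong_one:
  fixes p q :: nat
  assumes "coprime p q" "q > 0"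
  shows "\<exists>N>0. int q dvd int p ^ N - 1"
proof -
  have "\<not> inj (\<lambda>i. p ^ i mod q)"
  proof
    assume "inj (\<lambda>i. p ^ i mod q)"
    then have "infinite (range (\<lambda>i. p ^ i mod q))" by (simp add: finite_image_iff)
    moreover have "range (\<lambda>i. p ^ i mod q) \<subseteq> {..<q}" using assms(2) by auto
    ultimately show False using finite_subset by blast
  qed
  then obtain i j where ij: "i < j" "p ^ i mod q = p ^ j mod q"
    by (metis (mono_tags, lifting) injI linorder_neqE_nat)
  then have "int q dvd int p ^ j - int p ^ i"
    by (metis mod_eq_dvd_iff of_nat_mod of_nat_power)
  moreover have "int p ^ j - int p ^ i = int p ^ i * (int p ^ (j - i) - 1)"
    using ij(1) by (simp add: algebra_simps flip: power_add)
  moreover have "coprime (int q) (int p ^ i)"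
    using assms(1) by (simp add: coprime_commute)
  ultimately have "int q dvd int p ^ (j - i) - 1"
    by (simp add: coprime_dvd_mult_right_iff)
  then show ?thesis using ij(1) by (intro exI[of _ "j - i"]) auto
qed

text \<open>Over \<open>q\<close> both \<open>p\<close> and \<open>l\<close> are units and the root
  test accepts the open unit ball. As \<open>p ^ N\<close> is \<open>1\<close> modulo
  \<open>q\<close>, its inverse is \<open>1\<close> plus a small element; multiplied by
  \<open>p ^ (N - 1)\<close>, a sum of ones, it puts the inverse of \<open>p\<close> among the
  accepted elements.\<close>

lemma char_formula_not_over:
  fixes f :: "'a::field_char_0 \<Rightarrow> real"
  assumes q: "lies_over q f" and p: "prime p" "p \<noteq> q" and l: "prime l" "l \<noteq> q"
  shows "\<not> holds_in (field_completion f) (char_formula p l)"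
proof
  assume holds: "holds_in (field_completion f) (char_formula p l)"
  have f: "absolute_value f" "nonarchimedean f" "f (of_nat q) < 1" "prime q" using q by (auto simp: lies_over_def)
  have l0: "l > 0" using l(1) by (simp add: prime_gt_0_nat)
  have "sat f (\<lambda>_ _. 0) (char_formula p l)"
    using holds f by (subst (asm) holds_in_completion_iff[OF f(1) sentence_char_formula, where e = "\<lambda>_ _. 0"]) auto
  then have S: "\<And>x y. x \<in> Cau f \<Longrightarrow> y \<in> Cau f \<Longrightarrow> root_test f p l x \<Longrightarrow> root_test f p l y \<Longrightarrow>
        root_test f p l (\<lambda>n. x n + y n) \<and> root_test f p l (\<lambda>n. x n * y n)"
    "root_test f p l (\<lambda>n. 1)"
    "\<And>x. x \<in> Cau f \<Longrightarrow> (\<lambda>n. of_nat p * x n - 1) \<in> Nul f \<Longrightarrow> \<not> root_test f p l x"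
    unfolding sat_char_formula by blast+
  define C where "C a \<longleftrightarrow> root_test f p l (\<lambda>_. a)" for a
  have C: "C 1" "\<And>a b. C a \<Longrightarrow> C b \<Longrightarrow> C (a + b)" "\<And>a b. C a \<Longrightarrow> C b \<Longrightarrow> C (a * b)"
    unfolding C_def using S(1)[OF Cau_const Cau_const] S(2) f(1) by blast+
  have fl: "f (of_nat l) = 1" by (rule lies_over_of_prime[OF q l])
  have fp: "f (of_nat p) = 1" by (rule lies_over_of_prime[OF q p])
  have small: "C a" if "f a < 1" for a
    unfolding C_def
  proof (rule root_test_small[OF f(1,2) fl])
    show "f (of_nat p) * seq_abs f (\<lambda>_. a) ^ l < 1"
      using that f l0 by (simp add: fp power_less_one_iff)
  qed (use f in auto)
  obtain N where N: "N > 0" "int q dvd int p ^ N - 1"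
    using exists_power_cong_one[of p q] p f(4) by (auto simp: prime_gt_0_nat primes_coprime)
  then obtain m where m: "int p ^ N - 1 = int q * m" by auto
  have p0: "(of_nat p :: 'a) \<noteq> 0" using p(1) by (simp add: prime_gt_0_nat)
  have pN: "(of_nat p :: 'a) ^ N = 1 + of_nat q * of_int m"
  proof -
    have "(of_int (int p ^ N) :: 'a) = of_int (1 + int q * m)" using m by (simp add: algebra_simps)
    then show ?thesis by simp
  qed
  have "f (- (of_nat q * of_int m) / of_nat p ^ N) < 1"
  proof -
    have "f (of_nat q) * f (of_int m) \<le> f (of_nat q) * 1"
      using f by (intro mult_left_mono nonarch_of_int_le) auto
    then have "f (of_nat q) * f (of_int m) < 1" using f(3) by linarith
    then show ?thesis using f fp by (simp add: av_mult av_divide av_power)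
  qed
  then have "C (1 + - (of_nat q * of_int m) / of_nat p ^ N)" by (intro C small)
  moreover have "1 + - (of_nat q * of_int m) / of_nat p ^ N = (1 / of_nat p ^ N :: 'a)"
  proof -
    have "of_nat p ^ N - of_nat q * of_int m = (1 :: 'a)" using pN by simp
    moreover have "1 + - (of_nat q * of_int m) / of_nat p ^ N = (of_nat p ^ N - of_nat q * of_int m) / (of_nat p ^ N :: 'a)"
      using p0 by (simp add: diff_divide_distrib)
    ultimately show ?thesis by simp
  qed
  ultimately have "C (1 / of_nat p ^ N)" by simp
  moreover have Cn: "C (of_nat n)" if "n > 0" for n
    using that by (induction n rule: nat_induct_non_zero) (auto intro: C)
  have "C (of_nat (p ^ (N - 1)))" using p(1) by (intro Cn) (simp add: prime_gt_0_nat)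
  ultimately have "C (of_nat (p ^ (N - 1)) * (1 / of_nat p ^ N))" by (intro C)
  moreover have "of_nat (p ^ (N - 1)) * (1 / of_nat p ^ N) = (1 / of_nat p :: 'a)"
    using p0 N by (cases N) auto
  ultimately have "root_test f p l (\<lambda>_. 1 / of_nat p)" by (simp add: C_def)
  moreover have "(\<lambda>n. of_nat p * (1 / of_nat p) - 1 :: 'a) \<in> Nul f" using p0 f by simp
  ultimately show False using S(3)[of "\<lambda>_. 1 / of_nat p"] f(1) by auto
qed

section \<open>A sentence that excludes non-archimedean places\<close>

definition roots_formula :: "nat \<Rightarrow> ring_formula" where
  "roots_formula l = Forall 0 (Exist 1 (Equal (power_term (Var 1) l) (Var 0)))"

lemma sentence_roots_formula: "sentence (roots_formula l)"
  using term_vars_power_term[of "Var 1" l] by (auto simp: sentence_def roots_formula_def)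

lemma holds_roots_formula:
  assumes "absolute_value f"
  shows "holds_in (field_completion f) (roots_formula l) \<longleftrightarrow>
    (\<forall>x\<in>Cau f. \<exists>y\<in>Cau f. (\<lambda>n. y n ^ l - x n) \<in> Nul f)"
  using assms by (subst holds_in_completion_iff[OF assms sentence_roots_formula, where e = "\<lambda>_ _. 0"])
    (auto simp: roots_formula_def)

text \<open>An \<open>l\<close>-th root of \<open>p\<close> would have a value excluded by
  \<open>no_small_value\<close>; the contradiction is drawn at one late entry of a sequence
  representing the root.\<close>

lemma roots_formula_over:
  fixes f :: "'a::field_char_0 \<Rightarrow> real"
  assumes d: "dim_at_most TYPE('a) d" "d < l" and p: "lies_over p f"
  shows "\<not> holds_in (field_completion f) (roots_formula l)"
proof
  have f: "absolute_value f" "nonarchimedean f" "f (of_nat p) < 1" using p by (auto simp: lies_over_def)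
  assume "holds_in (field_completion f) (roots_formula l)"
  then obtain y where "y \<in> Cau f" and y: "(\<lambda>n. y n ^ l - of_nat p) \<in> Nul f"
    using bspec[OF iffD1[OF holds_roots_formula[OF f(1)]] Cau_const[OF f(1), of "of_nat p"]] by auto
  have "\<forall>\<^sub>F n in sequentially. f (y n ^ l - of_nat p) < f (of_nat p)"
    using y lies_over_pos[OF p] by (intro order_tendstoD(2)[where y = 0]) (auto simp: Nul_iff)
  then obtain n where "f (y n ^ l - of_nat p) < f (of_nat p)"
    by (auto simp: eventually_sequentially)
  then have "f (of_nat p - y n ^ l) < f (of_nat p)"
    by (subst av_diff_commute[OF f(1)])
  then have "f (y n) ^ l = f (of_nat p)"
    using nonarch_eq[OF f(1,2), of "of_nat p" "y n ^ l"] by (simp add: av_power[OF f(1)])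
  moreover from this have "f (y n) < 1"
    using f(3) by (metis linorder_not_le one_le_power)
  ultimately show False using no_small_value[OF d p, of "y n"] by simp
qed

section \<open>Homomorphisms between completions\<close>

lemma seq_abs_diff_triangle:
  assumes "absolute_value g" "x \<in> Cau g" "y \<in> Cau g" "z \<in> Cau g"
  shows "seq_abs g (\<lambda>n. x n - z n) \<le> seq_abs g (\<lambda>n. x n - y n) + seq_abs g (\<lambda>n. y n - z n)"
  using seq_abs_triangle[OF assms(1) Cau_diff[OF assms(1,2,3)] Cau_diff[OF assms(1,3,4)]] by simp

lemma seq_abs_diff_commute:
  "absolute_value g \<Longrightarrow> seq_abs g (\<lambda>n. x n - y n) = seq_abs g (\<lambda>n. y n - x n)"
  by (simp add: seq_abs_def av_diff_commute)

lemma seq_abs_abs_diff: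
  assumes "absolute_value g" "x \<in> Cau g" "y \<in> Cau g"
  shows "\<bar>seq_abs g x - seq_abs g y\<bar> \<le> seq_abs g (\<lambda>n. x n - y n)"
  using seq_abs_triangle[OF assms(1) Cau_diff[OF assms(1,2,3)] assms(3)]
    seq_abs_triangle[OF assms(1) Cau_diff[OF assms(1,3,2)] assms(2)]
    seq_abs_diff_commute[OF assms(1), of x y] by simp

lemma seq_abs_diff_cong:
  assumes g: "absolute_value g" and x: "x \<in> Cau g" "y \<in> Cau g" "(\<lambda>n. x' n - x n) \<in> Nul g"
  shows "seq_abs g (\<lambda>n. x' n - y n) = seq_abs g (\<lambda>n. x n - y n)"
proof (rule seq_abs_cong[OF g])
  show "(\<lambda>n. x n - y n) \<in> Cau g" using g x by (intro Cau_diff)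
  show "(\<lambda>n. x' n - y n - (x n - y n)) \<in> Nul g" using x(3) by simp
qed

lemma completion_abs_nonneg:
  "absolute_value f \<Longrightarrow> U \<in> carrier (field_completion f) \<Longrightarrow> 0 \<le> completion_abs f U"
  by (auto simp: completion_carrier completion_abs_seq_class)

lemma completion_abs_0_iff:
  assumes f: "absolute_value f" and U: "U \<in> carrier (field_completion f)"
  shows "completion_abs f U = 0 \<longleftrightarrow> U = \<zero>\<^bsub>field_completion f\<^esub>"
proof -
  obtain x where "x \<in> Cau f" "U = seq_class f x" using completion_carrierE[OF f U] .
  then show ?thesis
    using f by (simp add: completion_abs_seq_class completion_zero seq_class_eq_iff seq_abs_0_iff)
qed

lemma completion_abs_triangle:
  assumes f: "absolute_value f" and U: "U \<in> carrier (field_completion f)" "W \<in> carrier (field_completion f)"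
  shows "completion_abs f (U \<oplus>\<^bsub>field_completion f\<^esub> W) \<le> completion_abs f U + completion_abs f W"
proof -
  obtain x y where "x \<in> Cau f" "U = seq_class f x" "y \<in> Cau f" "W = seq_class f y"
    using U f by (auto simp: completion_carrier)
  then show ?thesis
    using f seq_abs_triangle[OF f, of x y] by (simp add: completion_add completion_abs_seq_class Cau_add)
qed

lemma completion_dense:
  assumes f: "absolute_value f" and U: "U \<in> carrier (field_completion f)" and e: "e > 0"
  shows "\<exists>a. completion_abs f (U \<ominus>\<^bsub>field_completion f\<^esub> seq_class f (\<lambda>_. a)) < e"
proof -
  obtain x where x: "x \<in> Cau f" "U = seq_class f x" using completion_carrierE[OF f U] .
  obtain a where "seq_abs f (\<lambda>n. x n - a) < e" using seq_abs_dense[OF f x(1) e] by blast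
  then show ?thesis
    using f x by (intro exI[of _ a]) (simp add: completion_diff completion_abs_seq_class Cau_diff)
qed

text \<open>The Cauchy sequence \<open>\<phi> x\<close> represents the image of \<open>x\<close>, so \<open>\<phi>\<close> stands for a ring homomorphism into the
  completion.\<close>

lemma completion_extend:
  fixes f :: "'a::field \<Rightarrow> real" and g :: "'b::field \<Rightarrow> real" and \<phi> :: "'a \<Rightarrow> nat \<Rightarrow> 'b"
  assumes f: "absolute_value f" and g: "absolute_value g" and s: "s > 0"
    and Cau: "\<And>x. \<phi> x \<in> Cau g"
    and add: "\<And>x y n. \<phi> (x + y) n = \<phi> x n + \<phi> y n"
    and mult: "\<And>x y. (\<lambda>n. \<phi> (x * y) n - \<phi> x n * \<phi> y n) \<in> Nul g"
    and one: "(\<lambda>n. \<phi> 1 n - 1) \<in> Nul g"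
    and abs: "\<And>x. seq_abs g (\<phi> x) = f x powr s"
  shows "\<exists>\<Phi> \<in> ring_hom (field_completion f) (field_completion g).
    \<forall>U\<in>carrier (field_completion f). completion_abs g (\<Phi> U) = completion_abs f U powr s"
proof -
  have zero: "\<phi> 0 n = 0" for n using add[of 0 0 n] by (metis add.right_neutral add_cancel_right_right)
  have diff: "\<phi> (x - y) n = \<phi> x n - \<phi> y n" for x y n using add[of "x - y" y n] by simp
  \<comment> \<open>Here \<open>l\<close> represents the limit of the images of the entries of
    \<open>x\<close>; the existence of such an \<open>l\<close> is completeness of the
    target.\<close>
  define R where "R x l \<longleftrightarrow> l \<in> Cau g \<and> (\<lambda>n. seq_abs g (\<lambda>m. \<phi> (x n) m - l m)) \<longlonglongrightarrow> 0" for x l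
  have R_I: "R x l" if "l \<in> Cau g" "\<And>n. seq_abs g (\<lambda>m. \<phi> (x n) m - l m) \<le> b n" "b \<longlonglongrightarrow> 0" for x l b
    unfolding R_def
  proof
    show "(\<lambda>n. seq_abs g (\<lambda>m. \<phi> (x n) m - l m)) \<longlonglongrightarrow> 0"
      by (rule tendsto_sandwich[of "\<lambda>_. 0" _ _ b]) (use that g Cau in \<open>auto intro!: always_eventually seq_abs_nonneg Cau_diff\<close>)
  qed (rule that)
  have R_ex: "\<exists>l. R x l" if x: "x \<in> Cau f" for x
  proof -
    \<comment> \<open>Each image is replaced by a nearby element of the dense field; the sequence of
      these elements represents the limit.\<close>
    have "\<exists>a. seq_abs g (\<lambda>m. \<phi> (x n) m - a) < 1 / real (Suc n)" for n
      by (intro seq_abs_dense[OF g Cau]) simp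
    then obtain l where l: "\<And>n. seq_abs g (\<lambda>m. \<phi> (x n) m - l n) < 1 / real (Suc n)" by metis
    have inv0: "(\<lambda>n. 1 / real (Suc n)) \<longlonglongrightarrow> 0" using LIMSEQ_inverse_real_of_nat by (simp add: inverse_eq_divide)
    have tri: "g (l i - l j) \<le> 1 / real (Suc i) + f (x i - x j) powr s + 1 / real (Suc j)" for i j
    proof -
      have "g (l i - l j) = seq_abs g (\<lambda>m. l i - l j)" by simp
      also have "\<dots> \<le> seq_abs g (\<lambda>m. l i - \<phi> (x i) m) + seq_abs g (\<lambda>m. \<phi> (x i) m - l j)"
        using g Cau by (intro seq_abs_diff_triangle) auto
      also have "seq_abs g (\<lambda>m. \<phi> (x i) m - l j) \<le>
          seq_abs g (\<lambda>m. \<phi> (x i) m - \<phi> (x j) m) + seq_abs g (\<lambda>m. \<phi> (x j) m - l j)"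
        using g Cau by (intro seq_abs_diff_triangle) auto
      also have "(\<lambda>m. \<phi> (x i) m - \<phi> (x j) m) = \<phi> (x i - x j)" by (rule ext) (simp add: diff)
      also have "seq_abs g (\<lambda>m. l i - \<phi> (x i) m) = seq_abs g (\<lambda>m. \<phi> (x i) m - l i)"
        by (rule seq_abs_diff_commute[OF g])
      finally show ?thesis using l[of i] l[of j] by (simp add: abs)
    qed
    have "l \<in> Cau g"
      unfolding Cau_iff
    proof (intro allI impI)
      fix e :: real assume "e > 0"
      then have e3: "e / 3 > 0" "(e / 3) powr (1 / s) > 0" by simp_all
      obtain N where N: "\<forall>m\<ge>N. \<forall>n\<ge>N. f (x m - x n) < (e / 3) powr (1 / s)"
        using CauD[OF x e3(2)] by blast
      obtain M where M: "\<forall>n\<ge>M. 1 / real (Suc n) < e / 3"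
        using order_tendstoD(2)[OF inv0 e3(1)] by (auto simp: eventually_sequentially)
      have "g (l i - l j) < e" if "i \<ge> max M N" "j \<ge> max M N" for i j
      proof -
        have "f (x i - x j) powr s < ((e / 3) powr (1 / s)) powr s"
          using N that f s by (intro powr_less_mono2) auto
        also have "\<dots> = e / 3" using s \<open>e > 0\<close> by (simp add: powr_powr)
        finally have "f (x i - x j) powr s < e / 3" .
        moreover have "1 / real (Suc i) < e / 3" "1 / real (Suc j) < e / 3" using M that by auto
        ultimately show ?thesis using tri[of i j] by linarith
      qed
      then show "\<exists>N. \<forall>m\<ge>N. \<forall>n\<ge>N. g (l m - l n) < e" by blast
    qed
    moreover have "(\<lambda>n. seq_abs g (\<lambda>m. l n - l m)) \<longlonglongrightarrow> 0"
    proof (rule LIMSEQ_I)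
      fix e :: real assume "e > 0"
      then obtain N where N: "\<forall>m\<ge>N. \<forall>n\<ge>N. g (l m - l n) < e / 2"
        using CauD[OF \<open>l \<in> Cau g\<close>, of "e / 2"] by auto
      have "norm (seq_abs g (\<lambda>m. l n - l m) - 0) < e" if "n \<ge> N" for n
      proof -
        have c: "(\<lambda>m. l n - l m) \<in> Cau g" using g \<open>l \<in> Cau g\<close> by (intro Cau_diff) auto
        have "seq_abs g (\<lambda>m. l n - l m) \<le> e / 2"
          using N that by (intro tendsto_upperbound[OF seq_abs_tendsto[OF g c]])
            (auto simp: eventually_sequentially intro!: exI[of _ N] less_imp_le)
        then show ?thesis using seq_abs_nonneg[OF g c] \<open>e > 0\<close> by simp
      qed
      then show "\<exists>N. \<forall>n\<ge>N. norm (seq_abs g (\<lambda>m. l n - l m) - 0) < e" by blast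
    qed
    then have "(\<lambda>n. 1 / real (Suc n) + seq_abs g (\<lambda>m. l n - l m)) \<longlonglongrightarrow> 0"
      using tendsto_add[OF inv0] by fastforce
    moreover have "seq_abs g (\<lambda>m. \<phi> (x n) m - l m) \<le> 1 / real (Suc n) + seq_abs g (\<lambda>m. l n - l m)" for n
      using seq_abs_diff_triangle[OF g Cau[of "x n"] Cau_const[OF g, of "l n"] \<open>l \<in> Cau g\<close>] l[of n] by linarith
    ultimately show ?thesis
      by (intro exI[of _ l] R_I[where b = "\<lambda>n. 1 / real (Suc n) + seq_abs g (\<lambda>m. l n - l m)"])
  qed
  have R_add: "R (\<lambda>n. x n + x' n) (\<lambda>n. l n + l' n)" if "R x l" "R x' l'" for x x' l l'
  proof (rule R_I)
    show "(\<lambda>n. l n + l' n) \<in> Cau g" using that g by (auto simp: R_def intro: Cau_add)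
    show "(\<lambda>n. seq_abs g (\<lambda>m. \<phi> (x n) m - l m) + seq_abs g (\<lambda>m. \<phi> (x' n) m - l' m)) \<longlonglongrightarrow> 0"
      using that tendsto_add[of "\<lambda>n. seq_abs g (\<lambda>m. \<phi> (x n) m - l m)" 0] by (fastforce simp: R_def)
    show "seq_abs g (\<lambda>m. \<phi> (x n + x' n) m - (l m + l' m)) \<le>
        seq_abs g (\<lambda>m. \<phi> (x n) m - l m) + seq_abs g (\<lambda>m. \<phi> (x' n) m - l' m)" for n
      using seq_abs_triangle[OF g Cau_diff[OF g Cau[of "x n"]] Cau_diff[OF g Cau[of "x' n"]], of l l'] that
      by (simp add: R_def add algebra_simps)
  qed
  have R_diff: "R (\<lambda>n. x n - x' n) (\<lambda>n. l n - l' n)" if "R x l" "R x' l'" for x x' l l'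
  proof (rule R_I)
    show "(\<lambda>n. l n - l' n) \<in> Cau g" using that g by (auto simp: R_def intro: Cau_diff)
    show "(\<lambda>n. seq_abs g (\<lambda>m. \<phi> (x n) m - l m) + seq_abs g (\<lambda>m. \<phi> (x' n) m - l' m)) \<longlonglongrightarrow> 0"
      using that tendsto_add[of "\<lambda>n. seq_abs g (\<lambda>m. \<phi> (x n) m - l m)" 0] by (fastforce simp: R_def)
    show "seq_abs g (\<lambda>m. \<phi> (x n - x' n) m - (l m - l' m)) \<le>
        seq_abs g (\<lambda>m. \<phi> (x n) m - l m) + seq_abs g (\<lambda>m. \<phi> (x' n) m - l' m)" for n
      using seq_abs_triangle[OF g Cau_diff[OF g Cau[of "x n"]] Cau_minus[OF g Cau_diff[OF g Cau[of "x' n"]]], of l l']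
        that seq_abs_minus[OF g, of "\<lambda>m. \<phi> (x' n) m - l' m"]
      by (simp add: R_def diff algebra_simps)
  qed
  have R_abs: "seq_abs g l = seq_abs f x powr s" if x: "x \<in> Cau f" and "R x l" for x l
  proof -
    have l: "l \<in> Cau g" "(\<lambda>n. seq_abs g (\<lambda>m. \<phi> (x n) m - l m)) \<longlonglongrightarrow> 0" using that by (auto simp: R_def)
    have "(\<lambda>n. seq_abs g (\<phi> (x n)) - seq_abs g l) \<longlonglongrightarrow> 0"
    proof (rule tendsto_rabs_zero_cancel, rule tendsto_sandwich[OF _ _ _ l(2)])
      show "\<forall>\<^sub>F n in sequentially. \<bar>seq_abs g (\<phi> (x n)) - seq_abs g l\<bar> \<le> seq_abs g (\<lambda>m. \<phi> (x n) m - l m)"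
        using seq_abs_abs_diff[OF g Cau l(1)] by simp
    qed auto
    then have "(\<lambda>n. f (x n) powr s) \<longlonglongrightarrow> seq_abs g l"
      by (simp add: abs LIM_zero_iff)
    moreover have "(\<lambda>n. f (x n) powr s) \<longlonglongrightarrow> seq_abs f x powr s"
      using s f by (intro tendsto_powr' seq_abs_tendsto x tendsto_const) auto
    ultimately show ?thesis by (rule LIMSEQ_unique)
  qed
  have R_mult: "R (\<lambda>n. x n * x' n) (\<lambda>n. l n * l' n)" if x: "x \<in> Cau f" "x' \<in> Cau f" and R: "R x l" "R x' l'" for x x' l l'
  proof (rule R_I)
    have l: "l \<in> Cau g" "l' \<in> Cau g" using R by (auto simp: R_def)
    show "(\<lambda>n. l n * l' n) \<in> Cau g" using l g by (intro Cau_mult)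
    have "(\<lambda>n. f (x' n) powr s) \<longlonglongrightarrow> seq_abs f x' powr s"
      using s f by (intro tendsto_powr' seq_abs_tendsto x tendsto_const) auto
    moreover have "(\<lambda>n. seq_abs g (\<lambda>m. \<phi> (x n) m - l m)) \<longlonglongrightarrow> 0" "(\<lambda>n. seq_abs g (\<lambda>m. \<phi> (x' n) m - l' m)) \<longlonglongrightarrow> 0"
      using R by (auto simp: R_def)
    ultimately have "(\<lambda>n. seq_abs g (\<lambda>m. \<phi> (x n) m - l m) * f (x' n) powr s +
        seq_abs g l * seq_abs g (\<lambda>m. \<phi> (x' n) m - l' m)) \<longlonglongrightarrow> 0 * seq_abs f x' powr s + seq_abs g l * 0"
      by (intro tendsto_add tendsto_mult tendsto_const)
    then show "(\<lambda>n. seq_abs g (\<lambda>m. \<phi> (x n) m - l m) * f (x' n) powr s +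
        seq_abs g l * seq_abs g (\<lambda>m. \<phi> (x' n) m - l' m)) \<longlonglongrightarrow> 0" by simp
    fix n
    have C: "(\<lambda>m. \<phi> (x n) m - l m) \<in> Cau g" "(\<lambda>m. \<phi> (x' n) m - l' m) \<in> Cau g"
      using g Cau l by (auto intro: Cau_diff)
    have "seq_abs g (\<lambda>m. \<phi> (x n * x' n) m - l m * l' m) = seq_abs g (\<lambda>m. \<phi> (x n) m * \<phi> (x' n) m - l m * l' m)"
      using g Cau l mult by (intro seq_abs_diff_cong) (auto intro: Cau_mult)
    also have "(\<lambda>m. \<phi> (x n) m * \<phi> (x' n) m - l m * l' m) =
        (\<lambda>m. (\<phi> (x n) m - l m) * \<phi> (x' n) m + l m * (\<phi> (x' n) m - l' m))"
      by (simp add: algebra_simps)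
    also have "seq_abs g \<dots> \<le> seq_abs g (\<lambda>m. (\<phi> (x n) m - l m) * \<phi> (x' n) m) +
        seq_abs g (\<lambda>m. l m * (\<phi> (x' n) m - l' m))"
      using C l Cau g by (intro seq_abs_triangle Cau_mult) auto
    also have "\<dots> = seq_abs g (\<lambda>m. \<phi> (x n) m - l m) * f (x' n) powr s +
        seq_abs g l * seq_abs g (\<lambda>m. \<phi> (x' n) m - l' m)"
      using C l Cau g by (simp add: seq_abs_mult abs)
    finally show "seq_abs g (\<lambda>m. \<phi> (x n * x' n) m - l m * l' m) \<le>
        seq_abs g (\<lambda>m. \<phi> (x n) m - l m) * f (x' n) powr s +
        seq_abs g l * seq_abs g (\<lambda>m. \<phi> (x' n) m - l' m)" .
  qed
  \<comment> \<open>The scaling of absolute values, applied to a difference, gives independence of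
    representatives.\<close>
  have R_unique: "seq_class g l = seq_class g l'"
    if "R x l" "R x' l'" "seq_class f x = seq_class f x'" "x \<in> Cau f" "x' \<in> Cau f" for x x' l l'
  proof -
    have "seq_abs g (\<lambda>n. l n - l' n) = seq_abs f (\<lambda>n. x n - x' n) powr s"
      using that f by (intro R_abs R_diff Cau_diff)
    also have "seq_abs f (\<lambda>n. x n - x' n) = 0"
      using that f by (simp add: seq_abs_0_iff Cau_diff seq_class_eq_iff)
    finally have "seq_abs g (\<lambda>n. l n - l' n) = 0" by simp
    then show ?thesis
      using that g seq_abs_0_iff[OF g Cau_diff[OF g]] by (simp add: R_def seq_class_eq_iff)
  qed
  have R_one: "R (\<lambda>_. 1) (\<lambda>_. 1)"
  proof (rule R_I[where b = "\<lambda>_. 0"])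
    have "seq_abs g (\<lambda>m. \<phi> 1 m - 1) = 0"
      using one g Nul_in_Cau[OF g one] by (simp add: seq_abs_0_iff)
    then show "seq_abs g (\<lambda>m. \<phi> 1 m - 1) \<le> 0" for n :: nat by simp
  qed (use g in auto)
  define P where "P U W \<longleftrightarrow> (\<exists>x l. x \<in> Cau f \<and> U = seq_class f x \<and> W = seq_class g l \<and> R x l)" for U W
  have P_ex: "\<exists>W. P U W" if U: "U \<in> carrier (field_completion f)" for U
  proof -
    obtain x where x: "x \<in> Cau f" "U = seq_class f x" using completion_carrierE[OF f U] .
    obtain l where "R x l" using R_ex[OF x(1)] by blast
    then show ?thesis unfolding P_def using x by blast
  qed
  have P_unique: "W = W'" if PW: "P U W" "P U W'" for U W W'
  proof -
    obtain x l where x: "x \<in> Cau f" "U = seq_class f x" "W = seq_class g l" "R x l" using PW(1)[unfolded P_def] by (elim exE conjE)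
    obtain x' l' where x': "x' \<in> Cau f" "U = seq_class f x'" "W' = seq_class g l'" "R x' l'" using PW(2)[unfolded P_def] by (elim exE conjE)
    have "seq_class f x = seq_class f x'" using x(2) x'(2) by simp
    from R_unique[OF x(4) x'(4) this x(1) x'(1)] show ?thesis using x(3) x'(3) by simp
  qed
  define \<Phi> where "\<Phi> U = (SOME W. P U W)" for U
  have P_iff: "\<Phi> U = W" if "P U W" for U W
    unfolding \<Phi>_def using that P_unique by (metis someI)
  have rep: "\<exists>x l. x \<in> Cau f \<and> U = seq_class f x \<and> \<Phi> U = seq_class g l \<and> R x l"
    if "U \<in> carrier (field_completion f)" for U
    using P_ex[OF that] P_iff by (metis P_def)
  have \<Phi>_R: "\<Phi> (seq_class f x) = seq_class g l" if "x \<in> Cau f" "R x l" for x l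
    using that by (intro P_iff) (auto simp: P_def)
  have Rc: "l \<in> Cau g" if "R x l" for x l using that by (simp add: R_def)
  have "\<Phi> \<in> ring_hom (field_completion f) (field_completion g)"
  proof (rule ring_hom_memI)
    fix U W assume UW: "U \<in> carrier (field_completion f)" "W \<in> carrier (field_completion f)"
    obtain x l where x: "x \<in> Cau f" "U = seq_class f x" "\<Phi> U = seq_class g l" "R x l" using rep[OF UW(1)] by blast
    obtain x' l' where x': "x' \<in> Cau f" "W = seq_class f x'" "\<Phi> W = seq_class g l'" "R x' l'" using rep[OF UW(2)] by blast
    show "\<Phi> U \<in> carrier (field_completion g)" using x g Rc by simp
    show "\<Phi> (U \<otimes>\<^bsub>field_completion f\<^esub> W) = \<Phi> U \<otimes>\<^bsub>field_completion g\<^esub> \<Phi> W"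
      using \<Phi>_R[OF Cau_mult[OF f x(1) x'(1)] R_mult[OF x(1) x'(1) x(4) x'(4)]] x x' f g Rc
      by (simp add: completion_mult)
    show "\<Phi> (U \<oplus>\<^bsub>field_completion f\<^esub> W) = \<Phi> U \<oplus>\<^bsub>field_completion g\<^esub> \<Phi> W"
      using \<Phi>_R[OF Cau_add[OF f x(1) x'(1)] R_add[OF x(4) x'(4)]] x x' f g Rc
      by (simp add: completion_add)
  next
    show "\<Phi> \<one>\<^bsub>field_completion f\<^esub> = \<one>\<^bsub>field_completion g\<^esub>"
      using \<Phi>_R[OF _ R_one] f g by (simp add: completion_one)
  qed
  moreover have "completion_abs g (\<Phi> U) = completion_abs f U powr s"
    if U: "U \<in> carrier (field_completion f)" for U
  proof -
    obtain x l where x: "x \<in> Cau f" "U = seq_class f x" "\<Phi> U = seq_class g l" "R x l" using rep[OF U] by blast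
    then show ?thesis using R_abs[OF x(1,4)] f g Rc by (simp add: completion_abs_seq_class)
  qed
  ultimately show ?thesis by blast
qed

section \<open>Endomorphisms of a completion\<close>

lemma completion_hom_of_int:
  assumes f: "absolute_value f" and h: "h \<in> ring_hom (field_completion f) (field_completion f)"
  shows "h (seq_class f (\<lambda>_. of_int z)) = seq_class f (\<lambda>_. of_int z)"
proof -
  let ?F = "field_completion f" and ?c = "\<lambda>z. seq_class f (\<lambda>_. of_int z)"
  interpret F: field ?F by (rule completion_field[OF f])
  interpret h: ring_hom_ring ?F ?F h by (rule ring_hom_ringI2[OF F.ring_axioms F.ring_axioms h])
  have c: "?c z \<in> carrier ?F" for z using f by simp
  have one: "h (?c 1) = ?c 1" using h.hom_one by (simp add: completion_one f)
  have zero: "h (?c 0) = ?c 0" using h.hom_zero by (simp add: completion_zero)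
  have step: "?c (z + 1) = ?c z \<oplus>\<^bsub>?F\<^esub> ?c 1" "?c (z - 1) = ?c z \<ominus>\<^bsub>?F\<^esub> ?c 1" for z
    using f by (simp_all add: completion_add completion_diff)
  show ?thesis
  proof (induction z rule: int_induct[where k = 0])
    case base then show ?case by (rule zero)
  next
    case (step1 i) then show ?case unfolding step using c one f by simp
  next
    case (step2 i) then show ?case unfolding step using c one f by (simp add: a_minus_def)
  qed
qed

lemma common_denominator:
  fixes q :: "nat \<Rightarrow> rat"
  shows "\<exists>M>0. \<exists>z. \<forall>i<N. of_int (z i) = of_nat M * q i"
proof (induction N)
  case 0
  show ?case by (intro exI[of _ 1]) simp
next
  case (Suc N)
  then obtain M z where M: "M > 0" "\<forall>i<N. of_int (z i) = of_nat M * q i" by blast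
  obtain a c where ac: "quotient_of (q N) = (a, c)" by (cases "quotient_of (q N)")
  have c: "c > 0" "q N = of_int a / of_int c"
    using quotient_of_denom_pos[OF ac] quotient_of_div[OF ac] by auto
  have "of_int (if i = N then int M * a else z i * c) = of_nat (M * nat c) * q i" if "i < Suc N" for i
    using that M(2) c by (cases "i = N") (auto simp: less_Suc_eq)
  moreover have "M * nat c > 0" using M(1) c(1) by simp
  ultimately show ?case
    by (intro exI[of _ "M * nat c"] exI[of _ "\<lambda>i. if i = N then int M * a else z i * c"] conjI) simp_all
qed

text \<open>Integer coefficients are fixed by every endomorphism of the completion. They are listed
  from the leading one down, with nonzero head, as \<open>polynomial\<close> requires.\<close>

lemma int_relation:
  fixes b :: "'a::field_char_0"
  assumes "number_field TYPE('a)"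
  shows "\<exists>cs. cs \<noteq> [] \<and> hd cs \<noteq> (0::int) \<and> (\<Sum>i<length cs. of_int (cs ! i) * b ^ (length cs - Suc i)) = 0"
proof -
  obtain d where d: "dim_at_most TYPE('a) d" using number_field_dim[OF assms] .
  obtain q :: "nat \<Rightarrow> rat" where q: "\<exists>i\<in>{..d}. q i \<noteq> 0" "(\<Sum>i\<le>d. of_rat (q i) * b ^ i) = 0"
    using dim_at_most_dependent[OF d, of "{..d}" "\<lambda>i. b ^ i"] by auto
  obtain D z where D: "D > 0" and "\<forall>i<Suc d. of_int (z i) = of_nat D * q i"
    using common_denominator[of "Suc d" q] by blast
  then have z: "of_int (z i) = of_nat D * q i" if "i \<le> d" for i using that by simp
  define m where "m = Max {i. i \<le> d \<and> q i \<noteq> 0}"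
  have "m \<in> {i. i \<le> d \<and> q i \<noteq> 0}"
    unfolding m_def using q(1) by (intro Max_in) auto
  then have m: "m \<le> d" "q m \<noteq> 0" and mx: "\<And>i. i \<le> d \<Longrightarrow> q i \<noteq> 0 \<Longrightarrow> i \<le> m"
    by (auto simp: m_def)
  define cs where "cs = map (\<lambda>i. z (m - i)) [0..<Suc m]"
  have "(\<Sum>i<length cs. of_int (cs ! i) * b ^ (length cs - Suc i)) = (\<Sum>i<Suc m. of_int (z (m - i)) * b ^ (m - i))"
    by (simp add: cs_def del: upt_Suc sum.lessThan_Suc)
  also have "\<dots> = (\<Sum>i<Suc m. of_int (z i) * b ^ i)"
    using sum.nat_diff_reindex[of "\<lambda>i. of_int (z i) * b ^ i" "Suc m"] by simp
  also have "\<dots> = (\<Sum>i\<le>d. of_int (z i) * b ^ i)"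
  proof (rule sum.mono_neutral_left)
    show "\<forall>i\<in>{..d} - {..<Suc m}. of_int (z i) * b ^ i = 0"
    proof
      fix i assume i: "i \<in> {..d} - {..<Suc m}"
      then have "q i = 0" using mx[of i] by fastforce
      then have "z i = 0" using z[of i] i by auto
      then show "of_int (z i) * b ^ i = 0" by simp
    qed
  qed (use m in auto)
  also have "\<dots> = (\<Sum>i\<le>d. of_nat D * (of_rat (q i) * b ^ i))"
  proof (rule sum.cong)
    fix i assume "i \<in> {..d}"
    then have "(of_rat (of_int (z i)) :: 'a) = of_rat (of_nat D * q i)" using z[of i] by simp
    then show "of_int (z i) * b ^ i = of_nat D * (of_rat (q i) * b ^ i)" by (simp add: of_rat_mult)
  qed simp
  also have "\<dots> = 0" using q(2) by (simp flip: sum_distrib_left)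
  finally have "(\<Sum>i<length cs. of_int (cs ! i) * b ^ (length cs - Suc i)) = 0" .
  moreover have "hd cs = z m" by (simp add: cs_def upt_conv_Cons del: upt_Suc)
  moreover have "z m \<noteq> 0" using z[OF m(1)] m(2) D by auto
  ultimately show ?thesis by (intro exI[of _ cs]) (auto simp: cs_def)
qed

lemma completion_power:
  "absolute_value f \<Longrightarrow> x \<in> Cau f \<Longrightarrow> seq_class f x [^]\<^bsub>field_completion f\<^esub> (n::nat) = seq_class f (\<lambda>m. x m ^ n)"
proof (induction n)
  case 0
  interpret field "field_completion f" by (rule completion_field[OF 0(1)])
  show ?case using 0 by (simp add: completion_one)
next
  case (Suc n)
  interpret field "field_completion f" by (rule completion_field[OF Suc.prems(1)])
  show ?case using Suc by (simp add: completion_mult Cau_power mult.commute)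
qed

text \<open>The images of an algebraic number under the powers of an endomorphism of the completion are roots
  of one polynomial, so some power of the endomorphism fixes the number field, hence everything.\<close>

lemma completion_endo_periodic:
  fixes f :: "'a::field_char_0 \<Rightarrow> real"
  assumes K: "number_field TYPE('a)" and f: "absolute_value f"
    and h: "h \<in> ring_hom (field_completion f) (field_completion f)"
    and r: "r > 0" "\<And>U. U \<in> carrier (field_completion f) \<Longrightarrow> completion_abs f (h U) = completion_abs f U powr r"
  shows "\<exists>k>0. \<forall>U\<in>carrier (field_completion f). (h ^^ k) U = U"
proof -
  let ?F = "field_completion f" and ?c = "\<lambda>a::'a. seq_class f (\<lambda>_. a)"
  interpret F: field ?F by (rule completion_field[OF f])
  interpret h: ring_hom_ring ?F ?F h by (rule ring_hom_ringI2[OF F.ring_axioms F.ring_axioms h])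
  have c: "?c a \<in> carrier ?F" for a using f by simp
  have hk: "h ^^ k \<in> ring_hom ?F ?F" for k
  proof (induction k)
    case 0
    show ?case by (simp add: ring_hom_def)
  next
    case (Suc k)
    show ?case unfolding funpow.simps by (rule ring_hom_trans[OF Suc h])
  qed
  have hk_carrier: "(h ^^ k) U \<in> carrier ?F" if "U \<in> carrier ?F" for k U
    using ring_hom_closed[OF hk that] .
  have inj: "inj_on h (carrier ?F)"
  proof (rule inj_onI)
    fix U W assume UW: "U \<in> carrier ?F" "W \<in> carrier ?F" "h U = h W"
    then have "h (U \<ominus>\<^bsub>?F\<^esub> W) = \<zero>\<^bsub>?F\<^esub>" by (simp add: a_minus_def F.r_neg)
    then have "completion_abs f (U \<ominus>\<^bsub>?F\<^esub> W) powr r = 0"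
      using r(2)[of "U \<ominus>\<^bsub>?F\<^esub> W"] UW completion_abs_0_iff[OF f, of "\<zero>\<^bsub>?F\<^esub>"] by simp
    then have "U \<ominus>\<^bsub>?F\<^esub> W = \<zero>\<^bsub>?F\<^esub>" using UW completion_abs_0_iff[OF f] by simp
    then show "U = W" using UW by simp
  qed
  have inj_k: "inj_on (h ^^ k) (carrier ?F)" for k
  proof (induction k)
    case (Suc k)
    have "inj_on h ((h ^^ k) ` carrier ?F)"
      using hk_carrier inj by (intro inj_on_subset[OF inj]) auto
    then show ?case unfolding funpow.simps by (rule comp_inj_on[OF Suc])
  qed simp
  have orbit_finite: "finite (range (\<lambda>k. (h ^^ k) (?c b)))" for b
  proof -
    obtain cs where cs: "cs \<noteq> []" "hd cs \<noteq> (0::int)" "(\<Sum>i<length cs. of_int (cs ! i) * b ^ (length cs - Suc i)) = 0"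
      using int_relation[OF K] by blast
    define p where "p = map (\<lambda>z. ?c (of_int z)) cs"
    have p_carrier: "p \<in> carrier (poly_ring ?F)"
    proof -
      have "polynomial\<^bsub>?F\<^esub> (carrier ?F) p"
        unfolding polynomial_def p_def using cs c f
        by (auto simp: hd_map completion_zero seq_class_eq_iff Nul_iff LIMSEQ_const_iff)
      then show ?thesis by (simp add: univ_poly_carrier)
    qed
    have eval_map: "F.eval (map (\<lambda>z. ?c (of_int z)) zs) (?c b) =
        ?c (\<Sum>i<length zs. of_int (zs ! i) * b ^ (length zs - Suc i))" for zs
    proof (induction zs)
      case Nil
      show ?case by (simp add: completion_zero)
    next
      case (Cons z zs)
      have "(\<Sum>i<Suc (length zs). of_int ((z # zs) ! i) * b ^ (Suc (length zs) - Suc i)) =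
          of_int z * b ^ length zs + (\<Sum>i<length zs. of_int (zs ! i) * b ^ (length zs - Suc i))"
        by (subst sum.lessThan_Suc_shift) simp
      then show ?case using Cons f by (simp add: completion_power completion_mult completion_add del: sum.lessThan_Suc)
    qed
    have eval_h: "(h ^^ k) (F.eval (map (\<lambda>z. ?c (of_int z)) zs) U) = F.eval (map (\<lambda>z. ?c (of_int z)) zs) ((h ^^ k) U)"
      if U: "U \<in> carrier ?F" for k U zs
    proof (induction zs)
      case Nil
      interpret hk: ring_hom_ring ?F ?F "h ^^ k" by (rule ring_hom_ringI2[OF F.ring_axioms F.ring_axioms hk])
      show ?case by simp
    next
      case (Cons z zs)
      interpret hk: ring_hom_ring ?F ?F "h ^^ k" by (rule ring_hom_ringI2[OF F.ring_axioms F.ring_axioms hk])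
      have "set (map (\<lambda>z. ?c (of_int z)) zs) \<subseteq> carrier ?F" using c by auto
      then have "F.eval (map (\<lambda>z. ?c (of_int z)) zs) U \<in> carrier ?F" using U by (intro F.eval_in_carrier)
      moreover have "(h ^^ k) (U [^]\<^bsub>?F\<^esub> n) = (h ^^ k) U [^]\<^bsub>?F\<^esub> n" for n :: nat
        by (induction n) (use U in simp_all)
      ultimately show ?case using Cons U c completion_hom_of_int[OF f hk[of k]] by simp
    qed
    have "(h ^^ k) (?c b) \<in> {U. F.is_root p U}" for k
    proof -
      have "F.eval p (?c b) = \<zero>\<^bsub>?F\<^esub>" unfolding p_def eval_map using cs(3) by (simp add: completion_zero)
      then have "F.eval p ((h ^^ k) (?c b)) = (h ^^ k) \<zero>\<^bsub>?F\<^esub>" unfolding p_def using eval_h[OF c] by metis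
      also have "\<dots> = \<zero>\<^bsub>?F\<^esub>" using ring_hom_zero[OF hk F.ring_axioms F.ring_axioms] .
      finally show ?thesis using hk_carrier[OF c] cs(1) by (simp add: F.is_root_def p_def)
    qed
    then show ?thesis
      using F.finite_number_of_roots[OF p_carrier] by (meson finite_subset image_subsetI)
  qed
  obtain B :: "'a set" where B: "finite B" "rat_vs.span B = UNIV"
    using K by (auto simp: number_field_def)
  \<comment> \<open>The orbits of all elements of \<open>B\<close> are tracked at once, so that one
    repetition gives a period common to all of them.\<close>
  have "finite ((\<lambda>k. \<lambda>b\<in>B. (h ^^ k) (?c b)) ` UNIV)"
  proof (rule finite_subset)
    show "(\<lambda>k. \<lambda>b\<in>B. (h ^^ k) (?c b)) ` UNIV \<subseteq> (\<Pi>\<^sub>E b\<in>B. range (\<lambda>k. (h ^^ k) (?c b)))" by auto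
    show "finite (\<Pi>\<^sub>E b\<in>B. range (\<lambda>k. (h ^^ k) (?c b)))" using B(1) orbit_finite by (intro finite_PiE) auto
  qed
  then have "\<not> inj (\<lambda>k. \<lambda>b\<in>B. (h ^^ k) (?c b))" using finite_imageD infinite_UNIV_nat by blast
  then obtain i j where ij: "i < j" "(\<lambda>b\<in>B. (h ^^ i) (?c b)) = (\<lambda>b\<in>B. (h ^^ j) (?c b))"
    by (metis (mono_tags, lifting) injI linorder_neqE_nat)
  define k where "k = j - i"
  have k: "k > 0" using ij by (simp add: k_def)
  interpret hk: ring_hom_ring ?F ?F "h ^^ k" by (rule ring_hom_ringI2[OF F.ring_axioms F.ring_axioms hk])
  have fixB: "(h ^^ k) (?c b) = ?c b" if "b \<in> B" for b
  proof -
    have "(h ^^ i) (?c b) = (h ^^ j) (?c b)" using fun_cong[OF ij(2), of b] that by simp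
    also have "\<dots> = (h ^^ i) ((h ^^ k) (?c b))" using ij(1) by (simp add: k_def flip: funpow_add comp_apply[of "h ^^ i"])
    finally show ?thesis using inj_onD[OF inj_k] hk_carrier[OF c] c by metis
  qed
  have fix_mult: "(h ^^ k) (?c (a * b)) = ?c (a * b)" if "(h ^^ k) (?c a) = ?c a" "(h ^^ k) (?c b) = ?c b" for a b
    using hk.hom_mult[OF c c, of a b] that f by (simp add: completion_mult)
  have fix_add: "(h ^^ k) (?c (a + b)) = ?c (a + b)" if "(h ^^ k) (?c a) = ?c a" "(h ^^ k) (?c b) = ?c b" for a b
    using hk.hom_add[OF c c, of a b] that f by (simp add: completion_add)
  have fix_int: "(h ^^ k) (?c (of_int z)) = ?c (of_int z)" for z by (rule completion_hom_of_int[OF f hk])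
  have fix_rat: "(h ^^ k) (?c (of_rat q)) = ?c (of_rat q)" for q
  proof -
    obtain a b where ab: "b > 0" "of_rat q = (of_int a / of_int b :: 'a)" by (rule of_rat_quotient)
    have eq: "?c (of_int b) \<otimes>\<^bsub>?F\<^esub> ?c (of_rat q) = ?c (of_int a)" using ab f by (simp add: completion_mult)
    have "?c (of_int b) \<otimes>\<^bsub>?F\<^esub> (h ^^ k) (?c (of_rat q)) = ?c (of_int b) \<otimes>\<^bsub>?F\<^esub> ?c (of_rat q)"
      using hk.hom_mult[OF c c, of "of_int b" "of_rat q"] unfolding eq fix_int by simp
    moreover have "?c (of_int b) \<noteq> \<zero>\<^bsub>?F\<^esub>"
      using ab(1) f by (simp add: completion_zero seq_class_eq_iff Nul_iff LIMSEQ_const_iff)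
    ultimately show ?thesis using F.m_lcancel[OF _ c hk_carrier[OF c] c] by blast
  qed
  have fixK: "(h ^^ k) (?c a) = ?c a" for a
  proof -
    have "a \<in> rat_vs.span B" using B(2) by simp
    then show ?thesis
    proof (induction rule: rat_vs.span_induct_alt)
      case base
      show ?case using fix_int[of 0] by simp
    next
      case (step q x y)
      then show ?case using fix_add[OF fix_mult[OF fix_rat fixB[OF step(1)]]] by blast
    qed
  qed
  \<comment> \<open>Powers of \<open>h\<close> also scale absolute values by a positive exponent,
    hence are continuous.\<close>
  have abs_k: "\<exists>t>0. \<forall>U\<in>carrier ?F. completion_abs f ((h ^^ n) U) = completion_abs f U powr t" for n
  proof (induction n)
    case 0
    show ?case using completion_abs_nonneg[OF f] by (intro exI[of _ 1]) auto
  next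
    case (Suc n)
    then obtain t where "t > 0" "\<forall>U\<in>carrier ?F. completion_abs f ((h ^^ n) U) = completion_abs f U powr t" by blast
    then show ?case using r hk_carrier by (intro exI[of _ "t * r"]) (simp add: powr_powr)
  qed
  obtain t where t: "t > 0" "\<And>U. U \<in> carrier ?F \<Longrightarrow> completion_abs f ((h ^^ k) U) = completion_abs f U powr t"
    using abs_k[of k] by blast
  have "(h ^^ k) U = U" if U: "U \<in> carrier ?F" for U
  proof -
    let ?D = "completion_abs f ((h ^^ k) U \<ominus>\<^bsub>?F\<^esub> U)"
    have hU: "(h ^^ k) U \<in> carrier ?F" using hk_carrier[OF U] .
    have D0: "?D \<ge> 0" using U hU f by (intro completion_abs_nonneg) auto
    \<comment> \<open>An element \<open>a\<close> of the number field within \<open>e\<close> of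
      \<open>U\<close> is fixed by \<open>h ^^ k\<close>, so it is close to both \<open>U\<close>
      and its image; the summands are the two distances.\<close>
    have "?D \<le> e powr t + e" if e: "e > 0" for e
    proof -
      obtain a where a: "completion_abs f (U \<ominus>\<^bsub>?F\<^esub> ?c a) < e" using completion_dense[OF f U e] by blast
      let ?V = "U \<ominus>\<^bsub>?F\<^esub> ?c a"
      have V: "?V \<in> carrier ?F" using U c by simp
      have hV: "(h ^^ k) ?V = (h ^^ k) U \<ominus>\<^bsub>?F\<^esub> ?c a" using U c fixK by (simp add: a_minus_def)
      have eq: "(h ^^ k) U \<ominus>\<^bsub>?F\<^esub> U = (h ^^ k) ?V \<oplus>\<^bsub>?F\<^esub> (\<ominus>\<^bsub>?F\<^esub> ?V)"
      proof -
        have "?c a \<oplus>\<^bsub>?F\<^esub> (\<ominus>\<^bsub>?F\<^esub> U \<oplus>\<^bsub>?F\<^esub> \<ominus>\<^bsub>?F\<^esub> ?c a) = \<ominus>\<^bsub>?F\<^esub> U"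
          using F.a_lcomm[of "?c a" "\<ominus>\<^bsub>?F\<^esub> U" "\<ominus>\<^bsub>?F\<^esub> ?c a"] U c[of a] by (simp add: F.r_neg)
        then show ?thesis
          unfolding hV using U hU c[of a] by (simp add: a_minus_def F.minus_add F.a_ac)
      qed
      have absm: "completion_abs f (\<ominus>\<^bsub>?F\<^esub> ?V) = completion_abs f ?V"
        using completion_carrierE[OF f V] f by (metis Cau_minus completion_abs_seq_class completion_minus seq_abs_minus)
      have "?D \<le> completion_abs f ((h ^^ k) ?V) + completion_abs f ?V"
        unfolding eq using completion_abs_triangle[OF f hk_carrier[OF V] F.a_inv_closed[OF V]] absm by simp
      also have "\<dots> \<le> e powr t + e"
        using t(2)[OF V] a t(1) completion_abs_nonneg[OF f V] by (intro add_mono) (auto intro: powr_mono2)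
      finally show ?thesis .
    qed
    then have "\<forall>\<^sub>F e in at_right 0. ?D \<le> e powr t + e" by (auto simp: eventually_at_filter)
    moreover have "((\<lambda>e. e powr t + e) \<longlongrightarrow> 0 powr t + 0) (at_right 0)"
      using t(1) by (intro tendsto_add tendsto_powr' tendsto_ident_at tendsto_const) (auto simp: eventually_at_filter)
    ultimately have "?D \<le> 0" using t(1) by (intro tendsto_lowerbound[of "\<lambda>e. e powr t + e" 0 "at_right 0"]) auto
    then have "(h ^^ k) U \<ominus>\<^bsub>?F\<^esub> U = \<zero>\<^bsub>?F\<^esub>"
      using D0 U hU completion_abs_0_iff[OF f, of "(h ^^ k) U \<ominus>\<^bsub>?F\<^esub> U"] by simp
    then show ?thesis using U hU by simp
  qed
  then show ?thesis using k by blast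
qed

text \<open>Scaling of absolute values makes \<open>h\<close> injective. Some positive power of
  \<open>h \<circ> k\<close> is the identity, so every element is an image under
  \<open>h\<close>.\<close>

lemma completions_isomorphic:
  fixes f :: "'a::field \<Rightarrow> real" and g :: "'b::field_char_0 \<Rightarrow> real"
  assumes L: "number_field TYPE('b)" and f: "absolute_value f" and g: "absolute_value g"
    and h: "h \<in> ring_hom (field_completion f) (field_completion g)"
      "s > 0" "\<And>U. U \<in> carrier (field_completion f) \<Longrightarrow> completion_abs g (h U) = completion_abs f U powr s"
    and k: "k \<in> ring_hom (field_completion g) (field_completion f)"
      "t > 0" "\<And>U. U \<in> carrier (field_completion g) \<Longrightarrow> completion_abs f (k U) = completion_abs g U powr t"
  shows "h \<in> ring_iso (field_completion f) (field_completion g)"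
proof -
  let ?F = "field_completion f" and ?G = "field_completion g"
  interpret F: field ?F by (rule completion_field[OF f])
  interpret G: field ?G by (rule completion_field[OF g])
  interpret h: ring_hom_ring ?F ?G h by (rule ring_hom_ringI2[OF F.ring_axioms G.ring_axioms h(1)])
  interpret k: ring_hom_ring ?G ?F k by (rule ring_hom_ringI2[OF G.ring_axioms F.ring_axioms k(1)])
  have hk: "h \<circ> k \<in> ring_hom ?G ?G" using ring_hom_trans[OF k(1) h(1)] .
  have "\<exists>n>0. \<forall>U\<in>carrier ?G. ((h \<circ> k) ^^ n) U = U"
  proof (rule completion_endo_periodic[OF L g hk])
    show "t * s > 0" using h(2) k(2) by simp
    show "completion_abs g ((h \<circ> k) U) = completion_abs g U powr (t * s)" if "U \<in> carrier ?G" for U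
      using that h(3) k(3) by (simp add: powr_powr)
  qed
  then obtain n where n: "n > 0" "\<And>U. U \<in> carrier ?G \<Longrightarrow> ((h \<circ> k) ^^ n) U = U" by blast
  have closed: "((h \<circ> k) ^^ m) U \<in> carrier ?G" if "U \<in> carrier ?G" for U m
    using that by (induction m) auto
  have "bij_betw h (carrier ?F) (carrier ?G)"
  proof (rule bij_betw_imageI)
    show "inj_on h (carrier ?F)"
    proof (rule inj_onI)
      fix U W assume UW: "U \<in> carrier ?F" "W \<in> carrier ?F" "h U = h W"
      then have "h (U \<ominus>\<^bsub>?F\<^esub> W) = \<zero>\<^bsub>?G\<^esub>" by (simp add: a_minus_def G.r_neg)
      then have "completion_abs f (U \<ominus>\<^bsub>?F\<^esub> W) powr s = 0"
        using h(3)[of "U \<ominus>\<^bsub>?F\<^esub> W"] UW completion_abs_0_iff[OF g, of "\<zero>\<^bsub>?G\<^esub>"] by simp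
      then have "U \<ominus>\<^bsub>?F\<^esub> W = \<zero>\<^bsub>?F\<^esub>" using UW completion_abs_0_iff[OF f] by simp
      then show "U = W" using UW by simp
    qed
    show "h ` carrier ?F = carrier ?G"
    proof (intro equalityI subsetI)
      fix U assume U: "U \<in> carrier ?G"
      obtain m where m: "n = Suc m" using n(1) gr0_implies_Suc by blast
      have "U = h (k (((h \<circ> k) ^^ m) U))" using n(2)[OF U] by (simp add: m)
      then show "U \<in> h ` carrier ?F" using closed[OF U, of m] by (metis imageI k.hom_closed)
    qed auto
  qed
  then show ?thesis using h(1) by (simp add: ring_iso_def)
qed

section \<open>Embeddings of number fields in completions\<close>

text \<open>A basis indexed by an initial segment of \<nat>, so that its indices can serve as
  variables of a formula, with coordinates as linear functions.\<close>

lemma number_field_basis: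
  assumes "number_field TYPE('a::field_char_0)"
  shows "\<exists>(N::nat) (b :: nat \<Rightarrow> 'a) (c :: 'a \<Rightarrow> nat \<Rightarrow> rat).
    (\<forall>x. x = (\<Sum>i<N. of_rat (c x i) * b i)) \<and>
    (\<forall>x y i. c (x + y) i = c x i + c y i) \<and>
    (\<forall>q x i. c (of_rat q * x) i = q * c x i) \<and>
    (\<forall>i<N. \<forall>j<N. c (b i) j = (if i = j then 1 else 0))"
proof -
  obtain B0 :: "'a set" where B0: "finite B0" "rat_vs.span B0 = UNIV"
    using assms by (auto simp: number_field_def)
  obtain B where B: "B \<subseteq> B0" "rat_vs.independent B" "B0 \<subseteq> rat_vs.span B"
    using rat_vs.maximal_independent_subset[of B0] by blast
  have fin: "finite B" using B(1) B0(1) finite_subset by blast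
  have span: "rat_vs.span B = UNIV"
    using rat_vs.span_mono[OF B(3)] B0(2) by (simp add: rat_vs.span_span top.extremum_unique)
  obtain b where b: "bij_betw b {..<card B} B"
    using ex_bij_betw_nat_finite[OF fin] by (auto simp: atLeast0LessThan)
  define c where "c x i = rat_vs.representation B x (b i)" for x i
  show ?thesis
  proof (intro exI[of _ "card B"] exI[of _ b] exI[of _ c] conjI allI impI)
    show "x = (\<Sum>i<card B. of_rat (c x i) * b i)" for x
    proof -
      have "(\<Sum>i<card B. of_rat (c x i) * b i) = (\<Sum>y\<in>B. of_rat (rat_vs.representation B x y) * y)"
        unfolding c_def by (rule sum.reindex_bij_betw[OF b])
      also have "\<dots> = x" using B(2) span fin by (intro rat_vs.sum_representation_eq) auto
      finally show ?thesis by simp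
    qed
    show "c (x + y) i = c x i + c y i" for x y i
      unfolding c_def using B(2) span by (subst rat_vs.representation_add) auto
    show "c (of_rat q * x) i = q * c x i" for q x i
      unfolding c_def using B(2) span by (subst rat_vs.representation_scale) auto
    show "c (b i) j = (if i = j then 1 else 0)" if "i < card B" "j < card B" for i j
    proof -
      have "b i \<in> B" "b j = b i \<longleftrightarrow> i = j" using b that by (auto simp: bij_betw_def inj_on_def)
      then show ?thesis unfolding c_def using B(2) by (simp add: rat_vs.representation_basis)
    qed
  qed
qed

text \<open>The sentence asserts the existence of images for the elements of a basis of \<open>'a\<close> that respect the
  multiplication table.\<close>

lemma embedding_sentence:
  fixes a :: "'a::field_char_0"
  assumes K: "number_field TYPE('a)"
  shows "\<exists>q. sentence q \<and>
    (\<forall>f :: 'a \<Rightarrow> real. absolute_value f \<longrightarrow> root_test f p l (\<lambda>_. a) \<longrightarrow> holds_in (field_completion f) q) \<and>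
    (\<forall>g :: 'b::field_char_0 \<Rightarrow> real. absolute_value g \<longrightarrow> holds_in (field_completion g) q \<longrightarrow>
      (\<exists>\<phi>. (\<forall>x. \<phi> x \<in> Cau g) \<and> (\<forall>x y n. \<phi> (x + y) n = \<phi> x n + \<phi> y n) \<and>
        (\<forall>q x n. \<phi> (of_rat q * x) n = of_rat q * \<phi> x n) \<and>
        (\<forall>x y. (\<lambda>n. \<phi> (x * y) n - \<phi> x n * \<phi> y n) \<in> Nul g) \<and> (\<lambda>n. \<phi> 1 n - 1) \<in> Nul g \<and>
        (\<exists>z\<in>Cau g. (\<lambda>n. z n - \<phi> a n) \<in> Nul g \<and> root_test g p l z)))"
proof -
  obtain N :: nat and b :: "nat \<Rightarrow> 'a" and c where basis:
    "(\<forall>x. x = (\<Sum>i<N. of_rat (c x i) * b i)) \<and>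
     (\<forall>x y i. c (x + y) i = c x i + c y i) \<and>
     (\<forall>q x i. c (of_rat q * x) i = q * c x i) \<and>
     (\<forall>i<N. \<forall>j<N. c (b i) j = (if i = j then 1 else 0))"
    using number_field_basis[OF K] by (elim exE)
  then have c_sum: "\<And>x. x = (\<Sum>i<N. of_rat (c x i) * b i)"
    and c_add: "\<And>x y i. c (x + y) i = c x i + c y i"
    and c_scale: "\<And>q x i. c (of_rat q * x) i = q * c x i"
    and c_basis: "\<And>i j. i < N \<Longrightarrow> j < N \<Longrightarrow> c (b i) j = (if i = j then 1 else 0)"
    by (elim conjE; iprover)+
  \<comment> \<open>Terms have only integer coefficients, so the denominators of the coordinates are
    cleared, separately for each \<open>x\<close>.\<close>
  have "\<exists>M z. M > 0 \<and> (\<forall>i<N. of_int (z i) = of_nat M * c x i)" for x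
    using common_denominator[of N "c x"] by blast
  then obtain M z where M: "\<And>x. M x > (0::nat)" and z: "\<And>x i. i < N \<Longrightarrow> of_int (z x i) = of_nat (M x) * c x i"
    by metis
  have lin: "(\<Sum>i<N. of_int (z x i) * y i) = of_nat (M x) * (\<Sum>i<N. of_rat (c x i) * y i)"
    for x and y :: "nat \<Rightarrow> 'c::field_char_0"
  proof -
    have "of_int (z x i) = (of_nat (M x) * of_rat (c x i) :: 'c)" if "i < N" for i
    proof -
      have "(of_int (z x i) :: 'c) = of_rat (of_int (z x i))" by simp
      also have "\<dots> = of_rat (of_nat (M x) * c x i)" using z[OF that] by simp
      finally show ?thesis by (simp add: of_rat_mult)
    qed
    then show ?thesis by (simp add: sum_distrib_left mult.assoc)
  qed
  \<comment> \<open>When the variables below \<open>N\<close> hold the images of the basis, this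
    makes \<open>t\<close> the image of \<open>x\<close>.\<close>
  define eq where "eq x t = Equal (Times (nat_term (M x)) t)
    (sum_term (map (\<lambda>i. Times (int_term (z x i)) (Var i)) [0..<N]))" for x t
  \<comment> \<open>Variable \<open>N\<close> holds the image of \<open>a\<close>, on which the root
    test is imposed; \<open>Suc N\<close> is bound inside the root test.\<close>
  define body where "body = Conjs (eq 1 One # eq a (Var N) # root_formula p l (Var N) (Suc N) #
    map (\<lambda>(i, j). eq (b i * b j) (Times (Var i) (Var j))) (List.product [0..<N] [0..<N]))"
  have sat_eq: "sat g e (eq x t) \<longleftrightarrow>
      (\<lambda>n. of_nat (M x) * (term_at (\<lambda>i. e i n) t - (\<Sum>i<N. of_rat (c x i) * e i n))) \<in> Nul g"
    for x t e and g :: "'c::field_char_0 \<Rightarrow> real"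
    by (simp add: eq_def interv_sum_list_conv_sum_set_nat lin right_diff_distrib comp_def atLeast0LessThan)
  have sat_body: "sat g e body \<longleftrightarrow> sat g e (eq 1 One) \<and> sat g e (eq a (Var N)) \<and> root_test g p l (e N) \<and>
      (\<forall>i<N. \<forall>j<N. sat g e (eq (b i * b j) (Times (Var i) (Var j))))"
    if "absolute_value g" for e and g :: "'c::field_char_0 \<Rightarrow> real"
    using that by (auto simp: body_def sat_root_formula)
  have vars: "free_vars body \<subseteq> {..<Suc (Suc N)}"
    using free_vars_root_formula[of p l "Var N" "Suc N"] by (auto simp: body_def eq_def)
  have scale: "(\<lambda>n. x n) \<in> Nul g" if "absolute_value g" "(\<lambda>n. of_nat (M y) * x n) \<in> Nul g"
    for x y and g :: "'c::field_char_0 \<Rightarrow> real"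
    using Nul_mult[OF that(1) Cau_const[OF that(1), of "1 / of_nat (M y)"] that(2)] M[of y] by simp
  have "holds_in (field_completion f) (exs (Suc (Suc N)) body)"
    if f: "absolute_value f" and r: "root_test f p l (\<lambda>_. a)" for f :: "'a \<Rightarrow> real"
  proof -
    define e where "e i = (\<lambda>_::nat. if i < N then b i else if i = N then a else 0)" for i
    have es: "(\<Sum>i<N. of_rat (c x i) * e i n) = x" for x n
      using c_sum[of x] by (simp add: e_def)
    have "sat f e body"
      unfolding sat_body[OF f] sat_eq es using r f by (simp add: e_def)
    moreover have "e i \<in> Cau f" for i using f by (simp add: e_def)
    ultimately show ?thesis using holds_in_completion_exs[OF f vars] by blast
  qed
  moreover have "\<exists>\<phi>. (\<forall>x. \<phi> x \<in> Cau g) \<and> (\<forall>x y n. \<phi> (x + y) n = \<phi> x n + \<phi> y n) \<and>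
        (\<forall>q x n. \<phi> (of_rat q * x) n = of_rat q * \<phi> x n) \<and>
        (\<forall>x y. (\<lambda>n. \<phi> (x * y) n - \<phi> x n * \<phi> y n) \<in> Nul g) \<and> (\<lambda>n. \<phi> 1 n - 1) \<in> Nul g \<and>
        (\<exists>z\<in>Cau g. (\<lambda>n. z n - \<phi> a n) \<in> Nul g \<and> root_test g p l z)"
    if g: "absolute_value g" and h: "holds_in (field_completion g) (exs (Suc (Suc N)) body)" for g :: "'b \<Rightarrow> real"
  proof -
    obtain e where e: "\<And>i. e i \<in> Cau g" "sat g e body" using h holds_in_completion_exs[OF g vars] by blast
    \<comment> \<open>Linear extension, entry by entry: it is exactly additive, but multiplicative
      only up to null sequences.\<close>
    define \<phi> where "\<phi> x n = (\<Sum>i<N. of_rat (c x i) * e i n)" for x n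
    note sat = e(2)[unfolded sat_body[OF g] sat_eq, folded \<phi>_def]
    have sat_one: "(\<lambda>n. of_nat (M 1) * (1 - \<phi> 1 n)) \<in> Nul g"
      and sat_a: "(\<lambda>n. of_nat (M a) * (e N n - \<phi> a n)) \<in> Nul g" and sat_root: "root_test g p l (e N)"
      using sat by simp_all
    have sat_mult: "(\<lambda>n. of_nat (M (b i * b j)) * (e i n * e j n - \<phi> (b i * b j) n)) \<in> Nul g"
      if "i < N" "j < N" for i j
      using sat that by simp
    have \<phi>_Cau: "\<phi> x \<in> Cau g" for x
    proof -
      have "(\<lambda>n. \<Sum>i<N. of_rat (c x i) * e i n) \<in> Cau g"
        using g e(1) by (intro Cau_sum Cau_mult) auto
      then show ?thesis by (simp add: \<phi>_def[abs_def])
    qed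
    have \<phi>_add: "\<phi> (x + y) n = \<phi> x n + \<phi> y n" for x y n
      by (simp add: \<phi>_def c_add of_rat_add distrib_right sum.distrib)
    have \<phi>_scale: "\<phi> (of_rat q * x) n = of_rat q * \<phi> x n" for q x n
      unfolding \<phi>_def c_scale of_rat_mult sum_distrib_left by (simp only: mult.assoc)
    have \<phi>_basis: "\<phi> (b i) n = e i n" if "i < N" for i n
    proof -
      have "\<phi> (b i) n = (\<Sum>j<N. if j = i then e i n else 0)"
        unfolding \<phi>_def using c_basis[OF that] by (intro sum.cong) auto
      then show ?thesis using that by simp
    qed
    have \<phi>_sum: "\<phi> (\<Sum>i\<in>I. x i) n = (\<Sum>i\<in>I. \<phi> (x i) n)" if "finite I" for I :: "nat set" and x n
      using that
    proof (induction I rule: finite_induct)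
      case empty
      show ?case using \<phi>_scale[of 0 0 n] by simp
    qed (simp add: \<phi>_add)
    have basis_mult: "(\<lambda>n. \<phi> (b i * b j) n - \<phi> (b i) n * \<phi> (b j) n) \<in> Nul g" if "i < N" "j < N" for i j
    proof -
      have "(\<lambda>n. e i n * e j n - \<phi> (b i * b j) n) \<in> Nul g"
        by (rule scale[OF g sat_mult[OF that]])
      from Nul_minus[OF g this] show ?thesis using that by (simp add: \<phi>_basis)
    qed
    have \<phi>_mult: "(\<lambda>n. \<phi> (x * y) n - \<phi> x n * \<phi> y n) \<in> Nul g" for x y
    proof -
      have "x * y = (\<Sum>i<N. of_rat (c x i) * b i) * (\<Sum>j<N. of_rat (c y j) * b j)"
        using c_sum[of x, symmetric] c_sum[of y, symmetric] by simp
      also have "\<dots> = (\<Sum>i<N. \<Sum>j<N. of_rat (c x i) * (of_rat (c y j) * (b i * b j)))"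
        unfolding sum_product by (intro sum.cong refl) (simp add: algebra_simps)
      finally have "\<phi> (x * y) n = (\<Sum>i<N. \<Sum>j<N. of_rat (c x i) * (of_rat (c y j) * \<phi> (b i * b j) n))" for n
        by (simp add: \<phi>_sum \<phi>_scale)
      moreover have "\<phi> x n * \<phi> y n = (\<Sum>i<N. \<Sum>j<N. of_rat (c x i) * (of_rat (c y j) * (\<phi> (b i) n * \<phi> (b j) n)))" for n
        unfolding \<phi>_def[of x] \<phi>_def[of y] sum_product
        by (intro sum.cong refl) (simp add: \<phi>_basis algebra_simps)
      ultimately have "(\<lambda>n. \<phi> (x * y) n - \<phi> x n * \<phi> y n) =
          (\<lambda>n. \<Sum>i<N. \<Sum>j<N. of_rat (c x i) * (of_rat (c y j) * (\<phi> (b i * b j) n - \<phi> (b i) n * \<phi> (b j) n)))"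
        by (simp add: right_diff_distrib sum_subtractf)
      also have "\<dots> \<in> Nul g"
        using g basis_mult by (intro Nul_sum Nul_mult) auto
      finally show ?thesis .
    qed
    have "(\<lambda>n. 1 - \<phi> 1 n) \<in> Nul g" by (rule scale[OF g sat_one])
    from Nul_minus[OF g this] have \<phi>_one: "(\<lambda>n. \<phi> 1 n - 1) \<in> Nul g" by simp
    have "(\<lambda>n. e N n - \<phi> a n) \<in> Nul g" by (rule scale[OF g sat_a])
    then have \<phi>_a: "\<exists>z\<in>Cau g. (\<lambda>n. z n - \<phi> a n) \<in> Nul g \<and> root_test g p l z"
      using sat_root e(1)[of N] by (intro bexI[of _ "e N"]) auto
    show ?thesis
      using \<phi>_Cau \<phi>_add \<phi>_scale \<phi>_mult \<phi>_one \<phi>_a by (intro exI[of _ \<phi>]) blast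
  qed
  ultimately show ?thesis using sentence_exs[OF vars] by blast
qed

section \<open>The place induced by an embedding\<close>

lemma lies_over_equivalent:
  assumes "lies_over p f" "(g, f) \<in> equivalent_absolute_values"
  shows "lies_over p g"
proof -
  obtain s where s: "s > 0" "\<And>x. f x = g x powr s" and g: "absolute_value g"
    using assms(2) by (auto simp: equivalent_absolute_values_def dest: nontrivial_av)
  have mono: "g x < g y \<Longrightarrow> f x < f y" for x y
    using s g by (simp add: powr_less_mono2)
  have "nonarchimedean g"
    unfolding nonarchimedean_def
  proof (intro allI, rule ccontr)
    fix x y assume "\<not> g (x + y) \<le> max (g x) (g y)"
    then have "f x < f (x + y)" "f y < f (x + y)" using mono by auto
    moreover have "f (x + y) \<le> max (f x) (f y)"
      using assms(1) by (simp add: lies_over_def nonarchimedean_def)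
    ultimately show False by simp
  qed
  moreover have "g (of_nat p) < 1"
  proof (rule ccontr)
    assume "\<not> ?thesis"
    then have "f (of_nat p) \<ge> 1" using s by (simp add: ge_one_powr_ge_zero)
    then show False using assms(1) by (simp add: lies_over_def)
  qed
  ultimately show ?thesis using assms(1) g by (simp add: lies_over_def)
qed

text \<open>Separation among the finitely many places over \<open>p\<close> gives an element large
  at \<open>v\<close> and small at the others, and its inverse is the element sought. Integrality of
  that element later identifies the place induced by an embedding.\<close>

lemma exists_separating_integer:
  assumes K: "number_field TYPE('a::field_char_0)" and v: "v \<in> places" "lies_over p (place_abs v)"
  shows "\<exists>a::'a. place_abs v a \<le> 1 \<and> (\<forall>u\<in>places. lies_over p (place_abs u) \<and> place_abs u a \<le> 1 \<longrightarrow> u = v)"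
proof -
  let ?G = "place_abs ` ({u \<in> places. lies_over p (place_abs u)} - {v})"
  have "\<exists>a. place_abs v a > 1 \<and> (\<forall>g\<in>?G. g a < 1)"
  proof (rule av_separate)
    show "finite ?G" using finite_places_over[OF K, of p] by simp
    show "(place_abs v, g) \<notin> equivalent_absolute_values" if "g \<in> ?G" for g
      using that place_abs_equivalent_imp_eq[OF v(1)] by auto
  qed (use v place_abs_nontrivial in auto)
  then obtain a where a: "place_abs v a > 1" "\<And>g. g \<in> ?G \<Longrightarrow> g a < 1" by blast
  have "a \<noteq> 0" using a(1) v by auto
  show ?thesis
  proof (intro exI[of _ "inverse a"] conjI ballI impI)
    show "place_abs v (inverse a) \<le> 1"
      using a(1) v by (simp add: av_inverse inverse_le_1_iff)
    fix u :: "('a \<Rightarrow> real) set" assume u: "u \<in> places" "lies_over p (place_abs u) \<and> place_abs u (inverse a) \<le> 1"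
    show "u = v"
    proof (rule ccontr)
      assume "u \<noteq> v"
      then have "place_abs u a < 1" using a(2) u by auto
      moreover have "place_abs u a > 0" using \<open>a \<noteq> 0\<close> u by simp
      ultimately have "inverse (place_abs u a) > 1" by (simp add: one_less_inverse)
      then show False using u by (simp add: av_inverse)
    qed
  qed
qed

text \<open>Pulling \<open>g\<close> back along the embedding \<open>\<phi>\<close> gives an
  absolute value \<open>G\<close> over \<open>p\<close>, hence a place \<open>u\<close>. The root
  test on the image of \<open>a\<close> yields \<open>G a \<le> 1\<close>, which forces
  \<open>u = v\<close>; so \<open>\<phi>\<close> scales absolute values and extends to the
  completion.\<close>

lemma nonarch_embedding:
  fixes v :: "('a::field_char_0 \<Rightarrow> real) set" and g :: "'b::field_char_0 \<Rightarrow> real"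
  assumes K: "number_field TYPE('a)" and L: "number_field TYPE('b)"
    and v: "v \<in> places" "lies_over p (place_abs v)" and g: "lies_over p g"
    and transfer: "\<And>q. sentence q \<Longrightarrow> holds_in (completion_at v) q \<Longrightarrow> holds_in (field_completion g) q"
  shows "\<exists>h \<in> ring_hom (completion_at v) (field_completion g). \<exists>s>0.
    \<forall>U\<in>carrier (completion_at v). completion_abs g (h U) = completion_abs (place_abs v) U powr s"
proof -
  let ?f = "place_abs v"
  have f: "absolute_value ?f" "nonarchimedean ?f" using v(2) by (auto simp: lies_over_def)
  have g': "absolute_value g" "nonarchimedean g" "prime p" "g (of_nat p) < 1" using g by (auto simp: lies_over_def)
  obtain d where d: "dim_at_most TYPE('a) d" using number_field_dim[OF K] .
  obtain d' where d': "dim_at_most TYPE('b) d'" using number_field_dim[OF L] .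
  \<comment> \<open>Above both degrees and different from \<open>p\<close>, so that the root test
    means integrality in both completions.\<close>
  obtain l where l: "prime l" "l > d + d' + p" using bigger_prime by blast
  obtain a :: 'a where a: "?f a \<le> 1" "\<And>u. u \<in> places \<Longrightarrow> lies_over p (place_abs u) \<Longrightarrow> place_abs u a \<le> 1 \<Longrightarrow> u = v"
    using exists_separating_integer[OF K v] by blast
  have "root_test ?f p l (\<lambda>_. a)"
    using root_test_iff[OF d _ v(2) l(1), of "\<lambda>_. a"] l(2) a(1) f by simp
  then obtain \<phi> where \<phi>: "\<And>x. \<phi> x \<in> Cau g" "\<And>x y n. \<phi> (x + y) n = \<phi> x n + \<phi> y n"
    "\<And>q x n. \<phi> (of_rat q * x) n = of_rat q * \<phi> x n"
    "\<And>x y. (\<lambda>n. \<phi> (x * y) n - \<phi> x n * \<phi> y n) \<in> Nul g" "(\<lambda>n. \<phi> 1 n - 1) \<in> Nul g"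
    and "\<exists>z\<in>Cau g. (\<lambda>n. z n - \<phi> a n) \<in> Nul g \<and> root_test g p l z"
    using embedding_sentence[where 'b = 'b, OF K, of p l a] transfer f(1) g'(1) by blast
  then obtain z where z: "z \<in> Cau g" "(\<lambda>n. z n - \<phi> a n) \<in> Nul g" "root_test g p l z" by blast
  define G where "G x = seq_abs g (\<phi> x)" for x
  have G_rat: "G (of_rat q) = g (of_rat q)" for q
  proof -
    have "\<phi> (of_rat q) n - of_rat q = of_rat q * (\<phi> 1 n - 1)" for n
      using \<phi>(3)[of q 1 n] by (simp add: algebra_simps)
    then have "(\<lambda>n. \<phi> (of_rat q) n - of_rat q) \<in> Nul g"
      using Nul_mult[OF g'(1) Cau_const[OF g'(1), of "of_rat q"] \<phi>(5)] by simp
    from seq_abs_cong[OF g'(1) _ this] show ?thesis using g'(1) by (simp add: G_def)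
  qed
  have G_mult: "G (x * y) = G x * G y" for x y
    unfolding G_def using seq_abs_cong[OF g'(1) _ \<phi>(4)[of x y]] \<phi>(1) g'(1)
    by (simp add: Cau_mult seq_abs_mult)
  have G_1: "G 1 = 1" using G_rat[of 1] g'(1) by simp
  have G_0: "G 0 = 0" using G_rat[of 0] g'(1) by simp
  have G: "absolute_value G"
    unfolding absolute_value_def
  proof (intro conjI allI)
    fix x y
    show "0 \<le> G x" using \<phi>(1) g'(1) by (simp add: G_def)
    show "G x = 0 \<longleftrightarrow> x = 0"
      using G_mult[of x "inverse x"] G_1 G_0 by (cases "x = 0") auto
    show "G (x * y) = G x * G y" by (rule G_mult)
    have "\<phi> (x + y) = (\<lambda>n. \<phi> x n + \<phi> y n)" using \<phi>(2) by auto
    then show "G (x + y) \<le> G x + G y"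
      unfolding G_def using seq_abs_triangle[OF g'(1) \<phi>(1)[of x] \<phi>(1)[of y]] by simp
  qed
  have "nonarchimedean G"
    unfolding nonarchimedean_def
  proof (intro allI)
    fix x y
    have "\<phi> (x + y) = (\<lambda>n. \<phi> x n + \<phi> y n)" using \<phi>(2) by auto
    then show "G (x + y) \<le> max (G x) (G y)"
      unfolding G_def using seq_abs_nonarch_le[OF g'(1,2) \<phi>(1)[of x] \<phi>(1)[of y]] by simp
  qed
  moreover have Gp: "G (of_nat p) = g (of_nat p)" using G_rat[of "of_nat p"] by simp
  ultimately have Gover: "lies_over p G" using G g' by (simp add: lies_over_def)
  have "nontrivial_absolute_value G"
    unfolding nontrivial_absolute_value_def using G Gp g'(3,4)
    by (auto intro!: exI[of _ "of_nat p"] dest: prime_gt_0_nat)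
  then obtain u where u: "u \<in> places" "(place_abs u, G) \<in> equivalent_absolute_values"
    by (rule nontrivial_place)
  obtain s where s: "s > 0" "\<And>x. G x = place_abs u x powr s"
    using u(2) by (auto simp: equivalent_absolute_values_def)
  have "seq_abs g z \<le> 1"
    using root_test_iff[OF d' _ g l(1) _ z(1)] z(3) l(2) by simp
  then have "G a \<le> 1"
    using seq_abs_cong[OF g'(1) \<phi>(1) z(2)] by (simp add: G_def)
  then have "place_abs u a \<le> 1"
    using s powr_less_mono2[of s 1 "place_abs u a"] by (force simp: not_le[symmetric])
  then have "u = v" using a(2)[OF u(1) lies_over_equivalent[OF Gover u(2)]] by simp
  then have "seq_abs g (\<phi> x) = ?f x powr s" for x using s(2) by (simp add: G_def)
  from completion_extend[OF f(1) g'(1) s(1) \<phi>(1,2,4,5) this] show ?thesis using s(1) by blast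
qed

text \<open>The theory determines the residue characteristic through \<open>char_formula\<close>,
  after which there are embeddings in both directions. Valuation rings correspond because
  \<open>h\<close> raises absolute values to a positive power.\<close>

lemma nonarch_equivalent_isomorphic:
  fixes v :: "('a::field_char_0 \<Rightarrow> real) set" and w :: "('b::field_char_0 \<Rightarrow> real) set"
  assumes K: "number_field TYPE('a)" and L: "number_field TYPE('b)"
    and v: "v \<in> places" "nonarchimedean (place_abs v)" and w: "w \<in> places" "nonarchimedean (place_abs w)"
    and equiv: "\<And>q. sentence q \<Longrightarrow> holds_in (completion_at v) q \<longleftrightarrow> holds_in (completion_at w) q"
  shows "\<exists>h \<in> ring_iso (completion_at v) (completion_at w). \<forall>U\<in>carrier (completion_at v).
    h U \<in> valuation_ring (place_abs w) \<longleftrightarrow> U \<in> valuation_ring (place_abs v)"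
proof -
  obtain p where p: "lies_over p (place_abs v)" using nonarch_lies_over[OF K place_abs_nontrivial[OF v(1)] v(2)] .
  obtain q where q: "lies_over q (place_abs w)" using nonarch_lies_over[OF L place_abs_nontrivial[OF w(1)] w(2)] .
  have "p = q"
  proof (rule ccontr)
    assume "p \<noteq> q"
    obtain d where d: "dim_at_most TYPE('a) d" using number_field_dim[OF K] .
    obtain l where l: "prime l" "l > d + p + q" using bigger_prime by blast
    have "holds_in (completion_at v) (char_formula p l)"
      using l by (intro char_formula_over[OF d _ p]) auto
    moreover have "\<not> holds_in (completion_at w) (char_formula p l)"
      using l p \<open>p \<noteq> q\<close> by (intro char_formula_not_over[OF q]) (auto simp: lies_over_def)
    ultimately show False using equiv[OF sentence_char_formula] by blast
  qed
  note f = place_abs_av[OF v(1)] and g = place_abs_av[OF w(1)]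
  obtain h s where h: "h \<in> ring_hom (completion_at v) (completion_at w)" "s > 0"
    "\<And>U. U \<in> carrier (completion_at v) \<Longrightarrow> completion_abs (place_abs w) (h U) = completion_abs (place_abs v) U powr s"
    using nonarch_embedding[OF K L v(1) p] q \<open>p = q\<close> equiv by blast
  obtain k t where k: "k \<in> ring_hom (completion_at w) (completion_at v)" "t > 0"
    "\<And>U. U \<in> carrier (completion_at w) \<Longrightarrow> completion_abs (place_abs v) (k U) = completion_abs (place_abs w) U powr t"
    using nonarch_embedding[OF L K w(1) q] p \<open>p = q\<close> equiv by blast
  have iso: "h \<in> ring_iso (completion_at v) (completion_at w)"
    by (rule completions_isomorphic[OF L f g h k])
  have "h U \<in> valuation_ring (place_abs w) \<longleftrightarrow> U \<in> valuation_ring (place_abs v)"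
    if U: "U \<in> carrier (completion_at v)" for U
  proof -
    have "x powr s \<le> 1 \<longleftrightarrow> x \<le> 1" if "x \<ge> 0" for x
      using that h(2) powr_less_mono2[of s 1 x] powr_le1[of s x] by (cases "x \<le> 1") (simp_all add: not_le)
    then show ?thesis
      using U h(3)[OF U] completion_abs_nonneg[OF f U] ring_hom_closed[OF h(1) U]
      by (simp add: valuation_ring_def)
  qed
  then show ?thesis using iso by blast
qed

section \<open>Archimedean completions\<close>

definition type_ring :: "'a::field ring" where
  "type_ring = \<lparr>carrier = UNIV, monoid.mult = (*), one = 1, zero = 0, add = (+)\<rparr>"

lemma type_ring_simps [simp]:
  "carrier type_ring = UNIV" "x \<otimes>\<^bsub>type_ring\<^esub> y = x * y" "\<one>\<^bsub>type_ring\<^esub> = 1"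
  "\<zero>\<^bsub>type_ring\<^esub> = 0" "x \<oplus>\<^bsub>type_ring\<^esub> y = x + y"
  by (simp_all add: type_ring_def)

lemma type_ring_cring: "cring (type_ring :: 'a::field ring)"
proof (rule cringI)
  show "abelian_group (type_ring :: 'a ring)"
  proof (rule abelian_groupI)
    fix x :: 'a
    show "\<exists>y\<in>carrier type_ring. y \<oplus>\<^bsub>type_ring\<^esub> x = \<zero>\<^bsub>type_ring\<^esub>"
      by (rule bexI[of _ "- x"]) simp_all
  qed (simp_all add: algebra_simps)
  show "comm_monoid (type_ring :: 'a ring)"
    by (rule comm_monoidI) (simp_all add: algebra_simps)
qed (simp add: algebra_simps)

lemma type_ring_ring: "ring (type_ring :: 'a::field ring)"
  using type_ring_cring[where 'a = 'a] by (simp add: cring_def)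

lemma type_ring_minus: "x \<ominus>\<^bsub>type_ring\<^esub> y = x - (y :: 'a::field)"
proof -
  interpret cring "type_ring :: 'a ring" by (rule type_ring_cring)
  have "\<ominus>\<^bsub>type_ring\<^esub> y = - y" by (rule minus_equality) simp_all
  then show ?thesis by (simp add: a_minus_def)
qed

lemma satisfies_iso:
  assumes R: "ring R" and S: "ring S" and h: "h \<in> ring_iso R S"
  shows "range e \<subseteq> carrier R \<Longrightarrow> satisfies S (h \<circ> e) p \<longleftrightarrow> satisfies R e p"
proof (induction p arbitrary: e)
  interpret R: ring R by (rule R)
  interpret S: ring S by (rule S)
  have hh: "h \<in> ring_hom R S" and bij: "bij_betw h (carrier R) (carrier S)" using h by (auto simp: ring_iso_def)
  interpret h: ring_hom_ring R S h by (rule ring_hom_ringI2[OF R S hh])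
  have tval: "term_value R e t \<in> carrier R \<and> term_value S (h \<circ> e) t = h (term_value R e t)"
    if "range e \<subseteq> carrier R" for e t
    using that by (induction t) (auto simp: a_minus_def)
  {
    case (Equal s t)
    then show ?case
      unfolding satisfies.simps using tval[of e s] tval[of e t] bij by (metis bij_betw_def inj_onD)
  next
    case (Negation p)
    then show ?case by simp
  next
    case (Conj p q)
    then show ?case by simp
  next
    case (Forall i p)
    have upd: "(h \<circ> e)(i := h a) = h \<circ> e(i := a)" for a by auto
    have IH: "satisfies S (h \<circ> e(i := a)) p \<longleftrightarrow> satisfies R (e(i := a)) p" if "a \<in> carrier R" for a
      by (rule Forall.IH) (use that Forall.prems in auto)
    have "carrier S = h ` carrier R" using bij by (simp add: bij_betw_def)
    then have "satisfies S (h \<circ> e) (Forall i p) \<longleftrightarrow> (\<forall>a\<in>carrier R. satisfies S ((h \<circ> e)(i := h a)) p)"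
      by (simp del: comp_apply fun_upd_apply)
    also have "\<dots> \<longleftrightarrow> satisfies R e (Forall i p)"
      unfolding upd using IH by (simp del: comp_apply fun_upd_apply)
    finally show ?case .
  }
qed

lemma holds_in_iso:
  assumes "ring R" "ring S" "R \<simeq> S" "sentence p"
  shows "holds_in R p \<longleftrightarrow> holds_in S p"
proof -
  obtain h where h: "h \<in> ring_iso R S" using assms(3) by (auto simp: is_ring_iso_def)
  have z: "\<zero>\<^bsub>R\<^esub> \<in> carrier R" using assms(1) by (simp add: ring.ring_simprules)
  then have hz: "h \<zero>\<^bsub>R\<^esub> \<in> carrier S" using h by (auto simp: ring_iso_def bij_betw_def)
  have "holds_in S p \<longleftrightarrow> satisfies S (h \<circ> (\<lambda>_. \<zero>\<^bsub>R\<^esub>)) p"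
    using holds_in_iff[OF assms(4), where e = "h \<circ> (\<lambda>_. \<zero>\<^bsub>R\<^esub>)" and R = S] hz by simp
  also have "\<dots> \<longleftrightarrow> satisfies R (\<lambda>_. \<zero>\<^bsub>R\<^esub>) p"
    by (rule satisfies_iso[OF assms(1,2) h]) (use z in auto)
  also have "\<dots> \<longleftrightarrow> holds_in R p"
    using holds_in_iff[OF assms(4), where e = "\<lambda>_. \<zero>\<^bsub>R\<^esub>" and R = R] z by simp
  finally show ?thesis by simp
qed

lemma completion_abs_mult:
  assumes f: "absolute_value f" and U: "U \<in> carrier (field_completion f)" "W \<in> carrier (field_completion f)"
  shows "completion_abs f (U \<otimes>\<^bsub>field_completion f\<^esub> W) = completion_abs f U * completion_abs f W"
proof -
  obtain x y where "x \<in> Cau f" "U = seq_class f x" "y \<in> Cau f" "W = seq_class f y"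
    using U f by (auto simp: completion_carrier)
  then show ?thesis
    using f by (simp add: completion_mult completion_abs_seq_class Cau_mult seq_abs_mult)
qed

section \<open>Real polynomials at complex numbers\<close>

lemma poly_of_real_add:
  "poly (map_poly complex_of_real (p + q)) z =
    poly (map_poly complex_of_real p) z + poly (map_poly complex_of_real q) z"
  by (induction p q rule: poly_induct2) (simp_all add: map_poly_pCons algebra_simps)

lemma poly_of_real_smult:
  "poly (map_poly complex_of_real (smult a p)) z = complex_of_real a * poly (map_poly complex_of_real p) z"
  by (induction p) (simp_all add: map_poly_pCons algebra_simps)

lemma poly_of_real_mult:
  "poly (map_poly complex_of_real (p * q)) z =
    poly (map_poly complex_of_real p) z * poly (map_poly complex_of_real q) z"
  by (induction p) (simp_all add: map_poly_pCons poly_of_real_add poly_of_real_smult algebra_simps)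

text \<open>The normalised situation, with the usual absolute value on \<rat>; the general
  archimedean case is reduced to it by taking a power.\<close>

locale archimedean_completion =
  fixes g :: "'a::field_char_0 \<Rightarrow> real"
  assumes K: "number_field TYPE('a)" and g: "absolute_value g"
    and g_rat: "\<And>q. g (of_rat q) = \<bar>real_of_rat q\<bar>"
begin

abbreviation "F \<equiv> field_completion g"

lemma F_field: "field F"
  by (rule completion_field[OF g])

sublocale F: field F
  by (rule F_field)

lemma rat_seq_Cau:
  assumes "(\<lambda>n. real_of_rat (q n)) \<longlonglongrightarrow> r"
  shows "(\<lambda>n. of_rat (q n)) \<in> Cau g"
proof -
  have "Cauchy (\<lambda>n. real_of_rat (q n))" using assms by (rule LIMSEQ_imp_Cauchy)
  then show ?thesis
    by (simp add: Cau_iff Cauchy_def dist_real_def g_rat flip: of_rat_diff)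
qed

lemma rat_seq_Nul:
  assumes "(\<lambda>n. real_of_rat (q n)) \<longlonglongrightarrow> 0"
  shows "(\<lambda>n. of_rat (q n)) \<in> Nul g"
  using tendsto_rabs_zero[OF assms] by (simp add: Nul_iff g_rat)

definition approx :: "real \<Rightarrow> nat \<Rightarrow> rat" where
  "approx r n = (SOME q. \<bar>real_of_rat q - r\<bar> < inverse (real (Suc n)))"

lemma approx_tendsto: "(\<lambda>n. real_of_rat (approx r n)) \<longlonglongrightarrow> r"
proof -
  have ap: "\<bar>real_of_rat (approx r n) - r\<bar> < inverse (real (Suc n))" for n
  proof -
    have "\<exists>q. r - inverse (real (Suc n)) < real_of_rat q \<and> real_of_rat q < r"
      by (rule of_rat_dense) simp
    then obtain q where q: "r - inverse (real (Suc n)) < real_of_rat q" "real_of_rat q < r" by blast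
    have "\<bar>real_of_rat q - r\<bar> < inverse (real (Suc n))" using q by linarith
    then have "\<exists>q. \<bar>real_of_rat q - r\<bar> < inverse (real (Suc n))" by blast
    then show ?thesis unfolding approx_def by (rule someI_ex)
  qed
  have "(\<lambda>n. real_of_rat (approx r n) - r) \<longlonglongrightarrow> 0"
  proof (rule tendsto_rabs_zero_cancel, rule tendsto_sandwich[OF _ _ _ LIMSEQ_inverse_real_of_nat])
    show "\<forall>\<^sub>F n in sequentially. \<bar>real_of_rat (approx r n) - r\<bar> \<le> inverse (real (Suc n))"
      using ap by (auto intro!: always_eventually less_imp_le)
  qed auto
  then show ?thesis by (simp add: LIM_zero_iff)
qed

text \<open>The copy of the reals inside the completion, as the closure of the rationals.\<close>

definition R :: "real \<Rightarrow> (nat \<Rightarrow> 'a) set" where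
  "R r = seq_class g (\<lambda>n. of_rat (approx r n))"

lemma R_eqI:
  assumes "(\<lambda>n. real_of_rat (q n)) \<longlonglongrightarrow> r"
  shows "seq_class g (\<lambda>n. of_rat (q n)) = R r"
proof -
  have "(\<lambda>n. real_of_rat (q n - approx r n)) \<longlonglongrightarrow> 0"
    using tendsto_diff[OF assms approx_tendsto[of r]] by (simp add: of_rat_diff)
  from rat_seq_Nul[OF this] show ?thesis
    unfolding R_def by (simp add: seq_class_eq_iff g of_rat_diff)
qed

lemma R_carrier [simp]: "R r \<in> carrier F"
  unfolding R_def using rat_seq_Cau[OF approx_tendsto] g by simp

lemma R_of_rat: "R (real_of_rat q) = seq_class g (\<lambda>_. of_rat q)"
  by (rule R_eqI[symmetric]) simp

lemma R_add: "R (r + s) = R r \<oplus>\<^bsub>F\<^esub> R s"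
proof -
  have "R (r + s) = seq_class g (\<lambda>n. of_rat (approx r n + approx s n))"
    by (rule R_eqI[symmetric]) (simp add: of_rat_add tendsto_add approx_tendsto)
  then show ?thesis
    unfolding R_def using rat_seq_Cau[OF approx_tendsto] g by (simp add: completion_add of_rat_add)
qed

lemma R_mult: "R (r * s) = R r \<otimes>\<^bsub>F\<^esub> R s"
proof -
  have "R (r * s) = seq_class g (\<lambda>n. of_rat (approx r n * approx s n))"
    by (rule R_eqI[symmetric]) (simp add: of_rat_mult tendsto_mult approx_tendsto)
  then show ?thesis
    unfolding R_def using rat_seq_Cau[OF approx_tendsto] g by (simp add: completion_mult of_rat_mult)
qed

lemma R_0: "R 0 = \<zero>\<^bsub>F\<^esub>" and R_1: "R 1 = \<one>\<^bsub>F\<^esub>"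
  using R_of_rat[of 0] R_of_rat[of 1] g by (simp_all add: completion_zero completion_one)

lemma R_minus: "R (- r) = \<ominus>\<^bsub>F\<^esub> R r"
  by (rule F.minus_equality[symmetric]) (simp_all add: R_0 flip: R_add)

lemma R_diff: "R (r - s) = R r \<ominus>\<^bsub>F\<^esub> R s"
  using R_add[of r "- s"] by (simp add: R_minus a_minus_def)

lemma R_abs: "completion_abs g (R r) = \<bar>r\<bar>"
proof -
  have "(\<lambda>n. g (of_rat (approx r n))) \<longlonglongrightarrow> \<bar>r\<bar>"
    unfolding g_rat by (intro tendsto_rabs approx_tendsto)
  then show ?thesis
    unfolding R_def using rat_seq_Cau[OF approx_tendsto] g by (simp add: completion_abs_seq_class seq_abs_eqI)
qed

lemma R_inj: "R r = R s \<longleftrightarrow> r = s"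
proof
  assume "R r = R s"
  then have "R (r - s) = \<zero>\<^bsub>F\<^esub>" by (simp add: R_diff a_minus_def F.r_neg)
  then have "completion_abs g (R (r - s)) = 0" using completion_abs_0_iff[OF g, of "\<zero>\<^bsub>F\<^esub>"] by simp
  then show "r = s" by (simp add: R_abs)
qed simp

text \<open>Horner evaluation at \<open>B\<close> with coefficients read through \<open>R\<close>.
  Working with \<open>real poly\<close> gives access to division with remainder and to complex
  roots.\<close>

definition ev :: "(nat \<Rightarrow> 'a) set \<Rightarrow> real poly \<Rightarrow> (nat \<Rightarrow> 'a) set" where
  "ev B p = foldr (\<lambda>a U. R a \<oplus>\<^bsub>F\<^esub> B \<otimes>\<^bsub>F\<^esub> U) (coeffs p) \<zero>\<^bsub>F\<^esub>"

context
  fixes B assumes B: "B \<in> carrier F"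
begin

lemma ev_0 [simp]: "ev B 0 = \<zero>\<^bsub>F\<^esub>"
  by (simp add: ev_def)

lemma ev_pCons: "ev B (pCons a p) = R a \<oplus>\<^bsub>F\<^esub> B \<otimes>\<^bsub>F\<^esub> ev B p"
  using B by (auto simp: ev_def cCons_def R_0)

lemma ev_carrier [simp]: "ev B p \<in> carrier F"
  by (induction p) (use B in \<open>simp_all add: ev_pCons\<close>)

lemma ev_add: "ev B (p + q) = ev B p \<oplus>\<^bsub>F\<^esub> ev B q"
proof (induction p q rule: poly_induct2)
  case (pCons a p b q)
  then show ?case using B by (simp add: ev_pCons R_add F.r_distr F.a_ac)
qed simp

lemma ev_smult: "ev B (smult a p) = R a \<otimes>\<^bsub>F\<^esub> ev B p"
proof (induction p)
  case (pCons b p)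
  then show ?case using B by (simp add: ev_pCons R_mult F.r_distr F.m_ac)
qed simp

lemma ev_mult: "ev B (p * q) = ev B p \<otimes>\<^bsub>F\<^esub> ev B q"
proof (induction p)
  case (pCons a p)
  then show ?case
    using B by (simp add: ev_pCons ev_add ev_smult R_0 F.l_distr F.m_assoc)
qed simp

text \<open>Induction on the degree. A complex root \<open>z\<close> of \<open>P\<close> has a real
  minimal polynomial \<open>M\<close> of degree \<open>1\<close> or \<open>2\<close>, which divides
  \<open>P\<close>; as the completion is a field, \<open>B\<close> is a root of \<open>M\<close> or
  of the cofactor.\<close>

lemma ev_quadratic_root:
  "P \<noteq> 0 \<Longrightarrow> ev B P = \<zero>\<^bsub>F\<^esub> \<Longrightarrow> \<exists>u w. ev B ([:- u, 1:] * [:- u, 1:] + [:w\<^sup>2:]) = \<zero>\<^bsub>F\<^esub>"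
proof (induction "Polynomial.degree P" arbitrary: P rule: less_induct)
  case less
  let ?P = "map_poly complex_of_real P"
  have deg: "Polynomial.degree P \<noteq> 0"
  proof
    assume "Polynomial.degree P = 0"
    then obtain a where a: "P = [:a:]" using degree_eq_zeroE by blast
    then have "R a = \<zero>\<^bsub>F\<^esub>" using less.prems B by (simp add: ev_pCons)
    then have "a = 0" using R_inj[of a 0] by (simp add: R_0)
    then show False using less.prems a by simp
  qed
  have "\<exists>z. poly ?P z = 0"
  proof (rule fundamental_theorem_of_algebra_alt, rule notI, elim exE conjE)
    fix a l assume "?P = pCons a l" "l = (0 :: complex poly)"
    then have "Polynomial.degree ?P = 0" by simp
    then show False using deg degree_map_poly[of complex_of_real P] by simp
  qed
  then obtain z where z: "poly ?P z = 0" by blast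
  define u w where "u = Re z" and "w = Im z"
  \<comment> \<open>The minimal polynomial of \<open>z\<close> over the reals, according to whether
    \<open>z\<close> is real.\<close>
  define M where "M = (if w = 0 then [:- u, 1:] else [:- u, 1:] * [:- u, 1:] + [:w\<^sup>2:])"
  have zuw: "z = Complex u w" by (simp add: u_def w_def)
  have Mz: "poly (map_poly complex_of_real M) z = 0"
    by (simp add: M_def zuw map_poly_pCons complex_eq_iff power2_eq_square algebra_simps)
  have M0: "M \<noteq> 0" by (auto simp: M_def)
  have degM: "Polynomial.degree M > 0" by (auto simp: M_def)
  \<comment> \<open>Minimality of \<open>M\<close>; applied to the remainder it shows that
    \<open>M\<close> divides \<open>P\<close>.\<close>
  have root_of_small: "Q = 0" if Q: "poly (map_poly complex_of_real Q) z = 0" "Q = 0 \<or> Polynomial.degree Q < Polynomial.degree M" for Q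
  proof (rule ccontr)
    assume Q0: "Q \<noteq> 0"
    obtain a b where ab: "Q = [:a, b:]" "w = 0 \<Longrightarrow> b = 0"
    proof -
      have "Polynomial.degree Q < 2" using Q(2) Q0 by (auto simp: M_def split: if_splits)
      then have "Q = [:Polynomial.coeff Q 0, Polynomial.coeff Q 1:]"
        by (intro poly_eqI) (auto simp: coeff_pCons coeff_eq_0 split: nat.split)
      moreover have "Polynomial.coeff Q 1 = 0" if "w = 0"
        using Q(2) Q0 that by (auto simp: M_def intro!: coeff_eq_0)
      ultimately show ?thesis using that by blast
    qed
    have "a + b * u = 0" "b * w = 0"
      using Q(1) by (auto simp: ab(1) zuw map_poly_pCons complex_eq_iff algebra_simps)
    then have "b = 0" "a = 0" using ab(2) by auto
    then show False using Q0 ab(1) by simp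
  qed
  have hom: "poly (map_poly complex_of_real (p * q)) z = poly (map_poly complex_of_real p) z * poly (map_poly complex_of_real q) z"
    "poly (map_poly complex_of_real (p + q)) z = poly (map_poly complex_of_real p) z + poly (map_poly complex_of_real q) z" for p q
    by (rule poly_of_real_mult poly_of_real_add)+
  have "P mod M = 0"
  proof (rule root_of_small)
    have "poly (map_poly complex_of_real (P div M * M + P mod M)) z = 0" using z by simp
    then show "poly (map_poly complex_of_real (P mod M)) z = 0" unfolding hom using Mz by simp
    show "P mod M = 0 \<or> Polynomial.degree (P mod M) < Polynomial.degree M"
      by (rule degree_mod_less[OF M0])
  qed
  then obtain Q where Q: "P = M * Q" by (metis dvd_def mod_eq_0_iff_dvd)
  have "ev B M = \<zero>\<^bsub>F\<^esub> \<or> ev B Q = \<zero>\<^bsub>F\<^esub>"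
    using less.prems(2) F.integral unfolding Q ev_mult by simp
  then show ?case
  proof
    assume M: "ev B M = \<zero>\<^bsub>F\<^esub>"
    show ?thesis
    proof (cases "w = 0")
      \<comment> \<open>A linear factor is squared to take the common quadratic shape, with
        \<open>0\<close> for the second parameter.\<close>
      case True
      then have "ev B ([:- u, 1:] * [:- u, 1:] + [:0\<^sup>2:]) = \<zero>\<^bsub>F\<^esub>"
        using M by (simp add: M_def ev_mult ev_add del: mult_pCons_left mult_pCons_right)
      then show ?thesis by blast
    next
      case False
      then show ?thesis using M by (auto simp: M_def)
    qed
  next
    assume "ev B Q = \<zero>\<^bsub>F\<^esub>"
    moreover have "Q \<noteq> 0" using less.prems(1) Q by auto
    moreover have "Polynomial.degree Q < Polynomial.degree P"
      using degM M0 \<open>Q \<noteq> 0\<close> by (simp add: Q degree_mult_eq)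
    ultimately show ?thesis using less.hyps by blast
  qed
qed

end

lemma const_carrier [simp]: "seq_class g (\<lambda>_. b) \<in> carrier F"
  using g by simp

lemma ev_Poly:
  "ev (seq_class g (\<lambda>_. b)) (Poly (map real_of_rat qs)) = seq_class g (\<lambda>_. horner_sum of_rat b qs)"
proof (induction qs)
  case (Cons q qs)
  then show ?case
    using g by (simp add: ev_pCons R_of_rat completion_mult completion_add)
qed (simp add: completion_zero)

text \<open>An element of the number field satisfies a rational polynomial, so
  \<open>ev_quadratic_root\<close> makes it a root of a real quadratic in completed-square form;
  \<open>D\<close> is the element shifted by the real part \<open>u\<close>.\<close>

lemma const_quadratic:
  "\<exists>D u w. D \<in> carrier F \<and> seq_class g (\<lambda>_. b) = D \<oplus>\<^bsub>F\<^esub> R u \<and> D \<otimes>\<^bsub>F\<^esub> D = \<ominus>\<^bsub>F\<^esub> (R w \<otimes>\<^bsub>F\<^esub> R w)"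
proof -
  let ?B = "seq_class g (\<lambda>_. b)"
  obtain d where d: "dim_at_most TYPE('a) d" using number_field_dim[OF K] .
  obtain q :: "nat \<Rightarrow> rat" where q: "\<exists>i\<in>{..<Suc d}. q i \<noteq> 0" "(\<Sum>i<Suc d. of_rat (q i) * b ^ i) = 0"
    using dim_at_most_dependent[OF d, of "{..<Suc d}" "\<lambda>i. b ^ i"] by (auto simp del: sum.lessThan_Suc)
  define qs where "qs = map q [0..<Suc d]"
  have "horner_sum of_rat b qs = 0"
  proof -
    have "horner_sum of_rat b qs = (\<Sum>i<Suc d. of_rat (qs ! i) * b ^ i)"
      by (simp add: horner_sum_eq_sum qs_def atLeast0LessThan del: sum.lessThan_Suc upt_Suc)
    also have "\<dots> = (\<Sum>i<Suc d. of_rat (q i) * b ^ i)"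
      by (rule sum.cong) (auto simp: qs_def simp del: upt_Suc)
    finally show ?thesis using q(2) by simp
  qed
  then have "ev ?B (Poly (map real_of_rat qs)) = \<zero>\<^bsub>F\<^esub>" by (simp add: ev_Poly completion_zero)
  moreover have "Poly (map real_of_rat qs) \<noteq> 0"
  proof
    assume "Poly (map real_of_rat qs) = 0"
    then obtain n where "map real_of_rat qs = replicate n 0" by (auto simp: Poly_eq_0)
    then have "set (map real_of_rat qs) = set (replicate n 0)" by (rule arg_cong)
    then have "set (map real_of_rat qs) \<subseteq> {0}" by (simp only: set_replicate_conv_if) simp
    moreover obtain i where "i < Suc d" "q i \<noteq> 0" using q(1) by auto
    moreover from this have "real_of_rat (q i) \<in> set (map real_of_rat qs)"
      by (auto simp: qs_def simp del: upt_Suc)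
    ultimately show False by auto
  qed
  ultimately obtain u w where uw: "ev ?B ([:- u, 1:] * [:- u, 1:] + [:w\<^sup>2:]) = \<zero>\<^bsub>F\<^esub>"
    using ev_quadratic_root[OF const_carrier] by blast
  define D where "D = ev ?B [:- u, 1:]"
  have D: "D \<in> carrier F" by (simp add: D_def)
  have "?B = D \<oplus>\<^bsub>F\<^esub> R u"
  proof -
    have "D = R (- u) \<oplus>\<^bsub>F\<^esub> ?B" by (simp add: D_def ev_pCons R_1)
    then have "D \<oplus>\<^bsub>F\<^esub> R u = ?B \<oplus>\<^bsub>F\<^esub> (R (- u) \<oplus>\<^bsub>F\<^esub> R u)" by (simp add: F.a_ac)
    also have "R (- u) \<oplus>\<^bsub>F\<^esub> R u = \<zero>\<^bsub>F\<^esub>" by (simp add: R_0 flip: R_add)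
    finally show ?thesis by simp
  qed
  moreover have "D \<otimes>\<^bsub>F\<^esub> D \<oplus>\<^bsub>F\<^esub> R w \<otimes>\<^bsub>F\<^esub> R w = \<zero>\<^bsub>F\<^esub>"
  proof -
    have "ev ?B [:w\<^sup>2:] = R w \<otimes>\<^bsub>F\<^esub> R w" by (simp add: ev_pCons power2_eq_square R_mult)
    then show ?thesis
      using uw unfolding ev_add[OF const_carrier] ev_mult[OF const_carrier] D_def by simp
  qed
  then have "D \<otimes>\<^bsub>F\<^esub> D = \<ominus>\<^bsub>F\<^esub> (R w \<otimes>\<^bsub>F\<^esub> R w)"
    using D by (intro F.minus_equality[symmetric]) auto
  ultimately show ?thesis using D by blast
qed

text \<open>The two bounds make \<open>h\<close> a bicontinuous embedding of a complete space, so
  its image is closed; it contains the number field, which is dense.\<close>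

lemma surj_from_complete:
  fixes h :: "'c::{banach,real_normed_field} \<Rightarrow> (nat \<Rightarrow> 'a) set"
  assumes h: "\<And>z. h z \<in> carrier F" "\<And>x y. h (x - y) = h x \<ominus>\<^bsub>F\<^esub> h y"
    and abs: "\<And>z. norm z \<le> c * completion_abs g (h z)" "\<And>z. completion_abs g (h z) \<le> c * norm z" "c > 0"
    and const: "\<And>b. seq_class g (\<lambda>_. b) \<in> range h"
  shows "range h = carrier F"
proof (intro equalityI subsetI)
  fix U assume U: "U \<in> carrier F"
  obtain x where x: "x \<in> Cau g" "U = seq_class g x" using completion_carrierE[OF g U] .
  have "\<exists>z. h z = seq_class g (\<lambda>_. x n)" for n using const[of "x n"] by (auto simp: image_iff)
  then obtain z where z: "\<And>n. h (z n) = seq_class g (\<lambda>_. x n)" by metis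
  have "Cauchy z"
    unfolding Cauchy_def dist_norm
  proof (intro allI impI)
    fix e :: real assume "e > 0"
    then obtain N where N: "\<forall>m\<ge>N. \<forall>n\<ge>N. g (x m - x n) < e / c" using CauD[OF x(1), of "e / c"] abs(3) by auto
    have "norm (z m - z n) < e" if "m \<ge> N" "n \<ge> N" for m n
    proof -
      have "completion_abs g (h (z m - z n)) = g (x m - x n)"
        using g by (simp add: h(2) z completion_diff completion_abs_seq_class)
      then have "norm (z m - z n) \<le> c * g (x m - x n)" using abs(1)[of "z m - z n"] by simp
      also have "\<dots> < c * (e / c)" using N that abs(3) by (intro mult_strict_left_mono) auto
      also have "\<dots> = e" using abs(3) by simp
      finally show ?thesis .
    qed
    then show "\<exists>M. \<forall>m\<ge>M. \<forall>n\<ge>M. norm (z m - z n) < e" by blast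
  qed
  then obtain l where l: "z \<longlonglongrightarrow> l" using Cauchy_convergent_iff convergent_def by blast
  obtain y where y: "y \<in> Cau g" "h l = seq_class g y" using completion_carrierE[OF g h(1)] .
  have lim0: "(\<lambda>n. c * norm (z n - l)) \<longlonglongrightarrow> c * 0"
    by (intro tendsto_mult tendsto_const tendsto_norm_zero) (use l in \<open>simp add: LIM_zero_iff\<close>)
  have le: "seq_abs g (\<lambda>m. x n - y m) \<le> c * norm (z n - l)" for n
    using abs(2)[of "z n - l"] y g by (simp add: h(2) z completion_diff completion_abs_seq_class Cau_diff)
  have nonneg: "0 \<le> seq_abs g (\<lambda>m. x n - y m)" for n
    by (rule seq_abs_nonneg[OF g Cau_diff[OF g Cau_const[OF g] y(1)]])
  have lim1: "(\<lambda>n. seq_abs g (\<lambda>m. x n - y m)) \<longlonglongrightarrow> 0"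
    by (rule tendsto_sandwich[OF always_eventually always_eventually tendsto_const])
      (use lim0 le nonneg in auto)
  \<comment> \<open>The constants \<open>x n\<close> approach the class of \<open>x\<close>, and by
    \<open>lim1\<close> also that of \<open>y\<close>, so the two classes agree.\<close>
  have "(\<lambda>n. seq_abs g (\<lambda>m. x m - x n)) \<longlonglongrightarrow> 0"
  proof (rule LIMSEQ_I)
    fix e :: real assume "e > 0"
    then obtain N where N: "\<forall>m\<ge>N. \<forall>n\<ge>N. g (x m - x n) < e / 2" using CauD[OF x(1), of "e / 2"] by auto
    have "norm (seq_abs g (\<lambda>m. x m - x n) - 0) < e" if "n \<ge> N" for n
    proof -
      have c: "(\<lambda>m. x m - x n) \<in> Cau g" using g x(1) by (intro Cau_diff) auto
      have "seq_abs g (\<lambda>m. x m - x n) \<le> e / 2"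
        using N that by (intro tendsto_upperbound[OF seq_abs_tendsto[OF g c]])
          (auto simp: eventually_sequentially intro!: exI[of _ N] less_imp_le)
      then show ?thesis using seq_abs_nonneg[OF g c] \<open>e > 0\<close> by simp
    qed
    then show "\<exists>N. \<forall>n\<ge>N. norm (seq_abs g (\<lambda>m. x m - x n) - 0) < e" by blast
  qed
  from tendsto_add[OF this lim1]
  have "(\<lambda>n. seq_abs g (\<lambda>m. x m - x n) + seq_abs g (\<lambda>m. x n - y m)) \<longlonglongrightarrow> 0" by simp
  then have "seq_abs g (\<lambda>m. x m - y m) \<le> 0"
  proof (rule tendsto_lowerbound)
    show "\<forall>\<^sub>F n in sequentially. seq_abs g (\<lambda>m. x m - y m) \<le>
        seq_abs g (\<lambda>m. x m - x n) + seq_abs g (\<lambda>m. x n - y m)"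
      by (intro always_eventually allI seq_abs_diff_triangle[OF g x(1) Cau_const[OF g] y(1)])
  qed simp
  then have "(\<lambda>m. x m - y m) \<in> Nul g"
    using seq_abs_0_iff[OF g Cau_diff[OF g x(1) y(1)]] seq_abs_nonneg[OF g Cau_diff[OF g x(1) y(1)]] by simp
  then show "U \<in> range h" using x y g by (metis rangeI seq_class_eq_iff)
qed (use h in auto)

text \<open>If the number field lies in the closure of \<rat>, that closure is everything. Otherwise
  an element outside it provides \<open>J\<close> with square minus one, hence a copy of the complex
  numbers; by \<open>const_quadratic\<close> each element of the number field is a real shift of a
  square root of some \<open>- (t * t)\<close>, and so lies in this copy.\<close>

lemma real_or_complex:
  "(type_ring :: real ring) \<simeq> F \<or> (type_ring :: complex ring) \<simeq> F"
proof (cases "\<forall>b. seq_class g (\<lambda>_. b) \<in> range R")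
  case True
  have "range R = carrier F"
  proof (rule surj_from_complete[where c = 1])
    show "R (x - y) = R x \<ominus>\<^bsub>F\<^esub> R y" for x y by (rule R_diff)
  qed (use True in \<open>simp_all add: R_abs\<close>)
  then have "bij_betw R (carrier type_ring) (carrier F)"
    by (simp add: bij_betw_def inj_on_def R_inj)
  moreover have "R \<in> ring_hom type_ring F"
    by (rule ring_hom_memI) (simp_all add: R_mult R_add R_1)
  ultimately show ?thesis by (auto simp: is_ring_iso_def ring_iso_def)
next
  case False
  then obtain b where b: "seq_class g (\<lambda>_. b) \<notin> range R" by blast
  obtain D u w where D: "D \<in> carrier F" "seq_class g (\<lambda>_. b) = D \<oplus>\<^bsub>F\<^esub> R u"
    "D \<otimes>\<^bsub>F\<^esub> D = \<ominus>\<^bsub>F\<^esub> (R w \<otimes>\<^bsub>F\<^esub> R w)" using const_quadratic by blast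
  have w: "w \<noteq> 0"
  proof
    assume "w = 0"
    then have "D = \<zero>\<^bsub>F\<^esub>" using D F.integral[of D D] by (simp add: R_0)
    then show False using b D(2) by simp
  qed
  \<comment> \<open>The square of \<open>D\<close> is minus the square of the nonzero real
    \<open>w\<close>, so dividing by \<open>w\<close> gives a square root of minus one.\<close>
  define J where "J = D \<otimes>\<^bsub>F\<^esub> R (1 / w)"
  have J: "J \<in> carrier F" using D by (simp add: J_def)
  have JJ: "J \<otimes>\<^bsub>F\<^esub> J = \<ominus>\<^bsub>F\<^esub> \<one>\<^bsub>F\<^esub>"
  proof -
    have "J \<otimes>\<^bsub>F\<^esub> J = (D \<otimes>\<^bsub>F\<^esub> D) \<otimes>\<^bsub>F\<^esub> (R (1 / w) \<otimes>\<^bsub>F\<^esub> R (1 / w))"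
      using D(1) by (simp add: J_def F.m_ac)
    also have "\<dots> = \<ominus>\<^bsub>F\<^esub> (R (w * w * (1 / w * (1 / w))))" by (simp only: D(3) R_mult F.l_minus R_carrier F.m_closed)
    also have "w * w * (1 / w * (1 / w)) = 1" using w by simp
    finally show ?thesis by (simp add: R_1)
  qed
  define C where "C z = R (Re z) \<oplus>\<^bsub>F\<^esub> R (Im z) \<otimes>\<^bsub>F\<^esub> J" for z
  have C_carrier [simp]: "C z \<in> carrier F" for z using J by (simp add: C_def)
  have C_add: "C (x + y) = C x \<oplus>\<^bsub>F\<^esub> C y" for x y
    using J by (simp add: C_def R_add F.l_distr F.a_ac)
  have C_mult: "C (x * y) = C x \<otimes>\<^bsub>F\<^esub> C y" for x y
  proof -
    have "R (Im x) \<otimes>\<^bsub>F\<^esub> J \<otimes>\<^bsub>F\<^esub> (R (Im y) \<otimes>\<^bsub>F\<^esub> J) = (R (Im x) \<otimes>\<^bsub>F\<^esub> R (Im y)) \<otimes>\<^bsub>F\<^esub> (J \<otimes>\<^bsub>F\<^esub> J)"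
      using J by (simp add: F.m_ac)
    also have "\<dots> = R (- (Im x * Im y))"
      unfolding JJ by (simp add: R_minus R_mult F.r_minus)
    finally have "C x \<otimes>\<^bsub>F\<^esub> C y = R (Re x * Re y) \<oplus>\<^bsub>F\<^esub> R (Re x * Im y) \<otimes>\<^bsub>F\<^esub> J \<oplus>\<^bsub>F\<^esub>
        (R (Im x * Re y) \<otimes>\<^bsub>F\<^esub> J \<oplus>\<^bsub>F\<^esub> R (- (Im x * Im y)))"
      using J by (simp add: C_def F.l_distr F.r_distr R_mult F.m_ac F.a_ac)
    also have "\<dots> = R (Re x * Re y + - (Im x * Im y)) \<oplus>\<^bsub>F\<^esub> R (Re x * Im y + Im x * Re y) \<otimes>\<^bsub>F\<^esub> J"
      using J by (simp add: R_diff R_minus R_add F.l_distr F.a_ac a_minus_def)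
    finally show ?thesis by (simp add: C_def)
  qed
  have C_1: "C 1 = \<one>\<^bsub>F\<^esub>" using J by (simp add: C_def R_1 R_0)
  have C_0: "C 0 = \<zero>\<^bsub>F\<^esub>" using J by (simp add: C_def R_0)
  have C_minus: "C (- x) = \<ominus>\<^bsub>F\<^esub> C x" for x
    by (rule F.minus_equality[symmetric]) (simp_all add: C_0 flip: C_add)
  have C_diff: "C (x - y) = C x \<ominus>\<^bsub>F\<^esub> C y" for x y
    using C_add[of x "- y"] by (simp add: C_minus a_minus_def)
  have C_power: "completion_abs g (C (x ^ k)) = completion_abs g (C x) ^ k" for x k
  proof (induction k)
    case 0
    show ?case using R_abs[of 1] by (simp add: C_1 R_1)
  qed (simp add: C_mult completion_abs_mult[OF g])
  have absJ: "completion_abs g J = 1"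
  proof -
    have "completion_abs g J * completion_abs g J = completion_abs g (R (- 1))"
      using completion_abs_mult[OF g J J] by (simp add: JJ R_minus R_1)
    also have "\<dots> = 1" by (simp add: R_abs)
    finally show ?thesis
      using completion_abs_nonneg[OF g J] by (metis abs_of_nonneg real_sqrt_abs2 real_sqrt_one)
  qed
  have le2: "completion_abs g (C z) \<le> 2 * cmod z" for z
  proof -
    have "completion_abs g (C z) \<le> completion_abs g (R (Re z)) + completion_abs g (R (Im z) \<otimes>\<^bsub>F\<^esub> J)"
      unfolding C_def using J by (intro completion_abs_triangle[OF g]) auto
    also have "\<dots> = \<bar>Re z\<bar> + \<bar>Im z\<bar>" using J by (simp add: completion_abs_mult[OF g] R_abs absJ)
    also have "\<dots> \<le> 2 * cmod z" using abs_Re_le_cmod[of z] abs_Im_le_cmod[of z] by linarith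
    finally show ?thesis .
  qed
  \<comment> \<open>Applying the crude bound to \<open>z ^ k\<close> and taking \<open>k\<close>-th
    roots removes the factor \<open>2\<close>; the same bound for \<open>inverse z\<close> then
    gives equality.\<close>
  have le: "completion_abs g (C z) \<le> cmod z" for z
  proof (rule power_growth_le[where C = 2])
    fix k
    have "completion_abs g (C z) ^ k \<le> 2 * cmod z ^ k"
      using le2[of "z ^ k"] by (simp add: C_power norm_power)
    also have "\<dots> \<le> 2 * (real k + 1) * cmod z ^ k" by (intro mult_right_mono) auto
    finally show "completion_abs g (C z) ^ k \<le> 2 * (real k + 1) * cmod z ^ k" .
  qed simp
  have C_abs: "completion_abs g (C z) = cmod z" for z
  proof (cases "z = 0")
    case True
    then show ?thesis using R_abs[of 0] by (simp add: C_0 R_0)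
  next
    case False
    have "completion_abs g (C z) * completion_abs g (C (inverse z)) = completion_abs g (C (z * inverse z))"
      by (simp add: C_mult completion_abs_mult[OF g])
    also have "\<dots> = 1" using False R_abs[of 1] by (simp add: C_1 R_1)
    finally have "1 = completion_abs g (C z) * completion_abs g (C (inverse z))" by simp
    also have "\<dots> \<le> completion_abs g (C z) * cmod (inverse z)"
      using completion_abs_nonneg[OF g C_carrier] by (intro mult_left_mono le) auto
    finally have "1 \<le> completion_abs g (C z) * inverse (cmod z)" unfolding norm_inverse .
    then have "cmod z \<le> completion_abs g (C z)" using False by (simp add: field_simps)
    then show ?thesis using le[of z] by simp
  qed
  have const: "seq_class g (\<lambda>_. c) \<in> range C" for c
  proof -
    obtain E s t where E: "E \<in> carrier F" "seq_class g (\<lambda>_. c) = E \<oplus>\<^bsub>F\<^esub> R s"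
      "E \<otimes>\<^bsub>F\<^esub> E = \<ominus>\<^bsub>F\<^esub> (R t \<otimes>\<^bsub>F\<^esub> R t)" using const_quadratic by blast
    \<comment> \<open>The image of \<open>t\<close> times the imaginary unit has the same square as
      \<open>E\<close>, so \<open>E\<close> equals it up to sign.\<close>
    let ?Y = "C (Complex 0 t)"
    have YY: "?Y \<otimes>\<^bsub>F\<^esub> ?Y = E \<otimes>\<^bsub>F\<^esub> E"
    proof -
      have "?Y \<otimes>\<^bsub>F\<^esub> ?Y = C (Complex 0 t * Complex 0 t)" by (simp only: C_mult)
      also have "Complex 0 t * Complex 0 t = Complex (- (t * t)) 0" by (simp add: complex_eq_iff)
      also have "C \<dots> = \<ominus>\<^bsub>F\<^esub> (R t \<otimes>\<^bsub>F\<^esub> R t)" using J by (simp add: C_def R_0 R_minus R_mult)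
      finally show ?thesis using E(3) by simp
    qed
    have "(E \<ominus>\<^bsub>F\<^esub> ?Y) \<otimes>\<^bsub>F\<^esub> (E \<oplus>\<^bsub>F\<^esub> ?Y) = E \<otimes>\<^bsub>F\<^esub> E \<ominus>\<^bsub>F\<^esub> ?Y \<otimes>\<^bsub>F\<^esub> ?Y"
    proof -
      have "(E \<ominus>\<^bsub>F\<^esub> ?Y) \<otimes>\<^bsub>F\<^esub> (E \<oplus>\<^bsub>F\<^esub> ?Y) = (E \<otimes>\<^bsub>F\<^esub> E \<oplus>\<^bsub>F\<^esub> E \<otimes>\<^bsub>F\<^esub> ?Y) \<oplus>\<^bsub>F\<^esub>
          (\<ominus>\<^bsub>F\<^esub> (E \<otimes>\<^bsub>F\<^esub> ?Y) \<oplus>\<^bsub>F\<^esub> \<ominus>\<^bsub>F\<^esub> (?Y \<otimes>\<^bsub>F\<^esub> ?Y))"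
        using E(1) by (simp add: a_minus_def F.l_distr F.r_distr F.l_minus F.m_comm[of ?Y E] F.a_ac)
      also have "\<dots> = E \<otimes>\<^bsub>F\<^esub> E \<ominus>\<^bsub>F\<^esub> ?Y \<otimes>\<^bsub>F\<^esub> ?Y"
        using E(1) by (simp add: a_minus_def F.a_assoc F.r_neg2)
      finally show ?thesis .
    qed
    also have "\<dots> = \<zero>\<^bsub>F\<^esub>" using E(1) by (simp add: YY a_minus_def F.r_neg)
    finally have "E \<ominus>\<^bsub>F\<^esub> ?Y = \<zero>\<^bsub>F\<^esub> \<or> E \<oplus>\<^bsub>F\<^esub> ?Y = \<zero>\<^bsub>F\<^esub>"
      by (rule F.integral) (use E(1) in simp_all)
    then have "E = ?Y \<or> E = C (- Complex 0 t)"
      using E(1) F.minus_equality[of E ?Y] by (auto simp: C_minus)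
    then obtain y where "E = C y" by blast
    moreover have "R s = C (complex_of_real s)" using J by (simp add: C_def R_0)
    ultimately have "seq_class g (\<lambda>_. c) = C (y + complex_of_real s)" using E(2) by (simp add: C_add)
    then show ?thesis by blast
  qed
  have "range C = carrier F"
    by (rule surj_from_complete[where c = 1]) (simp_all add: C_diff C_abs const)
  moreover have "inj C"
  proof (rule injI)
    fix x y assume "C x = C y"
    then have "C (x - y) = \<zero>\<^bsub>F\<^esub>" by (simp add: C_diff a_minus_def F.r_neg)
    then have "completion_abs g (C (x - y)) = 0" using completion_abs_0_iff[OF g, of "\<zero>\<^bsub>F\<^esub>"] by simp
    then show "x = y" by (simp add: C_abs)
  qed
  ultimately have "bij_betw C (carrier type_ring) (carrier F)" by (simp add: bij_betw_def)
  moreover have "C \<in> ring_hom type_ring F"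
    by (rule ring_hom_memI) (simp_all add: C_mult C_add C_1)
  ultimately show ?thesis by (auto simp: is_ring_iso_def ring_iso_def)
qed

end

text \<open>A positive power has the same Cauchy sequences and the same null sequences, so the two
  quotients are literally equal.\<close>

lemma field_completion_powr:
  assumes f: "absolute_value f" and g: "absolute_value g" and t: "t > 0" "\<And>x. g x = f x powr t"
  shows "field_completion g = field_completion f"
proof -
  have sub: "Cau f \<subseteq> Cau g" "Nul f \<subseteq> Nul g"
    if f: "absolute_value f" and t: "t > 0" "\<And>x. g x = f x powr t" for f g :: "'a::field \<Rightarrow> real" and t
  proof -
    show "Cau f \<subseteq> Cau g"
    proof
      fix x assume x: "x \<in> Cau f"
      show "x \<in> Cau g"
        unfolding Cau_iff
      proof (intro allI impI)
        fix e :: real assume e: "e > 0"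
        then obtain N where N: "\<forall>m\<ge>N. \<forall>n\<ge>N. f (x m - x n) < e powr (1 / t)" using CauD[OF x, of "e powr (1 / t)"] by auto
        have "g (x m - x n) < e" if "m \<ge> N" "n \<ge> N" for m n
        proof -
          have "f (x m - x n) powr t < (e powr (1 / t)) powr t"
            using N that f t(1) by (intro powr_less_mono2) auto
          then show ?thesis using t e by (simp add: powr_powr)
        qed
        then show "\<exists>N. \<forall>m\<ge>N. \<forall>n\<ge>N. g (x m - x n) < e" by blast
      qed
    qed
    show "Nul f \<subseteq> Nul g"
    proof
      fix x assume "x \<in> Nul f"
      then have "(\<lambda>n. f (x n) powr t) \<longlonglongrightarrow> 0 powr t"
        using t(1) f by (intro tendsto_powr' tendsto_const) (auto simp: Nul_iff)
      then show "x \<in> Nul g" using t by (simp add: Nul_iff)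
    qed
  qed
  have "f x = g x powr (1 / t)" for x using t f by (simp add: powr_powr)
  then have "Cau g \<subseteq> Cau f" "Nul g \<subseteq> Nul f" using sub[OF g, of "1 / t" f] t(1) by auto
  then have "Cau g = Cau f" "Nul g = Nul f" using sub[OF f t] by auto
  then show ?thesis by (simp add: field_completion_def cauchy_ring_def)
qed

text \<open>Ostrowski's exponent \<open>s\<close> is removed by passing to \<open>g\<close>, the
  power \<open>1 / s\<close> of \<open>f\<close>. Powers of an absolute value can violate the
  triangle inequality; for \<open>g\<close> it is recovered from the values on \<nat> by binomial
  expansion and \<open>k\<close>-th roots.\<close>

lemma archimedean_real_or_complex:
  fixes f :: "'a::field_char_0 \<Rightarrow> real"
  assumes K: "number_field TYPE('a)" and f: "absolute_value f" "\<not> nonarchimedean f"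
  shows "(type_ring :: real ring) \<simeq> field_completion f \<or> (type_ring :: complex ring) \<simeq> field_completion f"
proof -
  obtain s where s: "0 < s" "\<And>q. f (of_rat q) = \<bar>real_of_rat q\<bar> powr s"
    using archimedean_on_rat[OF f] by blast
  define g where "g x = f x powr (1 / s)" for x
  have fg: "f x = g x powr s" for x using s(1) f(1) by (simp add: g_def powr_powr)
  have g0: "g x \<ge> 0" for x by (simp add: g_def)
  have g_rat: "g (of_rat q) = \<bar>real_of_rat q\<bar>" for q using s by (simp add: g_def powr_powr)
  have g_mult: "g (x * y) = g x * g y" for x y using f by (simp add: g_def av_mult powr_mult)
  have g_pow: "g (x ^ k) = g x ^ k" for x k
    by (induction k) (use g_rat[of 1] in \<open>simp_all add: g_mult\<close>)
  have g_nat: "g (of_nat n) = real n" for n using g_rat[of "of_nat n"] by simp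
  have g_triangle: "g (x + y) \<le> g x + g y" for x y
  proof (rule ccontr)
    assume "\<not> ?thesis"
    then have "(g x + g y) powr s < g (x + y) powr s" using g0 s(1) by (intro powr_less_mono2) auto
    moreover have "f (x + y) \<le> (g x + g y) powr s"
    proof (rule power_growth_le[where C = 1])
      fix k
      have "f (x + y) ^ k = f (\<Sum>i\<le>k. of_nat (k choose i) * x ^ i * y ^ (k - i))"
        by (simp add: av_power[OF f(1), symmetric] binomial_ring)
      also have "\<dots> \<le> (\<Sum>i\<le>k. f (of_nat (k choose i) * x ^ i * y ^ (k - i)))" by (rule av_sum[OF f(1)])
      also have "\<dots> \<le> (\<Sum>i\<le>k. ((g x + g y) ^ k) powr s)"
      proof (rule sum_mono)
        fix i assume i: "i \<in> {..k}"
        \<comment> \<open>Since \<open>g (of_nat n)\<close> is \<open>n\<close>, the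
          \<open>g\<close>-value of each term is one summand of the real binomial expansion of
          \<open>(g x + g y) ^ k\<close>.\<close>
        have "real (k choose i) * g x ^ i * g y ^ (k - i) \<le> (\<Sum>i\<le>k. real (k choose i) * g x ^ i * g y ^ (k - i))"
          using i g0 by (intro member_le_sum) auto
        also have "\<dots> = (g x + g y) ^ k" by (simp add: binomial_ring)
        finally show "f (of_nat (k choose i) * x ^ i * y ^ (k - i)) \<le> ((g x + g y) ^ k) powr s"
          unfolding fg g_mult g_pow g_nat using g0 s(1) by (intro powr_mono2) auto
      qed
      also have "\<dots> = 1 * (real k + 1) * ((g x + g y) powr s) ^ k"
      proof (cases "g x + g y = 0")
        case True
        then show ?thesis using s(1) by (cases k) auto
      next
        case False
        then have "g x + g y > 0" using g0[of x] g0[of y] by linarith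
        then have "((g x + g y) ^ k) powr s = ((g x + g y) powr s) ^ k"
          by (simp add: powr_powr mult.commute flip: powr_realpow)
        then show ?thesis by (simp add: algebra_simps)
      qed
      finally show "f (x + y) ^ k \<le> 1 * (real k + 1) * ((g x + g y) powr s) ^ k" .
    qed simp
    ultimately show False by (simp add: fg)
  qed
  have g: "absolute_value g"
    unfolding absolute_value_def using g0 g_mult g_triangle f(1) by (auto simp: g_def)
  interpret archimedean_completion g
    by unfold_locales (rule K g g_rat)+
  show ?thesis
    using real_or_complex field_completion_powr[OF f(1) g, of "1 / s"] s(1) by (simp add: g_def)
qed

section \<open>Matching the places\<close>

lemma term_value_type_ring [simp]: "term_value type_ring e t = term_at e t"
  by (induction t) (simp_all add: type_ring_minus)

lemma holds_in_type_ring: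
  fixes e :: "nat \<Rightarrow> 'a::field"
  shows "sentence p \<Longrightarrow> holds_in (type_ring :: 'a ring) p \<longleftrightarrow> satisfies type_ring e p"
  by (rule holds_in_iff[where i = 0]) auto

lemma roots_formula_real:
  assumes "odd l"
  shows "holds_in (type_ring :: real ring) (roots_formula l)"
proof -
  have "\<exists>y. y ^ l = x" for x :: real
    using odd_real_root_pow[OF assms] by blast
  then show ?thesis
    unfolding holds_in_type_ring[OF sentence_roots_formula, where e = "\<lambda>_. 0"]
    by (simp add: roots_formula_def)
qed

lemma roots_formula_complex:
  assumes "l > 0"
  shows "holds_in (type_ring :: complex ring) (roots_formula l)"
proof -
  have "\<exists>y. y ^ l = x" for x :: complex
  proof
    show "rcis (root l (cmod x)) (Arg x / real l) ^ l = x"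
      using assms by (simp add: DeMoivre2 rcis_cmod_Arg)
  qed
  then show ?thesis
    unfolding holds_in_type_ring[OF sentence_roots_formula, where e = "\<lambda>_. 0"]
    by (simp add: roots_formula_def)
qed

lemma completion_ring: "absolute_value f \<Longrightarrow> ring (field_completion f)"
  using completion_cring[of f] by (simp add: cring_def)

lemma roots_formula_archimedean:
  fixes f :: "'a::field_char_0 \<Rightarrow> real"
  assumes K: "number_field TYPE('a)" and f: "absolute_value f" "\<not> nonarchimedean f" and l: "odd l"
  shows "holds_in (field_completion f) (roots_formula l)"
  using archimedean_real_or_complex[OF K f]
proof
  assume "(type_ring :: real ring) \<simeq> field_completion f"
  from holds_in_iso[OF type_ring_ring completion_ring[OF f(1)] this sentence_roots_formula]
  show ?thesis using roots_formula_real[OF l] by simp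
next
  assume "(type_ring :: complex ring) \<simeq> field_completion f"
  from holds_in_iso[OF type_ring_ring completion_ring[OF f(1)] this sentence_roots_formula]
  show ?thesis using roots_formula_complex[OF odd_pos[OF l]] by simp
qed

section \<open>Telling the reals from the complex numbers\<close>

definition square_formula :: ring_formula where
  "square_formula = Exist 0 (Equal (Plus (Times (Var 0) (Var 0)) One) Zero)"

lemma sentence_square_formula: "sentence square_formula"
  by (simp add: sentence_def square_formula_def)

lemma square_formula_real: "\<not> holds_in (type_ring :: real ring) square_formula"
proof -
  have "x * x + 1 \<noteq> 0" for x :: real
    using zero_le_square[of x] by linarith
  then show ?thesis
    unfolding holds_in_type_ring[OF sentence_square_formula, where e = "\<lambda>_. 0"]
    by (simp add: square_formula_def)
qed

lemma square_formula_complex: "holds_in (type_ring :: complex ring) square_formula"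
proof -
  have "\<exists>x :: complex. x * x + 1 = 0" by (rule exI[of _ \<i>]) simp
  then show ?thesis
    unfolding holds_in_type_ring[OF sentence_square_formula, where e = "\<lambda>_. 0"]
    by (simp add: square_formula_def)
qed

lemma square_formula_completion_real:
  assumes "absolute_value h" "(type_ring :: real ring) \<simeq> field_completion h"
  shows "\<not> holds_in (field_completion h) square_formula"
  using holds_in_iso[OF type_ring_ring completion_ring[OF assms(1)] assms(2) sentence_square_formula]
    square_formula_real by simp

lemma square_formula_completion_complex:
  assumes "absolute_value h" "(type_ring :: complex ring) \<simeq> field_completion h"
  shows "holds_in (field_completion h) square_formula"
  using holds_in_iso[OF type_ring_ring completion_ring[OF assms(1)] assms(2) sentence_square_formula]
    square_formula_complex by simp

lemma archimedean_equivalent_isomorphic: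
  fixes f :: "'a::field_char_0 \<Rightarrow> real" and g :: "'b::field_char_0 \<Rightarrow> real"
  assumes K: "number_field TYPE('a)" and L: "number_field TYPE('b)"
    and f: "absolute_value f" "\<not> nonarchimedean f" and g: "absolute_value g" "\<not> nonarchimedean g"
    and equiv: "\<And>q. sentence q \<Longrightarrow> holds_in (field_completion f) q \<longleftrightarrow> holds_in (field_completion g) q"
  shows "field_completion f \<simeq> field_completion g"
proof -
  let ?F = "field_completion f" and ?G = "field_completion g"
  consider "(type_ring :: real ring) \<simeq> ?F" "(type_ring :: real ring) \<simeq> ?G"
    | "(type_ring :: complex ring) \<simeq> ?F" "(type_ring :: complex ring) \<simeq> ?G"
    using archimedean_real_or_complex[OF K f] archimedean_real_or_complex[OF L g]
      square_formula_completion_real[OF f(1)] square_formula_completion_real[OF g(1)]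
      square_formula_completion_complex[OF f(1)] square_formula_completion_complex[OF g(1)] equiv[OF sentence_square_formula] by blast
  then show ?thesis
  proof cases
    case 1
    show ?thesis by (rule ring_iso_trans[OF ring_iso_sym[OF type_ring_ring 1(1)] 1(2)])
  next
    case 2
    show ?thesis by (rule ring_iso_trans[OF ring_iso_sym[OF type_ring_ring 2(1)] 2(2)])
  qed
qed

lemma holds_in_completion_Negation:
  assumes f: "absolute_value f" and p: "sentence p"
  shows "holds_in (field_completion f) (Negation p) \<longleftrightarrow> \<not> holds_in (field_completion f) p"
proof -
  have "sentence (Negation p)" using p by (simp add: sentence_def)
  then show ?thesis
    using holds_in_completion_iff[OF f, of _ "\<lambda>_ _. 0"] p f by simp
qed

lemma holds_in_completion_Conjs:
  assumes f: "absolute_value f" and ps: "\<And>p. p \<in> set ps \<Longrightarrow> sentence p"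
  shows "holds_in (field_completion f) (Conjs ps) \<longleftrightarrow> (\<forall>p\<in>set ps. holds_in (field_completion f) p)"
proof -
  have "sentence (Conjs ps)" using ps by (auto simp: sentence_def)
  then show ?thesis
    using holds_in_completion_iff[OF f, of _ "\<lambda>_ _. 0"] ps f by simp
qed

section \<open>Theories of places\<close>

definition place_theory :: "('k::field \<Rightarrow> real) set \<Rightarrow> ring_formula set" where
  "place_theory v = {p. sentence p \<and> holds_in (completion_at v) p}"

lemma place_theory_eqD:
  "place_theory v = place_theory w \<Longrightarrow> sentence p \<Longrightarrow> holds_in (completion_at v) p \<longleftrightarrow> holds_in (completion_at w) p"
  by (auto simp: place_theory_def)

text \<open>The sentence fails at non-archimedean places whose residue characteristic is neither
  \<open>p\<close> nor \<open>l\<close>; the remaining places are finite in number, whatever holds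
  there.\<close>

lemma finite_char_formula_models:
  assumes K: "number_field TYPE('a::field_char_0)" and p: "prime p" and l: "prime l"
  shows "finite {v :: ('a \<Rightarrow> real) set. v \<in> places \<and> holds_in (completion_at v) (char_formula p l)}"
proof (rule finite_subset)
  show "{v :: ('a \<Rightarrow> real) set. v \<in> places \<and> holds_in (completion_at v) (char_formula p l)} \<subseteq>
      {v. v \<in> places \<and> lies_over p (place_abs v)} \<union> {v. v \<in> places \<and> lies_over l (place_abs v)} \<union>
      {v. v \<in> places \<and> \<not> nonarchimedean (place_abs v)}"
  proof
    fix v :: "('a \<Rightarrow> real) set"
    assume v: "v \<in> {v. v \<in> places \<and> holds_in (completion_at v) (char_formula p l)}"
    show "v \<in> {v. v \<in> places \<and> lies_over p (place_abs v)} \<union> {v. v \<in> places \<and> lies_over l (place_abs v)} \<union>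
        {v. v \<in> places \<and> \<not> nonarchimedean (place_abs v)}"
    proof (cases "nonarchimedean (place_abs v)")
      case True
      then obtain q where q: "lies_over q (place_abs v)"
        using nonarch_lies_over[OF K place_abs_nontrivial] v by blast
      then have "p = q \<or> l = q" using char_formula_not_over[OF q p _ l] v by blast
      then show ?thesis using q v by blast
    qed (use v in blast)
  qed
qed (intro finite_UnI finite_places_over[OF K] finite_archimedean_places[OF K])

lemma finite_roots_formula_models:
  assumes K: "number_field TYPE('a::field_char_0)" and d: "dim_at_most TYPE('a) d" "d < l"
  shows "finite {v :: ('a \<Rightarrow> real) set. v \<in> places \<and> holds_in (completion_at v) (roots_formula l)}"
proof (rule finite_subset[OF _ finite_archimedean_places[OF K]])
  show "{v :: ('a \<Rightarrow> real) set. v \<in> places \<and> holds_in (completion_at v) (roots_formula l)} \<subseteq>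
      {v. v \<in> places \<and> \<not> nonarchimedean (place_abs v)}"
    using roots_formula_over[OF d] nonarch_lies_over[OF K place_abs_nontrivial] by blast
qed

lemma nonarchimedean_iff_roots_formula:
  fixes v :: "('a::field_char_0 \<Rightarrow> real) set"
  assumes K: "number_field TYPE('a)" and d: "dim_at_most TYPE('a) d" "d < l" and l: "odd l" and v: "v \<in> places"
  shows "nonarchimedean (place_abs v) \<longleftrightarrow> \<not> holds_in (completion_at v) (roots_formula l)"
proof
  assume "nonarchimedean (place_abs v)"
  then obtain p where "lies_over p (place_abs v)" using nonarch_lies_over[OF K place_abs_nontrivial[OF v]] by blast
  then show "\<not> holds_in (completion_at v) (roots_formula l)" by (rule roots_formula_over[OF d])
next
  assume "\<not> holds_in (completion_at v) (roots_formula l)"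
  then show "nonarchimedean (place_abs v)"
    using roots_formula_archimedean[OF K place_abs_av[OF v] _ l] by blast
qed

lemma odd_prime_exceeding:
  obtains l :: nat where "prime l" "l > n" "odd l"
proof -
  obtain l where "prime l" "l > max n 2" using bigger_prime by blast
  then show ?thesis using that primes_dvd_imp_eq[of 2 l] two_is_prime_nat by fastforce
qed

text \<open>At a place over \<open>p\<close> the sentence is \<open>char_formula\<close>, whose
  models are finite in number for every prime \<open>l\<close>. At an archimedean place it is
  \<open>roots_formula\<close>, which fails at the non-archimedean places of both fields only once
  \<open>l\<close> is above both degrees.\<close>

lemma finite_model_sentence:
  fixes v :: "('a::field_char_0 \<Rightarrow> real) set"
  assumes K: "number_field TYPE('a)" and L: "number_field TYPE('b::field_char_0)" and v: "v \<in> places"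
  shows "\<exists>p\<in>place_theory v. finite {u :: ('a \<Rightarrow> real) set. u \<in> places \<and> p \<in> place_theory u} \<and>
    finite {w :: ('b \<Rightarrow> real) set. w \<in> places \<and> p \<in> place_theory w}"
proof -
  obtain d where d: "dim_at_most TYPE('a) d" using number_field_dim[OF K] .
  obtain d' where d': "dim_at_most TYPE('b) d'" using number_field_dim[OF L] .
  show ?thesis
  proof (cases "nonarchimedean (place_abs v)")
    case True
    then obtain p where p: "lies_over p (place_abs v)" using nonarch_lies_over[OF K place_abs_nontrivial[OF v]] by blast
    obtain l where l: "prime l" "l > d + p" "odd l" by (rule odd_prime_exceeding)
    have pp: "prime p" using p by (simp add: lies_over_def)
    have "holds_in (completion_at v) (char_formula p l)" using l by (intro char_formula_over[OF d _ p]) auto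
    then show ?thesis
      using finite_char_formula_models[OF K pp l(1)] finite_char_formula_models[OF L pp l(1)]
      by (intro bexI[of _ "char_formula p l"]) (auto simp: place_theory_def sentence_char_formula)
  next
    case False
    obtain l where l: "prime l" "l > d + d'" "odd l" by (rule odd_prime_exceeding)
    have "holds_in (completion_at v) (roots_formula l)"
      by (rule roots_formula_archimedean[OF K place_abs_av[OF v] False l(3)])
    then show ?thesis
      using finite_roots_formula_models[OF K d, of l] finite_roots_formula_models[OF L d', of l] l(2)
      by (intro bexI[of _ "roots_formula l"]) (auto simp: place_theory_def sentence_roots_formula)
  qed
qed

text \<open>Place theories are complete: when one is strictly contained in another, the negation of
  an extra sentence separates them in the other direction.\<close>

lemma place_theories_separated:
  assumes v: "v \<in> places" and w: "w \<in> places" and neq: "place_theory v \<noteq> place_theory w"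
  shows "\<exists>p\<in>place_theory v. p \<notin> place_theory w"
proof (cases "place_theory v \<subseteq> place_theory w")
  case True
  then obtain p where p: "p \<in> place_theory w" "p \<notin> place_theory v" using neq by blast
  then have "sentence p" by (simp add: place_theory_def)
  then have "Negation p \<in> place_theory v" "Negation p \<notin> place_theory w"
    using p holds_in_completion_Negation[OF place_abs_av[OF v]] holds_in_completion_Negation[OF place_abs_av[OF w]]
    by (auto simp: place_theory_def sentence_def)
  then show ?thesis by blast
qed blast

lemma Conjs_in_place_theory:
  "v \<in> places \<Longrightarrow> (\<And>p. p \<in> set ps \<Longrightarrow> sentence p) \<Longrightarrow> Conjs ps \<in> place_theory v \<longleftrightarrow> set ps \<subseteq> place_theory v"
  by (auto simp: place_theory_def holds_in_completion_Conjs sentence_def)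

text \<open>Only finitely many theories compete with that of \<open>v\<close>, so one sentence separates it from all of them.\<close>

lemma isolating_sentence:
  fixes v :: "('a::field_char_0 \<Rightarrow> real) set"
  assumes K: "number_field TYPE('a)" and L: "number_field TYPE('b::field_char_0)" and v: "v \<in> places"
  shows "\<exists>p. sentence p \<and>
    finite {u :: ('a \<Rightarrow> real) set. u \<in> places \<and> p \<in> place_theory u} \<and>
    finite {w :: ('b \<Rightarrow> real) set. w \<in> places \<and> p \<in> place_theory w} \<and>
    (\<forall>u :: ('a \<Rightarrow> real) set. u \<in> places \<longrightarrow> (p \<in> place_theory u \<longleftrightarrow> place_theory u = place_theory v)) \<and>
    (\<forall>w :: ('b \<Rightarrow> real) set. w \<in> places \<longrightarrow> (p \<in> place_theory w \<longleftrightarrow> place_theory w = place_theory v))"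
proof -
  obtain q where q: "q \<in> place_theory v" "finite {u :: ('a \<Rightarrow> real) set. u \<in> places \<and> q \<in> place_theory u}"
    "finite {w :: ('b \<Rightarrow> real) set. w \<in> places \<and> q \<in> place_theory w}"
    using finite_model_sentence[OF K L v] by blast
  \<comment> \<open>The competitors: theories other than that of \<open>v\<close> that are realised,
    over either field, at a place where \<open>q\<close> holds.\<close>
  define \<T> where "\<T> = place_theory ` {u :: ('a \<Rightarrow> real) set. u \<in> places \<and> q \<in> place_theory u} \<union>
    place_theory ` {w :: ('b \<Rightarrow> real) set. w \<in> places \<and> q \<in> place_theory w} - {place_theory v}"
  have "finite \<T>" using q(2,3) by (simp add: \<T>_def)
  have "\<exists>p\<in>place_theory v. p \<notin> T" if T: "T \<in> \<T>" for T
  proof -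
    have neq: "place_theory v \<noteq> T" using that by (auto simp: \<T>_def)
    consider u :: "('a \<Rightarrow> real) set" where "u \<in> places" "T = place_theory u"
      | w :: "('b \<Rightarrow> real) set" where "w \<in> places" "T = place_theory w"
      using T by (auto simp: \<T>_def)
    then show ?thesis
    proof cases
      case 1
      then show ?thesis using place_theories_separated[OF v 1(1)] neq by simp
    next
      case 2
      then show ?thesis using place_theories_separated[OF v 2(1)] neq by simp
    qed
  qed
  then obtain sep where sep: "\<And>T. T \<in> \<T> \<Longrightarrow> sep T \<in> place_theory v" "\<And>T. T \<in> \<T> \<Longrightarrow> sep T \<notin> T" by metis
  obtain ps where ps: "set ps = insert q (sep ` \<T>)" using finite_list \<open>finite \<T>\<close> by (metis finite_imageI finite_insert)
  have sub: "set ps \<subseteq> place_theory v" using ps q(1) sep(1) by auto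
  then have sent: "\<And>p. p \<in> set ps \<Longrightarrow> sentence p" by (auto simp: place_theory_def)
  \<comment> \<open>Containing all of \<open>ps\<close> rules out every competitor, since each of
    them misses its own separating sentence.\<close>
  have iff: "set ps \<subseteq> T \<longleftrightarrow> T = place_theory v" if "q \<in> T \<Longrightarrow> T = place_theory v \<or> T \<in> \<T>" for T
  proof
    assume T: "set ps \<subseteq> T"
    then have "T \<notin> \<T>" using ps sep(2)[of T] by blast
    then show "T = place_theory v" using that T ps by blast
  qed (use sub in simp)
  have iffK: "Conjs ps \<in> place_theory u \<longleftrightarrow> place_theory u = place_theory v" if u: "u \<in> places" for u :: "('a \<Rightarrow> real) set"
  proof -
    have "Conjs ps \<in> place_theory u \<longleftrightarrow> set ps \<subseteq> place_theory u"
      using u sent by (rule Conjs_in_place_theory)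
    also have "\<dots> \<longleftrightarrow> place_theory u = place_theory v"
      by (rule iff) (use u in \<open>auto simp: \<T>_def\<close>)
    finally show ?thesis .
  qed
  have iffL: "Conjs ps \<in> place_theory w \<longleftrightarrow> place_theory w = place_theory v" if w: "w \<in> places" for w :: "('b \<Rightarrow> real) set"
  proof -
    have "Conjs ps \<in> place_theory w \<longleftrightarrow> set ps \<subseteq> place_theory w"
      using w sent by (rule Conjs_in_place_theory)
    also have "\<dots> \<longleftrightarrow> place_theory w = place_theory v"
      by (rule iff) (use w in \<open>auto simp: \<T>_def\<close>)
    finally show ?thesis .
  qed
  show ?thesis
  proof (intro exI[of _ "Conjs ps"] conjI allI impI)
    show "sentence (Conjs ps)" using sent by (auto simp: sentence_def)
    show "finite {u :: ('a \<Rightarrow> real) set. u \<in> places \<and> Conjs ps \<in> place_theory u}"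
      by (rule finite_subset[OF _ q(2)]) (use iffK q(1) in auto)
    show "finite {w :: ('b \<Rightarrow> real) set. w \<in> places \<and> Conjs ps \<in> place_theory w}"
      by (rule finite_subset[OF _ q(3)]) (use iffL q(1) in auto)
  qed (rule iffK iffL, assumption)+
qed

text \<open>A bijection is chosen for each common value and the choices are glued, since the fibres
  partition both sets.\<close>

lemma bij_betw_of_fibres:
  assumes "\<And>c. finite {a \<in> A. f a = c}" "\<And>c. finite {b \<in> B. g b = c}"
    and "\<And>c. card {a \<in> A. f a = c} = card {b \<in> B. g b = c}"
  shows "\<exists>s. bij_betw s A B \<and> (\<forall>a\<in>A. g (s a) = f a)"
proof -
  have "\<exists>s. bij_betw s {a \<in> A. f a = c} {b \<in> B. g b = c}" for c
    using finite_same_card_bij[OF assms] .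
  then obtain s where s: "\<And>c. bij_betw (s c) {a \<in> A. f a = c} {b \<in> B. g b = c}" by metis
  let ?s = "\<lambda>a. s (f a) a"
  have in_fibre: "?s a \<in> B" "g (?s a) = f a" if "a \<in> A" for a
    using bij_betwE[OF s[of "f a"]] that by auto
  have "bij_betw ?s A B"
  proof (rule bij_betw_imageI)
    show "inj_on ?s A"
    proof (rule inj_onI)
      fix a a' assume a: "a \<in> A" "a' \<in> A" "?s a = ?s a'"
      then have eq: "f a = f a'" using in_fibre by metis
      have "inj_on (s (f a)) {x \<in> A. f x = f a}" using s bij_betw_def by blast
      then show "a = a'" using a eq by (auto simp: inj_on_def)
    qed
    show "?s ` A = B"
    proof (intro equalityI subsetI)
      fix b assume "b \<in> B"
      then have "b \<in> s (g b) ` {a \<in> A. f a = g b}" using s[of "g b"] by (auto simp: bij_betw_def)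
      then obtain a where "a \<in> A" "f a = g b" "b = s (g b) a" by auto
      then show "b \<in> ?s ` A" by (intro image_eqI[of _ _ a]) simp_all
    qed (use in_fibre in auto)
  qed
  then show ?thesis using in_fibre by (intro exI[of _ ?s]) auto
qed

text \<open>The isolating sentence has exactly the fibre as its set of models, so the fibre is
  finite and \<open>models_card\<close> compares the two sides.\<close>

lemma place_theory_fibres:
  fixes v :: "('k::field_char_0 \<Rightarrow> real) set"
  assumes K: "number_field TYPE('k)" and L: "number_field TYPE('l::field_char_0)"
    and eq: "elementarily_equivalent (adeles :: 'k adele ring) (adeles :: 'l adele ring)"
    and v: "v \<in> places"
  defines "S \<equiv> {u :: ('k \<Rightarrow> real) set. u \<in> places \<and> place_theory u = place_theory v}"
    and "T \<equiv> {w :: ('l \<Rightarrow> real) set. w \<in> places \<and> place_theory w = place_theory v}"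
  shows "finite S \<and> finite T \<and> card S = card T"
proof -
  obtain p where p: "sentence p"
    "finite {u :: ('k \<Rightarrow> real) set. u \<in> places \<and> p \<in> place_theory u}"
    "finite {w :: ('l \<Rightarrow> real) set. w \<in> places \<and> p \<in> place_theory w}"
    "\<forall>u :: ('k \<Rightarrow> real) set. u \<in> places \<longrightarrow> (p \<in> place_theory u \<longleftrightarrow> place_theory u = place_theory v)"
    "\<forall>w :: ('l \<Rightarrow> real) set. w \<in> places \<longrightarrow> (p \<in> place_theory w \<longleftrightarrow> place_theory w = place_theory v)"
    using isolating_sentence[OF K L v] by (elim exE conjE)
  have S: "S = {u. u \<in> places \<and> holds_in (completion_at u) p}"
    and T: "T = {w. w \<in> places \<and> holds_in (completion_at w) p}"
    using p(1,4,5) by (auto simp: S_def T_def place_theory_def)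
  have "finite S" "finite T" using p(1-3) by (simp_all add: S T place_theory_def)
  then show ?thesis using models_card[OF eq p(1)] by (simp add: S T)
qed

theorem theorem3p5:
  assumes "number_field TYPE('k::field_char_0)"
    and "number_field TYPE('l::field_char_0)"
    and "elementarily_equivalent (adele_ring TYPE('k)) (adele_ring TYPE('l))"
  shows "adele_ring TYPE('k) \<simeq> adele_ring TYPE('l)"
proof -
  note K = assms(1) and L = assms(2)
  have sym: "elementarily_equivalent (adele_ring TYPE('l)) (adele_ring TYPE('k))"
    using assms(3) by (simp add: elementarily_equivalent_def)
  \<comment> \<open>A theory \<open>c\<close> may occur at places of either field or of neither; the
    symmetric hypothesis handles theories found over the second field.\<close>
  have fibres: "finite {u \<in> places :: ('k \<Rightarrow> real) set set. place_theory u = c} \<and>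
      finite {w \<in> places :: ('l \<Rightarrow> real) set set. place_theory w = c} \<and>
      card {u \<in> places :: ('k \<Rightarrow> real) set set. place_theory u = c} =
      card {w \<in> places :: ('l \<Rightarrow> real) set set. place_theory w = c}" for c
  proof -
    consider v where "v \<in> (places :: ('k \<Rightarrow> real) set set)" "place_theory v = c"
      | v where "v \<in> (places :: ('l \<Rightarrow> real) set set)" "place_theory v = c"
      | "{u \<in> places :: ('k \<Rightarrow> real) set set. place_theory u = c} = {}"
        "{w \<in> places :: ('l \<Rightarrow> real) set set. place_theory w = c} = {}" by blast
    then show ?thesis
    proof cases
      case 1
      then show ?thesis using place_theory_fibres[OF K L assms(3) 1(1)] by simp
    next
      case 2
      then show ?thesis using place_theory_fibres[OF L K sym 2(1)] by simp
    next
      case 3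
      then show ?thesis by (simp only: finite.emptyI card.empty)
    qed
  qed
  obtain s :: "('k \<Rightarrow> real) set \<Rightarrow> ('l \<Rightarrow> real) set" where s: "bij_betw s places places"
    "\<And>v. v \<in> places \<Longrightarrow> place_theory (s v) = place_theory v"
    using bij_betw_of_fibres[of "places :: ('k \<Rightarrow> real) set set" place_theory
      "places :: ('l \<Rightarrow> real) set set" place_theory] fibres by blast
  obtain d where d: "dim_at_most TYPE('k) d" using number_field_dim[OF K] .
  obtain d' where d': "dim_at_most TYPE('l) d'" using number_field_dim[OF L] .
  \<comment> \<open>Odd and above both degrees, so that \<open>roots_formula\<close> holds exactly
    at the archimedean places of either field.\<close>
  obtain l where l: "prime l" "l > d + d'" "odd l" by (rule odd_prime_exceeding)
  have "\<exists>h. h \<in> ring_iso (completion_at v) (completion_at (s v)) \<and>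
      (nonarchimedean (place_abs v) \<longleftrightarrow> nonarchimedean (place_abs (s v))) \<and>
      (nonarchimedean (place_abs v) \<longrightarrow> (\<forall>U\<in>carrier (completion_at v).
        h U \<in> valuation_ring (place_abs (s v)) \<longleftrightarrow> U \<in> valuation_ring (place_abs v)))"
    if v: "v \<in> places" for v
  proof -
    have w: "s v \<in> places" using s(1) v by (auto simp: bij_betw_def)
    have equiv: "holds_in (completion_at v) q \<longleftrightarrow> holds_in (completion_at (s v)) q" if "sentence q" for q
      using place_theory_eqD[OF s(2)[OF v] that] by simp
    have iff: "nonarchimedean (place_abs v) \<longleftrightarrow> nonarchimedean (place_abs (s v))"
      using nonarchimedean_iff_roots_formula[OF K d _ l(3) v] nonarchimedean_iff_roots_formula[OF L d' _ l(3) w] l(2)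
      using equiv[OF sentence_roots_formula] by simp
    show ?thesis
    proof (cases "nonarchimedean (place_abs v)")
      case True
      then show ?thesis
        using nonarch_equivalent_isomorphic[OF K L v True w _ equiv] iff by blast
    next
      \<comment> \<open>Archimedean places carry no integrality condition, so any ring isomorphism
        serves.\<close>
      case False
      then have "completion_at v \<simeq> completion_at (s v)"
        using iff by (intro archimedean_equivalent_isomorphic[OF K L] equiv place_abs_av v w) auto
      then show ?thesis using False iff by (auto simp: is_ring_iso_def)
    qed
  qed
  then obtain h where h: "\<And>v. v \<in> places \<Longrightarrow> h v \<in> ring_iso (completion_at v) (completion_at (s v)) \<and>
      (nonarchimedean (place_abs v) \<longleftrightarrow> nonarchimedean (place_abs (s v))) \<and>
      (nonarchimedean (place_abs v) \<longrightarrow> (\<forall>U\<in>carrier (completion_at v).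
        h v U \<in> valuation_ring (place_abs (s v)) \<longleftrightarrow> U \<in> valuation_ring (place_abs v)))" by metis
  show ?thesis
    by (rule adeles_isomorphic[OF s(1), of h]) (use h in blast)+
qed

end
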